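(* Let $s\in(0,1)$ and let $(-\Delta)^s$ be the fractional Laplacian in $\mathbb R^2$. Then there exist a bounded $C^\infty$ domain $\Omega\subset\mathbb R^2$, a constant $C_0>0$, and a function $g:\mathbb R^2\setminus\Omega\to\mathbb R$ satisfying $$|g(x)-g(z)|\le C_0|x-z|^s\quad\text{for all }x\in\mathbb R^2\setminus\Omega,\ z\in\partial\Omega,$$ $$|g(x)|\le C_0(1+|x|^s)\quad\text{for all }x\in\mathbb R^2\setminus\Omega,$$ such that the solution $u$ to $$(-\Delta)^su=0\ \text{ in }\Omega,\qquad u=g\ \text{ in }\mathbb R^2\setminus\Omega$$ satisfies $u\notin C^{0,s}(\overline\Omega)$.
   Context: $(-\Delta)^su(x)=c\int_{\mathbb R^2}\big(u(x)-\frac{u(x+y)+u(x-y)}2\big)\frac{dy}{|y|^{2+2s}}$ with the usual positive normalizing constant $c=c(s)$ (its value is irrelevant here). All functions are measurable. "Solution" means a weak or viscosity solution. Viscosity solution: $u\in C(\overline\Omega)$, $u=g$ in $\mathbb R^2\setminus\Omega$, and whenever $x_0\in\Omega$, $B_r(x_0)\subset\Omega$, $\phi\in C^2(\overline{B_r(x_0)})$ with $\phi(x_0)=u(x_0)$ and $\phi\ge u$ (resp. $\phi\le u$) in $B_r(x_0)$, the function $w$ equal to $\phi$ in $B_r(x_0)$ and to $u$ elsewhere satisfies $(-\Delta)^sw(x_0)\le0$ (resp. $\ge0$). Weak solution: $u=g$ in $\mathbb R^2\setminus\Omega$, $\iint_{(\mathbb R^2\times\mathbb R^2)\setminus(\Omega^c\times\Omega^c)}\frac{|u(x)-u(y)|^2}{|x-y|^{2+2s}}dx\,dy<\infty$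 and $\iint_{\mathbb R^2\times\mathbb R^2}\frac{(u(x)-u(y))(\eta(x)-\eta(y))}{|x-y|^{2+2s}}dx\,dy=0$ for all $\eta\in C_c^\infty(\Omega)$. $u\in C^{0,s}(\overline\Omega)$ means $\sup_{\overline\Omega}|u|+\sup_{x\ne y\in\overline\Omega}\frac{|u(x)-u(y)|}{|x-y|^s}<\infty$. *)

theory Defs
  imports "HOL-Analysis.Analysis"
begin

text \<open>The set \<open>U\<close> is meant to be open in the two notions of differentiability below.\<close>

fun Ck_on :: "nat \<Rightarrow> 'a::euclidean_space set \<Rightarrow> ('a \<Rightarrow> real) \<Rightarrow> bool" where
  "Ck_on 0 U f \<longleftrightarrow> continuous_on U f"
| "Ck_on (Suc k) U f \<longleftrightarrow>
     (\<forall>x\<in>U. f differentiable (at x)) \<and>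
     (\<forall>b\<in>Basis. Ck_on k U (\<lambda>x. frechet_derivative f (at x) b))"

definition smooth_on :: "'a::euclidean_space set \<Rightarrow> ('a \<Rightarrow> real) \<Rightarrow> bool" where
  "smooth_on U f \<longleftrightarrow> (\<forall>k. Ck_on k U f)"

text \<open>
  The space of $C^k$ functions on the closure of \<open>U\<close>: all partial derivatives in \<open>U\<close> of order at
  most \<open>k\<close> have continuous extensions to the closure. The values of \<open>f\<close> outside \<open>U\<close> are ignored.
\<close>

definition cont_extends_to_closure :: "'a::euclidean_space set \<Rightarrow> ('a \<Rightarrow> real) \<Rightarrow> bool" where
  "cont_extends_to_closure U f \<longleftrightarrow>
     (\<exists>F. continuous_on (closure U) F \<and> (\<forall>x\<in>U. F x = f x))"

fun Ck_closure :: "nat \<Rightarrow> 'a::euclidean_space set \<Rightarrow> ('a \<Rightarrow> real) \<Rightarrow> bool" where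
  "Ck_closure 0 U f \<longleftrightarrow> cont_extends_to_closure U f"
| "Ck_closure (Suc k) U f \<longleftrightarrow>
     cont_extends_to_closure U f \<and>
     (\<forall>x\<in>U. f differentiable (at x)) \<and>
     (\<forall>b\<in>Basis. Ck_closure k U (\<lambda>x. frechet_derivative f (at x) b))"

definition test_function :: "'a::euclidean_space set \<Rightarrow> ('a \<Rightarrow> real) \<Rightarrow> bool" where
  "test_function \<Omega> \<eta> \<longleftrightarrow>
     smooth_on UNIV \<eta> \<and> compact (closure {x. \<eta> x \<noteq> 0}) \<and> closure {x. \<eta> x \<noteq> 0} \<subseteq> \<Omega>"

text \<open>
  Smoothness of the boundary: near each boundary point \<open>p\<close>, in a suitable orthonormal frame
  \<open>e1\<close>, \<open>e2\<close> centred at \<open>p\<close>, the set is the strict epigraph of a smooth function. For points of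
  \<open>ball p r\<close> the first coordinate lies in the interval \<open>{-r<..<r}\<close>, so \<open>\<gamma>\<close> matters only there.
\<close>

definition bounded_smooth_domain :: "(real^2) set \<Rightarrow> bool" where
  "bounded_smooth_domain \<Omega> \<longleftrightarrow>
     open \<Omega> \<and> connected \<Omega> \<and> \<Omega> \<noteq> {} \<and> bounded \<Omega> \<and>
     (\<forall>p\<in>frontier \<Omega>. \<exists>r>0. \<exists>e1 e2. \<exists>\<gamma>::real \<Rightarrow> real.
        norm e1 = 1 \<and> norm e2 = 1 \<and> e1 \<bullet> e2 = 0 \<and> smooth_on {-r<..<r} \<gamma> \<and>
        (\<forall>x\<in>ball p r. x \<in> \<Omega> \<longleftrightarrow> \<gamma> ((x - p) \<bullet> e1) < (x - p) \<bullet> e2))"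

text \<open>
  The normalizing constant making the Fourier symbol of the operator equal to $|\xi|^{2s}$ in
  dimension two. The integral below is a Bochner integral, with value 0 for a non-integrable
  integrand; it is only applied to measurable functions that are $C^2$ near \<open>x\<close>. If moreover the
  function is \<open>O(1 + |y|^s)\<close>, then the integrand is integrable.
\<close>

definition frac_const :: "real \<Rightarrow> real" where
  "frac_const s = 4 powr s * Gamma (1 + s) / (pi * \<bar>Gamma (- s)\<bar>)"

definition frac_laplacian :: "real \<Rightarrow> (real^2 \<Rightarrow> real) \<Rightarrow> real^2 \<Rightarrow> real" where
  "frac_laplacian s u x =
     frac_const s *
       (LINT y|lebesgue. (u x - (u (x + y) + u (x - y)) / 2) / norm y powr (2 + 2 * s))"

definition viscosity_solution ::
    "real \<Rightarrow> (real^2) set \<Rightarrow> (real^2 \<Rightarrow> real) \<Rightarrow> (real^2 \<Rightarrow> real) \<Rightarrow> bool" where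
  "viscosity_solution s \<Omega> g u \<longleftrightarrow>
     u \<in> borel_measurable lebesgue \<and>
     continuous_on (closure \<Omega>) u \<and>
     (\<forall>x\<in>- \<Omega>. u x = g x) \<and>
     (\<forall>x0\<in>\<Omega>. \<forall>r>0. \<forall>\<phi>. ball x0 r \<subseteq> \<Omega> \<and> Ck_closure 2 (ball x0 r) \<phi> \<and> \<phi> x0 = u x0 \<longrightarrow>
        ((\<forall>x\<in>ball x0 r. u x \<le> \<phi> x) \<longrightarrow>
           frac_laplacian s (\<lambda>x. if x \<in> ball x0 r then \<phi> x else u x) x0 \<le> 0) \<and>
        ((\<forall>x\<in>ball x0 r. \<phi> x \<le> u x) \<longrightarrow>
           0 \<le> frac_laplacian s (\<lambda>x. if x \<in> ball x0 r then \<phi> x else u x) x0))"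

text \<open>
  Double integrals are taken with respect to Lebesgue measure on the product space. In the second
  condition integrability is asserted along with the value 0; it is implied by finiteness of the
  energy.
\<close>

definition weak_solution ::
    "real \<Rightarrow> (real^2) set \<Rightarrow> (real^2 \<Rightarrow> real) \<Rightarrow> (real^2 \<Rightarrow> real) \<Rightarrow> bool" where
  "weak_solution s \<Omega> g u \<longleftrightarrow>
     u \<in> borel_measurable lebesgue \<and>
     (\<forall>x\<in>- \<Omega>. u x = g x) \<and>
     (\<integral>\<^sup>+ (x, y) \<in> UNIV - (- \<Omega>) \<times> (- \<Omega>).
        ennreal (\<bar>u x - u y\<bar>\<^sup>2 / norm (x - y) powr (2 + 2 * s)) \<partial>lebesgue) < \<infinity> \<and>
     (\<forall>\<eta>. test_function \<Omega> \<eta> \<longrightarrow>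
        has_bochner_integral lebesgue
          (\<lambda>(x, y). (u x - u y) * (\<eta> x - \<eta> y) / norm (x - y) powr (2 + 2 * s)) 0)"

definition solution ::
    "real \<Rightarrow> (real^2) set \<Rightarrow> (real^2 \<Rightarrow> real) \<Rightarrow> (real^2 \<Rightarrow> real) \<Rightarrow> bool" where
  "solution s \<Omega> g u \<longleftrightarrow> weak_solution s \<Omega> g u \<or> viscosity_solution s \<Omega> g u"

definition holder_space :: "real \<Rightarrow> 'a::real_normed_vector set \<Rightarrow> ('a \<Rightarrow> real) set" where
  "holder_space s S =
     {u. bdd_above ((\<lambda>x. \<bar>u x\<bar>) ` S) \<and>
         bdd_above {\<bar>u x - u y\<bar> / norm (x - y) powr s | x y. x \<in> S \<and> y \<in> S \<and> x \<noteq> y}}"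

end

theory Submission
  imports Defs
begin

text \<open>
  On the unit disc take exterior data that vanish on the circle and grow like \<open>A * d powr s\<close> away
  from it, where \<open>d\<close> is the distance to the circle. Close to the circle the problem looks like the
  equation on a half-plane \<open>x1 > 0\<close> with data \<open>A * (-x1) powr s\<close> in \<open>x1 < 0\<close>. There the exponent
  \<open>s\<close> is resonant: \<open>(max 0 x1) powr s\<close> is itself annihilated by the operator in \<open>x1 > 0\<close>, while the
  data act on it like a source of size \<open>d powr (-s)\<close>. A resonant source produces a logarithm, so a
  solution should be at least of size \<open>d powr s * ln (1/d)\<close>. Every solution vanishes on the circle, hence a
  solution that is s-Hoelder up to the boundary would be \<open>O(d powr s)\<close>; this is the contradiction.

  The lower bound comes from a barrier. Put \<open>q = max 0 (1 - norm x ^ 2)\<close> and consider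
  \<open>q powr s * ln (1/q)\<close>. At a point where \<open>q = t\<close> write it as
  \<open>ln (1/t) * q powr s + q powr s * ln (t/q)\<close>. The second summand vanishes at the point and varies on
  the scale \<open>t\<close>, so the operator maps it to \<open>O(t powr (-s))\<close>. The first one carries the large
  factor \<open>ln (1/t)\<close>; here one compares \<open>q\<close> with its tangent plane \<open>l\<close>, for which
  \<open>q = l - norm y ^ 2\<close> exactly, with \<open>y\<close> the displacement. The positive part of \<open>l\<close> to the power
  \<open>s\<close> is annihilated (\<open>second_diff_ramp_2D\<close>), and the difference of the two is small enough to absorb
  the logarithm. That gives the bound \<open>C * d powr (-s)\<close> of \<open>barrier_second_diff_integral\<close>. Since the
  data contribute at most \<open>- c * A * d powr (-s)\<close> (\<open>ext_data_integral\<close>), barrier plus data is a strict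
  subsolution once \<open>A\<close> is large (\<open>strict_subsolution\<close>). Invariance in one direction reduces the
  identity for \<open>l\<close> to an integral over the line, which has an explicit primitive up to an inversion
  of the variable (\<open>integral_second_diff_ramp_1D\<close>).

  Comparison is a minimum argument. Where \<open>u\<close> minus the subsolution is minimal and negative, a
  viscosity solution is touched from below by a shifted copy of the barrier, which is smooth inside
  the disc, and the strict inequality is violated (\<open>viscosity_solution_above_barrier\<close>). For a weak
  solution in the Hoelder space the same is done with a mollification, because testing the weak
  equation with a translated bump function says exactly that the mollification satisfies the
  equation pointwise (\<open>weak_solution_mollified\<close>, \<open>weak_solution_above_barrier\<close>).

  A solution exists because the data have finite energy when continued by zero: the energy has a
  minimiser among the functions with the given exterior values, and its Euler-Lagrange equation is
  the weak equation (\<open>energy_minimizer_exists\<close>, \<open>weak_solution_exists\<close>).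
\<close>

section \<open>Smooth functions\<close>

lemma Ck_on_cong:
  fixes f g :: "'a::euclidean_space \<Rightarrow> real"
  assumes "open U" "\<And>x. x \<in> U \<Longrightarrow> f x = g x"
  shows "Ck_on k U f \<longleftrightarrow> Ck_on k U g"
  using assms(2)
proof (induction k arbitrary: f g)
  case 0
  then show ?case by (simp cong: continuous_on_cong)
next
  case (Suc k)
  have D: "f differentiable (at x) \<longleftrightarrow> g differentiable (at x)"
    and F: "frechet_derivative f (at x) = frechet_derivative g (at x)" if "x \<in> U" for x
  proof -
    have *: "(f has_derivative D) (at x) \<longleftrightarrow> (g has_derivative D) (at x)" for D
      using has_derivative_transform_within_open[OF _ \<open>open U\<close> that, of f D UNIV g]
        has_derivative_transform_within_open[OF _ \<open>open U\<close> that, of g D UNIV f] Suc.prems by auto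
    show "f differentiable (at x) \<longleftrightarrow> g differentiable (at x)"
      by (simp add: differentiable_def *)
    show "frechet_derivative f (at x) = frechet_derivative g (at x)"
      by (simp add: frechet_derivative_def *)
  qed
  have "Ck_on k U (\<lambda>x. frechet_derivative f (at x) b) \<longleftrightarrow> Ck_on k U (\<lambda>x. frechet_derivative g (at x) b)" for b
    by (rule Suc.IH) (simp add: F)
  then show ?case using D by auto
qed

text \<open>The higher derivatives of a function such as a power of \<open>1 - norm x ^ 2\<close> never stay in a finite
  family, but they are polynomials in the coordinates and in a few generators. If the first partials of
  the generators \<open>B\<close> lie in this algebra, then \<open>Ck_on\<close> follows for all \<open>k\<close> by one induction.\<close>

inductive_set smooth_algebra :: "('a::euclidean_space \<Rightarrow> real) set \<Rightarrow> ('a \<Rightarrow> real) set"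
  for B where
  const: "(\<lambda>x. c) \<in> smooth_algebra B"
| coord: "(\<lambda>x. x \<bullet> b) \<in> smooth_algebra B"
| base: "f \<in> B \<Longrightarrow> f \<in> smooth_algebra B"
| add: "f \<in> smooth_algebra B \<Longrightarrow> g \<in> smooth_algebra B \<Longrightarrow> (\<lambda>x. f x + g x) \<in> smooth_algebra B"
| mult: "f \<in> smooth_algebra B \<Longrightarrow> g \<in> smooth_algebra B \<Longrightarrow> (\<lambda>x. f x * g x) \<in> smooth_algebra B"

text \<open>The partials \<open>D b\<close> are functions on the whole space that give the derivative at points of \<open>U\<close> only;
  outside \<open>U\<close> powers and logarithms of negative numbers are never looked at.\<close>

definition closed_under_partials :: "'a::euclidean_space set \<Rightarrow> ('a \<Rightarrow> real) set \<Rightarrow> bool" where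
  "closed_under_partials U B \<longleftrightarrow>
     (\<forall>f\<in>B. \<exists>D. (\<forall>b\<in>Basis. D b \<in> smooth_algebra B) \<and>
        (\<forall>x\<in>U. (f has_derivative (\<lambda>h. \<Sum>b\<in>Basis. (h \<bullet> b) * D b x)) (at x)))"

lemma sum_Basis_inner_scaled:
  fixes h x :: "'a::euclidean_space"
  shows "(\<Sum>b\<in>Basis. (h \<bullet> b) * ((c * (x \<bullet> b)) * d)) = c * d * (h \<bullet> x)"
proof -
  have "(\<Sum>b\<in>Basis. (h \<bullet> b) * ((c * (x \<bullet> b)) * d)) = (\<Sum>b\<in>Basis. c * d * ((h \<bullet> b) * (x \<bullet> b)))"
    by (simp add: mult_ac)
  also have "\<dots> = c * d * (h \<bullet> x)"
    by (simp only: euclidean_inner[of h x] sum_distrib_left)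
  finally show ?thesis .
qed

lemma smooth_algebra_has_partials:
  assumes B: "closed_under_partials U B" and f: "f \<in> smooth_algebra B"
  shows "\<exists>D. (\<forall>b\<in>Basis. D b \<in> smooth_algebra B) \<and>
        (\<forall>x\<in>U. (f has_derivative (\<lambda>h. \<Sum>b\<in>Basis. (h \<bullet> b) * D b x)) (at x))"
  using f
proof induction
  case (const c)
  have "(\<lambda>x::'a. 0::real) \<in> smooth_algebra B" by (rule smooth_algebra.const)
  then show ?case by (intro exI[of _ "\<lambda>b x. 0"]) (auto intro!: derivative_eq_intros)
next
  case (coord b)
  have "((\<lambda>x. x \<bullet> b) has_derivative (\<lambda>h. \<Sum>c\<in>Basis. (h \<bullet> c) * (c \<bullet> b))) (at x)" for x :: 'a
    by (rule has_derivative_eq_rhs[OF has_derivative_inner_left[OF has_derivative_ident]])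
       (use sum_Basis_inner_scaled[of _ 1 b 1] in \<open>simp add: fun_eq_iff inner_commute\<close>)
  then show ?case
    by (intro exI[of _ "\<lambda>c x. c \<bullet> b"]) (auto intro: smooth_algebra.const)
next
  case (base f)
  then show ?case using B by (auto simp: closed_under_partials_def)
next
  case (add f g)
  then obtain D E where D: "\<forall>b\<in>Basis. D b \<in> smooth_algebra B" "\<forall>b\<in>Basis. E b \<in> smooth_algebra B"
    "\<forall>x\<in>U. (f has_derivative (\<lambda>h. \<Sum>b\<in>Basis. (h \<bullet> b) * D b x)) (at x)"
    "\<forall>x\<in>U. (g has_derivative (\<lambda>h. \<Sum>b\<in>Basis. (h \<bullet> b) * E b x)) (at x)" by blast
  have "((\<lambda>x. f x + g x) has_derivative (\<lambda>h. \<Sum>b\<in>Basis. (h \<bullet> b) * (D b x + E b x))) (at x)"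
    if "x \<in> U" for x
    by (rule has_derivative_eq_rhs[OF has_derivative_add])
       (use D that in \<open>auto simp: fun_eq_iff sum.distrib algebra_simps\<close>)
  then show ?case
    using D by (intro exI[of _ "\<lambda>b x. D b x + E b x"]) (auto intro: smooth_algebra.add)
next
  case (mult f g)
  then obtain D E where D: "\<forall>b\<in>Basis. D b \<in> smooth_algebra B" "\<forall>b\<in>Basis. E b \<in> smooth_algebra B"
    "\<forall>x\<in>U. (f has_derivative (\<lambda>h. \<Sum>b\<in>Basis. (h \<bullet> b) * D b x)) (at x)"
    "\<forall>x\<in>U. (g has_derivative (\<lambda>h. \<Sum>b\<in>Basis. (h \<bullet> b) * E b x)) (at x)" by blast
  have "((\<lambda>x. f x * g x) has_derivative (\<lambda>h. \<Sum>b\<in>Basis. (h \<bullet> b) * (f x * E b x + D b x * g x))) (at x)"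
    if "x \<in> U" for x
    by (rule has_derivative_eq_rhs[OF has_derivative_mult])
       (use D that in \<open>auto simp: fun_eq_iff sum.distrib sum_distrib_left sum_distrib_right algebra_simps\<close>)
  moreover have "(\<lambda>x. f x * E b x + D b x * g x) \<in> smooth_algebra B" if "b \<in> Basis" for b
    by (intro smooth_algebra.add smooth_algebra.mult) (use D mult.hyps that in auto)
  ultimately show ?case
    by (intro exI[of _ "\<lambda>b x. f x * E b x + D b x * g x"]) auto
qed

lemma frechet_derivative_sum_partials:
  assumes "(f has_derivative (\<lambda>h. \<Sum>b\<in>Basis. (h \<bullet> b) * D b)) (at (x::'a::euclidean_space))" "c \<in> Basis"
  shows "frechet_derivative f (at x) c = (D c :: real)"
proof -
  have "frechet_derivative f (at x) c = (\<Sum>b\<in>Basis. (c \<bullet> b) * D b)"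
    using frechet_derivative_at[OF assms(1)] by metis
  also have "\<dots> = (\<Sum>b\<in>Basis. if b = c then D c else 0)"
    using assms(2) by (intro sum.cong) (auto simp: inner_Basis)
  finally show ?thesis using assms(2) by simp
qed

lemma smooth_algebra_continuous:
  assumes "closed_under_partials U B" "f \<in> smooth_algebra B"
  shows "continuous_on U f"
proof -
  obtain D where "\<forall>x\<in>U. (f has_derivative (\<lambda>h. \<Sum>b\<in>Basis. (h \<bullet> b) * D b x)) (at x)"
    using smooth_algebra_has_partials[OF assms] by blast
  then show ?thesis
    by (meson continuous_at_imp_continuous_on has_derivative_continuous)
qed

lemma smooth_algebra_Ck_on:
  assumes "open U" and B: "closed_under_partials U B"
  shows "f \<in> smooth_algebra B \<Longrightarrow> Ck_on k U f"
proof (induction k arbitrary: f)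
  case 0
  then show ?case using smooth_algebra_continuous[OF B] by simp
next
  case (Suc k)
  obtain D where D: "\<And>b. b\<in>Basis \<Longrightarrow> D b \<in> smooth_algebra B"
    "\<And>x. x\<in>U \<Longrightarrow> (f has_derivative (\<lambda>h. \<Sum>b\<in>Basis. (h \<bullet> b) * D b x)) (at x)"
    using smooth_algebra_has_partials[OF B Suc.prems] by blast
  have "Ck_on k U (\<lambda>x. frechet_derivative f (at x) b) \<longleftrightarrow> Ck_on k U (D b)" if "b \<in> Basis" for b
    by (intro Ck_on_cong[OF \<open>open U\<close>] frechet_derivative_sum_partials[OF D(2)] that)
  then show ?case using D Suc.IH by (auto simp: differentiable_def)
qed

lemma smooth_algebra_smooth_on:
  "open U \<Longrightarrow> closed_under_partials U B \<Longrightarrow> f \<in> smooth_algebra B \<Longrightarrow> smooth_on U f"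
  by (simp add: smooth_on_def smooth_algebra_Ck_on)

lemma Ck_on_imp_Ck_closure:
  "Ck_on k U f \<Longrightarrow> closure V \<subseteq> U \<Longrightarrow> Ck_closure k V f"
proof (induction k arbitrary: f)
  case 0
  then show ?case
    by (auto simp: cont_extends_to_closure_def intro: continuous_on_subset)
next
  case (Suc k)
  have "continuous_on U f"
    using Suc.prems(1) differentiable_imp_continuous_within
    by (auto intro!: continuous_at_imp_continuous_on)
  then have "cont_extends_to_closure V f"
    unfolding cont_extends_to_closure_def using Suc.prems(2) continuous_on_subset by blast
  moreover have "V \<subseteq> U" using Suc.prems(2) closure_subset[of V] by blast
  ultimately show ?case using Suc.prems Suc.IH by auto
qed


text \<open>The chain rule for radial functions, with the derivative in the form that
  \<open>closed_under_partials\<close> asks for.\<close>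

lemma has_derivative_radial:
  fixes c x :: "'a::euclidean_space" and \<phi> :: "real \<Rightarrow> real"
  assumes "(\<phi> has_real_derivative d) (at (R - (x - c) \<bullet> (x - c)))"
  shows "((\<lambda>x. \<phi> (R - (x - c) \<bullet> (x - c))) has_derivative
           (\<lambda>h. \<Sum>b\<in>Basis. (h \<bullet> b) * (((-2) * ((x - c) \<bullet> b)) * d))) (at x)"
proof -
  have "((\<lambda>x. R - (x - c) \<bullet> (x - c)) has_derivative (\<lambda>h. 0 - ((x - c) \<bullet> (h - 0) + (h - 0) \<bullet> (x - c)))) (at x)"
    by (intro has_derivative_diff has_derivative_const has_derivative_inner has_derivative_ident)
  from has_derivative_compose[OF this assms[unfolded has_field_derivative_def]]
  show ?thesis
    by (rule has_derivative_eq_rhs)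
      (simp only: sum_Basis_inner_scaled fun_eq_iff, simp add: inner_commute algebra_simps)
qed

lemma closed_under_partials_powr_ln:
  shows "closed_under_partials (ball (0::'a::euclidean_space) 1)
     (insert (\<lambda>x. ln (1 - x \<bullet> x)) (range (\<lambda>p x. (1 - x \<bullet> x) powr p)))" (is "closed_under_partials ?U ?B")
  unfolding closed_under_partials_def
proof
  fix f assume "f \<in> ?B"
  have pos: "0 < 1 - x \<bullet> x" if "x \<in> ?U" for x
    using that by (simp add: norm_eq_sqrt_inner)
  have alg: "(\<lambda>x. ((-2) * (x \<bullet> b)) * (c * (1 - x \<bullet> x) powr p)) \<in> smooth_algebra ?B" for c b p
    by (intro smooth_algebra.mult smooth_algebra.const smooth_algebra.coord smooth_algebra.base) auto
  from \<open>f \<in> ?B\<close> consider "f = (\<lambda>x. ln (1 - x \<bullet> x))" | p where "f = (\<lambda>x. (1 - x \<bullet> x) powr p)" by auto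
  then show "\<exists>D. (\<forall>b\<in>Basis. D b \<in> smooth_algebra ?B) \<and>
        (\<forall>x\<in>?U. (f has_derivative (\<lambda>h. \<Sum>b\<in>Basis. (h \<bullet> b) * D b x)) (at x))"
  proof cases
    case 1
    have "(f has_derivative (\<lambda>h. \<Sum>b\<in>Basis. (h \<bullet> b) * (((-2) * (x \<bullet> b)) * (1 * (1 - x \<bullet> x) powr (-1))))) (at x)"
      if "x \<in> ?U" for x
      using has_derivative_radial[of ln "(1 - x \<bullet> x) powr (-1)" 1 x 0] pos[OF that] DERIV_ln[OF pos[OF that]]
      by (simp add: 1 powr_minus)
    then show ?thesis using alg by (intro exI[of _ "\<lambda>b x. ((-2) * (x \<bullet> b)) * (1 * (1 - x \<bullet> x) powr (-1))"]) blast
  next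
    case 2
    have "(f has_derivative (\<lambda>h. \<Sum>b\<in>Basis. (h \<bullet> b) * (((-2) * (x \<bullet> b)) * (p * (1 - x \<bullet> x) powr (p-1))))) (at x)"
      if "x \<in> ?U" for x
      using has_derivative_radial[of "\<lambda>y. y powr p" "p * (1 - x \<bullet> x) powr (p-1)" 1 x 0]
        has_real_derivative_powr[OF pos[OF that]]
      by (simp add: 2)
    then show ?thesis using alg by (intro exI[of _ "\<lambda>b x. ((-2) * (x \<bullet> b)) * (p * (1 - x \<bullet> x) powr (p-1))"]) blast
  qed
qed

lemma smooth_on_powr_ln_radial:
  "smooth_on (ball (0::'a::euclidean_space) 1) (\<lambda>x. c + d * ((1 - x \<bullet> x) powr p * ln (1 - x \<bullet> x)))"
  by (rule smooth_algebra_smooth_on[OF _ closed_under_partials_powr_ln],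
      (intro open_ball smooth_algebra.add smooth_algebra.mult smooth_algebra.const smooth_algebra.base; simp)+)

text \<open>The index \<open>m\<close> is there because differentiation of \<open>exp (-1/t)\<close> produces powers of \<open>1/t\<close>: with it the
  family is closed under derivatives.\<close>

definition flat_exp :: "nat \<Rightarrow> real \<Rightarrow> real" where
  "flat_exp m t = (if t \<le> 0 then 0 else exp (- (1 / t)) / t ^ m)"

text \<open>The single term \<open>(1/t) ^ (m + 2) / fact (m + 2)\<close> of the exponential series at \<open>1/t\<close> gives the bound.
  Quadratic decay at the origin is what makes the derivative vanish there.\<close>

lemma flat_exp_le: "\<bar>flat_exp m t\<bar> \<le> fact (m + 2) * t\<^sup>2"
proof (cases "t \<le> 0")
  case False
  then have t: "t > 0" by simp
  have "(1/t) ^ (m+2) /\<^sub>R fact (m+2) \<le> exp (1/t)"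
    using t sum_le_suminf[OF summable_exp_generic[of "1/t"], of "{m+2}"] by (simp add: exp_def)
  then have "exp (- (1/t)) / t ^ m \<le> fact (m+2) * t\<^sup>2"
    using t by (simp add: exp_minus divide_simps power_add power2_eq_square mult_ac)
  then show ?thesis using t by (simp add: flat_exp_def)
qed (simp add: flat_exp_def)

lemma flat_exp_has_derivative:
  "(flat_exp m has_real_derivative (flat_exp (m+2) t - m * flat_exp (m+1) t)) (at t)"
proof -
  consider "t < 0" | "t = 0" | "t > 0" by linarith
  then show ?thesis
  proof cases
    case 1
    have "((\<lambda>t. 0) has_real_derivative (flat_exp (m+2) t - m * flat_exp (m+1) t)) (at t)"
      using 1 by (auto simp: flat_exp_def)
    then show ?thesis
      by (rule has_field_derivative_transform_within_open[where S="{..<0}"]) (use 1 in \<open>auto simp: flat_exp_def\<close>)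
  next
    case 2
    have "((\<lambda>h. (flat_exp m (0 + h) - flat_exp m 0) / h) \<longlongrightarrow> 0) (at 0)"
    proof (rule Lim_null_comparison)
      show "((\<lambda>h. fact (m + 2) * \<bar>h\<bar>) \<longlongrightarrow> (0::real)) (at 0)"
        by (auto intro!: tendsto_eq_intros)
      show "\<forall>\<^sub>F h in at 0. norm ((flat_exp m (0 + h) - flat_exp m 0) / h) \<le> fact (m + 2) * \<bar>h\<bar>"
      proof (rule eventually_at_filter[THEN iffD2], rule always_eventually, intro allI impI)
        fix h :: real assume "h \<noteq> 0"
        have "\<bar>flat_exp m h\<bar> \<le> fact (m + 2) * \<bar>h\<bar> * \<bar>h\<bar>"
          using flat_exp_le[of m h] by (simp add: power2_eq_square)
        then have "\<bar>flat_exp m h\<bar> / \<bar>h\<bar> \<le> fact (m + 2) * \<bar>h\<bar>"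
          using \<open>h \<noteq> 0\<close> by (simp add: divide_le_eq)
        then show "norm ((flat_exp m (0 + h) - flat_exp m 0) / h) \<le> fact (m + 2) * \<bar>h\<bar>"
          by (simp add: flat_exp_def)
      qed
    qed
    then show ?thesis using 2 by (simp add: DERIV_def flat_exp_def)
  next
    case 3
    have "((\<lambda>t. exp (- (1 / t)) / t ^ m) has_real_derivative (flat_exp (m+2) t - m * flat_exp (m+1) t)) (at t)"
      using 3 apply (auto intro!: derivative_eq_intros simp: flat_exp_def)
      apply (cases m) apply (auto simp: field_simps power2_eq_square)
      done
    then show ?thesis
      by (rule has_field_derivative_transform_within_open[where S="{0<..}"]) (use 3 in \<open>auto simp: flat_exp_def\<close>)
  qed
qed

text \<open>The support is the closed ball of radius \<open>sqrt R\<close>; the square is used since \<open>(x - c) \<bullet> (x - c)\<close> is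
  a polynomial, unlike the norm.\<close>

definition bump :: "'a::euclidean_space \<Rightarrow> real \<Rightarrow> 'a \<Rightarrow> real" where
  "bump c R x = flat_exp 0 (R - (x - c) \<bullet> (x - c))"

lemma smooth_on_bump: "smooth_on UNIV (bump c R)"
proof -
  let ?B = "range (\<lambda>m x. flat_exp m (R - (x - c) \<bullet> (x - c)))"
  have "closed_under_partials UNIV ?B"
    unfolding closed_under_partials_def
  proof
    fix f assume "f \<in> ?B"
    then obtain m where f: "f = (\<lambda>x. flat_exp m (R - (x - c) \<bullet> (x - c)))" by auto
    define D where "D b x = ((-2) * (x \<bullet> b + (-(c \<bullet> b)))) * (flat_exp (m+2) (R - (x - c) \<bullet> (x - c))
           + (- real m) * flat_exp (m+1) (R - (x - c) \<bullet> (x - c)))" for b x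
    have "D b \<in> smooth_algebra ?B" for b
      unfolding D_def
      by (intro smooth_algebra.mult smooth_algebra.const smooth_algebra.coord smooth_algebra.add
            smooth_algebra.base[OF rangeI])
    moreover have "(f has_derivative (\<lambda>h. \<Sum>b\<in>Basis. (h \<bullet> b) * D b x)) (at x)" for x
      unfolding f D_def
      using has_derivative_radial[OF flat_exp_has_derivative[of m]] by (simp add: inner_diff_left)
    ultimately show "\<exists>D. (\<forall>b\<in>Basis. D b \<in> smooth_algebra ?B) \<and>
        (\<forall>x\<in>UNIV. (f has_derivative (\<lambda>h. \<Sum>b\<in>Basis. (h \<bullet> b) * D b x)) (at x))" by blast
  qed
  then show ?thesis
    by (rule smooth_algebra_smooth_on[OF open_UNIV]) (auto simp: bump_def[abs_def] intro: smooth_algebra.base)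
qed

lemma bump_nonneg: "0 \<le> bump c R x" by (simp add: bump_def flat_exp_def)

lemma bump_le_1: "bump c R x \<le> 1" by (simp add: bump_def flat_exp_def)

lemma bump_eq_0_iff: "bump c (\<epsilon>\<^sup>2) x = 0 \<longleftrightarrow> \<epsilon> \<le> dist c x" if "\<epsilon> > 0"
proof -
  have "\<epsilon>\<^sup>2 - (x - c) \<bullet> (x - c) \<le> 0 \<longleftrightarrow> \<epsilon> \<le> dist c x"
    using that by (simp add: dist_norm norm_minus_commute flip: power2_norm_eq_inner)
  then show ?thesis by (auto simp: bump_def flat_exp_def)
qed

lemma test_function_bump: "test_function \<Omega> (bump c (\<epsilon>\<^sup>2))" if "\<epsilon> > 0" "cball c \<epsilon> \<subseteq> \<Omega>"
proof -
  have "closure {x. bump c (\<epsilon>\<^sup>2) x \<noteq> 0} \<subseteq> cball c \<epsilon>"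
    by (rule closure_minimal) (auto simp: bump_eq_0_iff[OF that(1)])
  then show ?thesis
    unfolding test_function_def using that(2) smooth_on_bump
    by (meson closed_closure compact_cball compact_Int_closed bounded_subset bounded_cball compact_eq_bounded_closed order_trans)
qed

section \<open>The unit disc\<close>

lemma exists_orthogonal_unit_R2:
  fixes e :: "real^2"
  assumes "norm e = 1"
  obtains e' where "norm e' = 1" "e \<bullet> e' = 0"
    "\<And>x. x \<bullet> x = (x \<bullet> e)\<^sup>2 + (x \<bullet> e')\<^sup>2"
proof -
  define e' :: "real^2" where "e' = vector [- e$2, e$1]"
  have e: "(e$1)\<^sup>2 + (e$2)\<^sup>2 = 1"
    using assms by (simp add: norm_eq_sqrt_inner inner_vec_def sum_2 power2_eq_square)
  have c [simp]: "e' $ 1 = - e$2" "e' $ 2 = e$1" by (simp_all add: e'_def)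
  have "norm e' = 1"
    using e by (simp add: norm_eq_sqrt_inner inner_vec_def sum_2 power2_eq_square add.commute)
  moreover have "e \<bullet> e' = 0" by (simp add: inner_vec_def sum_2)
  moreover have "x \<bullet> x = (x \<bullet> e)\<^sup>2 + (x \<bullet> e')\<^sup>2" for x
  proof -
    have "(x \<bullet> e)\<^sup>2 + (x \<bullet> e')\<^sup>2 = ((x$1)\<^sup>2 + (x$2)\<^sup>2) * ((e$1)\<^sup>2 + (e$2)\<^sup>2)"
      by (simp add: inner_vec_def sum_2) algebra
    then have "(x \<bullet> e)\<^sup>2 + (x \<bullet> e')\<^sup>2 = (x$1)\<^sup>2 + (x$2)\<^sup>2" by (simp only: e mult_1_right)
    then show ?thesis by (simp add: inner_vec_def sum_2 power2_eq_square)
  qed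
  ultimately show ?thesis using that by blast
qed

text \<open>In the frame at \<open>p\<close> formed by a tangent vector and \<open>-p\<close> the disc is the epigraph of
  \<open>1 - sqrt (1 - a ^ 2)\<close>, since \<open>x \<bullet> p = 1 - b\<close> and \<open>x \<bullet> e' = a\<close> for a point with coordinates \<open>a\<close>
  and \<open>b\<close>.\<close>

lemma bounded_smooth_domain_unit_disc: "bounded_smooth_domain (ball 0 1)"
  unfolding bounded_smooth_domain_def
proof (intro conjI ballI)
  fix p :: "real^2" assume "p \<in> frontier (ball 0 1)"
  then have p: "norm p = 1" by simp
  then obtain e' where e': "norm e' = 1" "p \<bullet> e' = 0" "\<And>x. x \<bullet> x = (x \<bullet> p)\<^sup>2 + (x \<bullet> e')\<^sup>2"
    using exists_orthogonal_unit_R2 by metis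
  define \<gamma> where "\<gamma> a = 1 + (-1) * ((1 - a \<bullet> a) powr (1/2))" for a :: real
  have sm: "smooth_on {-1<..<1} \<gamma>"
  proof -
    have "smooth_on (ball (0::real) 1) \<gamma>"
      unfolding \<gamma>_def
      by (rule smooth_algebra_smooth_on[OF _ closed_under_partials_powr_ln],
          (intro open_ball smooth_algebra.add smooth_algebra.mult smooth_algebra.const smooth_algebra.base; simp)+)
    then show ?thesis by (simp add: ball_eq_greaterThanLessThan)
  qed
  have "x \<in> ball 0 1 \<longleftrightarrow> \<gamma> ((x - p) \<bullet> e') < (x - p) \<bullet> (- p)" if x: "x \<in> ball p 1" for x
  proof -
    define a b where "a = (x - p) \<bullet> e'" and "b = (x - p) \<bullet> (- p)"
    have pp: "p \<bullet> p = 1" using p by (simp add: norm_eq_sqrt_inner)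
    have xp: "x \<bullet> p = 1 - b" by (simp add: b_def inner_diff_left pp)
    have xe: "x \<bullet> e' = a" by (simp add: a_def inner_diff_left e')
    have "(x - p) \<bullet> (x - p) < 1"
      using x by (simp add: dist_norm norm_minus_commute[of p x] norm_eq_sqrt_inner[of "x - p"])
    then have "b\<^sup>2 + a\<^sup>2 < 1" using e'(3)[of "x - p"] by (simp add: a_def b_def)
    then have "a\<^sup>2 < 1" "b\<^sup>2 < 1"
      using zero_le_power2[of a] zero_le_power2[of b] by linarith+
    then have ab: "a\<^sup>2 < 1" "b < 1" by (simp_all add: abs_square_less_1 abs_less_iff)
    have "x \<in> ball 0 1 \<longleftrightarrow> (1 - b)\<^sup>2 + a\<^sup>2 < 1"
      using e'(3)[of x] by (simp add: norm_eq_sqrt_inner xp xe)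
    also have "\<dots> \<longleftrightarrow> 1 - b < sqrt (1 - a\<^sup>2)"
      using ab real_less_rsqrt[of "1 - b" "1 - a\<^sup>2"] real_sqrt_less_iff[of "(1 - b)\<^sup>2" "1 - a\<^sup>2"] by auto
    also have "\<dots> \<longleftrightarrow> \<gamma> a < b"
      using ab by (auto simp: \<gamma>_def powr_half_sqrt power2_eq_square)
    finally show ?thesis by (simp only: a_def b_def)
  qed
  then have "norm e' = 1 \<and> norm (- p) = 1 \<and> e' \<bullet> (- p) = 0 \<and> smooth_on {-1<..<1} \<gamma> \<and>
        (\<forall>x\<in>ball p 1. x \<in> ball 0 1 \<longleftrightarrow> \<gamma> ((x - p) \<bullet> e') < (x - p) \<bullet> (- p))"
    using p e'(1,2) sm by (simp only: norm_minus_cancel inner_minus_right inner_commute[of e' p] minus_zero) blast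
  then show "\<exists>r>0. \<exists>e1 e2. \<exists>\<gamma>. norm e1 = 1 \<and> norm e2 = 1 \<and> e1 \<bullet> e2 = 0 \<and> smooth_on {-r<..<r} \<gamma> \<and>
        (\<forall>x\<in>ball p r. x \<in> ball 0 1 \<longleftrightarrow> \<gamma> ((x - p) \<bullet> e1) < (x - p) \<bullet> e2)"
    using zero_less_one by blast
qed auto

section \<open>Singular kernels in the plane\<close>

lemma powr_square_mult: "0 < r \<Longrightarrow> r\<^sup>2 * r powr a = r powr (2 + a)" for r :: real
  by (simp add: powr_add)

lemma powr_Bernoulli:
  fixes v s :: real
  assumes "-1 \<le> v" "0 < s" "s < 1"
  shows "(1 + v) powr s \<le> 1 + s * v"
  using Youngs_inequality_0[of s "1 - s" "1 + v" 1] assms by (cases "v = -1") (auto simp: algebra_simps)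

lemma lborel_translate:
  fixes f :: "'a::euclidean_space \<Rightarrow> ennreal"
  assumes [measurable]: "f \<in> borel_measurable borel"
  shows "(\<integral>\<^sup>+y. f (c + y) \<partial>lborel) = (\<integral>\<^sup>+y. f y \<partial>lborel)"
proof -
  have "(\<integral>\<^sup>+y. f y \<partial>lborel) = (\<integral>\<^sup>+y. f y \<partial>distr lborel borel ((+) c))"
    by (simp add: lborel_distr_plus)
  also have "\<dots> = (\<integral>\<^sup>+y. f (c + y) \<partial>lborel)" by (subst nn_integral_distr) auto
  finally show ?thesis by simp
qed

lemma emeasure_ball_R2: "emeasure lborel (ball (c::real^2) r) = ennreal (pi * r\<^sup>2)" if "r \<ge> 0"
  using emeasure_ball[OF that, of c] unit_ball_vol_2 by simp

lemma emeasure_cball_R2: "emeasure lborel (cball (c::real^2) r) = ennreal (pi * r\<^sup>2)" if "r \<ge> 0"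
  using emeasure_cball[OF that, of c] unit_ball_vol_2 by simp

text \<open>Layer cake: \<open>norm y powr (-2-\<beta>)\<close> is the integral of \<open>(2+\<beta>) * r powr (-\<beta>-3)\<close> over \<open>r \<ge> norm y\<close>,
  and after exchanging the integrals the disc of radius \<open>r\<close> contributes its area. This replaces polar
  coordinates.\<close>

lemma nn_integral_kernel_far:
  fixes \<beta> \<rho> :: real
  assumes "\<beta> > 0" "\<rho> > 0"
  shows "(\<integral>\<^sup>+(y::real^2). ennreal (indicator {y. \<rho> \<le> norm y} y * norm y powr (-2-\<beta>)) \<partial>lborel)
       \<le> ennreal (pi * (2 + \<beta>) / \<beta> * \<rho> powr (-\<beta>))"
proof -
  have A: "(\<integral>\<^sup>+r. ennreal ((2+\<beta>) * r powr (-\<beta>-3)) * indicator {a..} r \<partial>lborel) = ennreal (a powr (-2-\<beta>))"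
    if "a > 0" for a
  proof -
    have "((\<lambda>r. (2+\<beta>) * r powr (-\<beta>-3)) has_integral ((2+\<beta>) * (-(a powr (-\<beta>-3+1)) / (-\<beta>-3+1)))) {a..}"
      using assms that by (intro has_integral_mult_right has_integral_powr_to_inf) auto
    moreover have "(2+\<beta>) * (-(a powr (-\<beta>-3+1)) / (-\<beta>-3+1)) = a powr (-2-\<beta>)"
    proof -
      have "(2+\<beta>) * (- X / (-2-\<beta>)) = X" for X
        using assms by (simp add: divide_simps) argo
      moreover have "-\<beta>-3+1 = -2-\<beta>" by simp
      ultimately show ?thesis by simp
    qed
    ultimately have "((\<lambda>r. (2+\<beta>) * r powr (-\<beta>-3)) has_integral (a powr (-2-\<beta>))) {a..}"
      by simp
    from nn_integral_has_integral_lebesgue'[OF _ this] assms show ?thesis by simp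
  qed
  have B: "(\<integral>\<^sup>+r. ennreal (pi * (2+\<beta>) * r powr (-\<beta>-1)) * indicator {\<rho>..} r \<partial>lborel)
      = ennreal (pi * (2 + \<beta>) / \<beta> * \<rho> powr (-\<beta>))"
  proof -
    have "((\<lambda>r. pi * (2+\<beta>) * r powr (-\<beta>-1)) has_integral (pi * (2+\<beta>) * (-(\<rho> powr (-\<beta>-1+1)) / (-\<beta>-1+1)))) {\<rho>..}"
      using assms by (intro has_integral_mult_right has_integral_powr_to_inf) auto
    from nn_integral_has_integral_lebesgue'[OF _ this] assms show ?thesis by simp
  qed
  have "(\<integral>\<^sup>+(y::real^2). ennreal (indicator {y. \<rho> \<le> norm y} y * norm y powr (-2-\<beta>)) \<partial>lborel)
     = (\<integral>\<^sup>+(y::real^2). \<integral>\<^sup>+r. ennreal ((2+\<beta>) * r powr (-\<beta>-3)) * indicator {norm y..} r * indicator {y. \<rho> \<le> norm y} y \<partial>lborel \<partial>lborel)"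
  proof (rule nn_integral_cong)
    fix y :: "real^2"
    show "ennreal (indicator {y. \<rho> \<le> norm y} y * norm y powr (-2-\<beta>)) =
       (\<integral>\<^sup>+r. ennreal ((2+\<beta>) * r powr (-\<beta>-3)) * indicator {norm y..} r * indicator {y. \<rho> \<le> norm y} y \<partial>lborel)"
    proof (cases "\<rho> \<le> norm y")
      case True
      then have "0 < norm y" using assms by linarith
      from A[OF this] True show ?thesis by simp
    qed simp
  qed
  also have "\<dots> = (\<integral>\<^sup>+r. \<integral>\<^sup>+(y::real^2). ennreal ((2+\<beta>) * r powr (-\<beta>-3)) * indicator {norm y..} r * indicator {y. \<rho> \<le> norm y} y \<partial>lborel \<partial>lborel)"
    by (rule lborel_pair.Fubini'[symmetric]) (simp add: atLeast_def; measurable)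
  also have "\<dots> \<le> (\<integral>\<^sup>+r. ennreal (pi * (2+\<beta>) * r powr (-\<beta>-1)) * indicator {\<rho>..} r \<partial>lborel)"
  proof (rule nn_integral_mono)
    fix r :: real
    have "(\<integral>\<^sup>+(y::real^2). ennreal ((2+\<beta>) * r powr (-\<beta>-3)) * indicator {norm y..} r * indicator {y. \<rho> \<le> norm y} y \<partial>lborel)
      \<le> (\<integral>\<^sup>+(y::real^2). ennreal ((2+\<beta>) * r powr (-\<beta>-3)) * indicator {\<rho>..} r * indicator (cball 0 r) y \<partial>lborel)"
      by (intro nn_integral_mono) (auto split: split_indicator)
    also have "\<dots> = ennreal ((2+\<beta>) * r powr (-\<beta>-3)) * indicator {\<rho>..} r * emeasure lborel (cball (0::real^2) r)"
      by (rule nn_integral_cmult_indicator) simp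
    also have "\<dots> \<le> ennreal (pi * (2+\<beta>) * r powr (-\<beta>-1)) * indicator {\<rho>..} r"
    proof (cases "\<rho> \<le> r")
      case True
      then have "r > 0" using assms by simp
      then have "r powr (-\<beta>-3) * r\<^sup>2 = r powr (-\<beta>-1)"
        using powr_square_mult[of r "-\<beta>-3"] by (simp add: mult.commute minus_diff_commute)
      then show ?thesis using True \<open>r > 0\<close> assms
        by (simp add: emeasure_cball_R2 ennreal_mult[symmetric] mult_ac)
    qed simp
    finally show "(\<integral>\<^sup>+(y::real^2). ennreal ((2+\<beta>) * r powr (-\<beta>-3)) * indicator {norm y..} r * indicator {y. \<rho> \<le> norm y} y \<partial>lborel) \<le> \<dots>" .
  qed
  finally show ?thesis unfolding B .
qed

text \<open>The same layer-cake argument, now with radii between \<open>norm y\<close> and \<open>\<rho>\<close>; the boundary term at \<open>\<rho>\<close>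
  is constant on the disc.\<close>

lemma nn_integral_kernel_near:
  fixes \<sigma> \<rho> :: real
  assumes "0 < \<sigma>" "\<sigma> < 2" "\<rho> > 0"
  shows "(\<integral>\<^sup>+(y::real^2). ennreal (indicator {y. norm y \<le> \<rho>} y * norm y powr (-\<sigma>)) \<partial>lborel)
       \<le> ennreal (2 * pi / (2 - \<sigma>) * \<rho> powr (2-\<sigma>))"
proof -
  have B: "(\<integral>\<^sup>+r. ennreal (\<sigma> * pi * r powr (1-\<sigma>)) * indicator {0..\<rho>} r \<partial>lborel)
      = ennreal (\<sigma> * pi / (2-\<sigma>) * \<rho> powr (2-\<sigma>))"
  proof -
    have "((\<lambda>r. r powr (1-\<sigma>)) has_integral (\<rho> powr (2-\<sigma>) / (2-\<sigma>))) {0..\<rho>}"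
      using has_integral_powr_from_0[of "1-\<sigma>" \<rho>] assms by simp
    from nn_integral_has_integral_lebesgue'[OF _ has_integral_mult_right[OF this, of "\<sigma> * pi"]] assms
    show ?thesis by simp
  qed
  have A: "ennreal (indicator {y. norm y \<le> \<rho>} y * norm y powr (-\<sigma>)) \<le> ennreal (\<rho> powr (-\<sigma>)) * indicator (cball 0 \<rho>) y +
       (\<integral>\<^sup>+r. ennreal (\<sigma> * r powr (-\<sigma>-1)) * indicator {norm y..\<rho>} r \<partial>lborel)" for y :: "real^2"
  proof (cases "norm y \<le> \<rho> \<and> y \<noteq> 0")
    case True
    have "(\<integral>\<^sup>+r. ennreal (\<sigma> * r powr (-\<sigma>-1)) * indicator {norm y..\<rho>} r \<partial>lborel)
       = ennreal ((- (\<rho> powr (-\<sigma>))) - (- (norm y powr (-\<sigma>))))"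
    proof (intro nn_integral_FTC_Icc)
      show "((\<lambda>r. - (r powr (-\<sigma>))) has_real_derivative \<sigma> * x powr (-\<sigma>-1)) (at x)"
        if "x \<in> {norm y..\<rho>}" for x
        using that True assms less_le_trans[of 0 "norm y" x]
        by (auto intro!: derivative_eq_intros simp: algebra_simps)
    qed (use assms True in auto)
    moreover have "\<rho> powr (-\<sigma>) \<le> norm y powr (-\<sigma>)"
      using True assms by (intro powr_mono2') auto
    ultimately show ?thesis using True by (simp flip: ennreal_plus)
  qed (auto split: split_indicator)
  have conv: "ennreal (\<sigma> * r powr (-\<sigma>-1)) * indicator {norm y..\<rho>} r =
      ennreal (\<sigma> * r powr (-\<sigma>-1)) * indicator {..\<rho>} r * indicator {0..} (r - norm y)" for y :: "real^2" and r
    by (simp split: split_indicator)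
  have "(\<integral>\<^sup>+(y::real^2). ennreal (indicator {y. norm y \<le> \<rho>} y * norm y powr (-\<sigma>)) \<partial>lborel) \<le>
    (\<integral>\<^sup>+(y::real^2). ennreal (\<rho> powr (-\<sigma>)) * indicator (cball 0 \<rho>) y +
       (\<integral>\<^sup>+r. ennreal (\<sigma> * r powr (-\<sigma>-1)) * indicator {..\<rho>} r * indicator {0..} (r - norm y) \<partial>lborel) \<partial>lborel)"
    using A by (intro nn_integral_mono) (simp add: conv)
  also have "\<dots> = ennreal (pi * \<rho> powr (2-\<sigma>)) +
      (\<integral>\<^sup>+(y::real^2). \<integral>\<^sup>+r. ennreal (\<sigma> * r powr (-\<sigma>-1)) * indicator {..\<rho>} r * indicator {0..} (r - norm y) \<partial>lborel \<partial>lborel)"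
  proof -
    have "\<rho> powr (-\<sigma>) * \<rho>\<^sup>2 = \<rho> powr (2-\<sigma>)"
      using powr_square_mult[of \<rho> "-\<sigma>"] assms by (simp add: mult.commute)
    moreover have "(\<integral>\<^sup>+(y::real^2). ennreal (\<rho> powr (-\<sigma>)) * indicator (cball 0 \<rho>) y \<partial>lborel)
        = ennreal (\<rho> powr (-\<sigma>)) * emeasure lborel (cball (0::real^2) \<rho>)"
      by (rule nn_integral_cmult_indicator) simp
    moreover have "\<dots> = ennreal (pi * (\<rho> powr (-\<sigma>) * \<rho>\<^sup>2))"
      using assms by (simp add: emeasure_cball_R2 ennreal_mult mult.left_commute)
    ultimately have eq: "(\<integral>\<^sup>+(y::real^2). ennreal (\<rho> powr (-\<sigma>)) * indicator (cball 0 \<rho>) y \<partial>lborel) = ennreal (pi * \<rho> powr (2-\<sigma>))"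
      by simp
    define f g where "f y = ennreal (\<rho> powr (-\<sigma>)) * indicator (cball 0 \<rho>) y"
      and "g y = (\<integral>\<^sup>+r. ennreal (\<sigma> * r powr (-\<sigma>-1)) * indicator {..\<rho>} r * indicator {0..} (r - norm y) \<partial>lborel)" for y :: "real^2"
    have "f \<in> borel_measurable lborel"
    proof -
      have [measurable]: "cball (0::real^2) \<rho> \<in> sets borel" by simp
      show ?thesis unfolding f_def by measurable
    qed
    moreover have "g \<in> borel_measurable lborel"
      unfolding g_def by measurable
    ultimately have "(\<integral>\<^sup>+y. f y + g y \<partial>lborel) = (\<integral>\<^sup>+y. f y \<partial>lborel) + (\<integral>\<^sup>+y. g y \<partial>lborel)"
      by (rule nn_integral_add)
    then show ?thesis
      unfolding eq[symmetric] f_def g_def .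
  qed
  also have "(\<integral>\<^sup>+(y::real^2). \<integral>\<^sup>+r. ennreal (\<sigma> * r powr (-\<sigma>-1)) * indicator {..\<rho>} r * indicator {0..} (r - norm y) \<partial>lborel \<partial>lborel)
     = (\<integral>\<^sup>+r. \<integral>\<^sup>+(y::real^2). ennreal (\<sigma> * r powr (-\<sigma>-1)) * indicator {..\<rho>} r * indicator {0..} (r - norm y) \<partial>lborel \<partial>lborel)"
    by (rule lborel_pair.Fubini'[symmetric]) measurable
  also have "\<dots> \<le> (\<integral>\<^sup>+r. ennreal (\<sigma> * pi * r powr (1-\<sigma>)) * indicator {0..\<rho>} r \<partial>lborel)"
  proof (rule nn_integral_mono)
    fix r :: real
    have "(\<integral>\<^sup>+(y::real^2). ennreal (\<sigma> * r powr (-\<sigma>-1)) * indicator {..\<rho>} r * indicator {0..} (r - norm y) \<partial>lborel)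
      \<le> (\<integral>\<^sup>+(y::real^2). ennreal (\<sigma> * r powr (-\<sigma>-1)) * indicator {0..\<rho>} r * indicator (cball 0 r) y \<partial>lborel)"
      by (intro nn_integral_mono) (auto split: split_indicator intro: order_trans[OF norm_ge_zero])
    also have "\<dots> = ennreal (\<sigma> * r powr (-\<sigma>-1)) * indicator {0..\<rho>} r * emeasure lborel (cball (0::real^2) r)"
      by (rule nn_integral_cmult_indicator) simp
    also have "\<dots> \<le> ennreal (\<sigma> * pi * r powr (1-\<sigma>)) * indicator {0..\<rho>} r"
    proof (cases "0 \<le> r")
      case True
      then have "r powr (-\<sigma>-1) * r\<^sup>2 = r powr (1-\<sigma>)"
        using powr_square_mult[of r "-\<sigma>-1"] by (cases "r = 0") (auto simp: mult.commute)
      then show ?thesis using True assms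
        by (simp add: emeasure_cball_R2 mult_ac flip: ennreal_mult split: split_indicator)
    qed simp
    finally show "(\<integral>\<^sup>+(y::real^2). ennreal (\<sigma> * r powr (-\<sigma>-1)) * indicator {..\<rho>} r * indicator {0..} (r - norm y) \<partial>lborel) \<le> \<dots>" .
  qed
  also note B
  also have "ennreal (pi * \<rho> powr (2-\<sigma>)) + ennreal (\<sigma> * pi / (2-\<sigma>) * \<rho> powr (2-\<sigma>)) = ennreal (2 * pi / (2 - \<sigma>) * \<rho> powr (2-\<sigma>))"
    using assms by (simp add: field_simps flip: ennreal_plus)
  finally show ?thesis by (simp add: add_left_mono)
qed

section \<open>The half-line solution\<close>

text \<open>Second difference with step \<open>r\<close>, at the point 1, of the function \<open>(max 0 x) powr s\<close>.\<close>

definition second_diff_ramp :: "real \<Rightarrow> real \<Rightarrow> real" where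
  "second_diff_ramp s r = 2 - (max 0 (1 + r)) powr s - (max 0 (1 - r)) powr s"

lemma set_integrable_lborel_if_has_integral:
  fixes f :: "real \<Rightarrow> real"
  assumes "(f has_integral I) S" "\<And>x. x \<in> S \<Longrightarrow> 0 \<le> f x"
    and [measurable]: "f \<in> borel_measurable borel" "S \<in> sets borel"
  shows "set_integrable lborel S f"
  unfolding set_integrable_def
proof (rule integrableI_nonneg)
  have "(\<integral>\<^sup>+x. ennreal (indicator S x *\<^sub>R f x) \<partial>lborel) = (\<integral>\<^sup>+x. ennreal (f x) * indicator S x \<partial>lborel)"
    by (intro nn_integral_cong) (auto split: split_indicator)
  then show "(\<integral>\<^sup>+x. ennreal (indicator S x *\<^sub>R f x) \<partial>lborel) < \<infinity>"
    using nn_integral_has_integral_lebesgue'[OF assms(2,1)] by simp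
qed (use assms(2) in \<open>auto split: split_indicator\<close>)

text \<open>Concavity (in the form of Bernoulli's inequality) gives the sign. The upper bound is the inequality
  between arithmetic and geometric mean applied to the two powers, whose product is
  \<open>(1 - r\<^sup>2) powr s \<ge> 1 - r\<^sup>2\<close>.\<close>

lemma ramp_bounds:
  assumes "0 < s" "s < 1" "\<bar>r\<bar> \<le> 1"
  shows "0 \<le> second_diff_ramp s r" "second_diff_ramp s r \<le> 2 * r\<^sup>2"
proof -
  have r: "0 \<le> 1 + r" "0 \<le> 1 - r" using assms by auto
  show "0 \<le> second_diff_ramp s r"
    using powr_Bernoulli[of r s] powr_Bernoulli[of "-r" s] assms r by (simp add: second_diff_ramp_def)
  define a b where "a = (1 + r) powr (s/2)" and "b = (1 - r) powr (s/2)"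
  have r2: "0 \<le> 1 - r\<^sup>2" "1 - r\<^sup>2 \<le> 1" using assms(3) by (simp_all add: abs_square_le_1)
  have "1 - r\<^sup>2 \<le> (1 - r\<^sup>2) powr (s/2)"
    using powr_mono'[of "s/2" 1 "1 - r\<^sup>2"] r2 assms by auto
  also have "1 - r\<^sup>2 = (1 + r) * (1 - r)" by (simp add: power2_eq_square algebra_simps)
  also have "\<dots> powr (s/2) = a * b" using r by (simp add: a_def b_def powr_mult)
  finally have "2 * (1 - r\<^sup>2) \<le> 2 * a * b" by (simp add: power2_eq_square algebra_simps)
  also have "\<dots> \<le> a\<^sup>2 + b\<^sup>2" using sum_squares_bound[of a b] by simp
  finally have "2 * (1 - r\<^sup>2) \<le> a\<^sup>2 + b\<^sup>2" .
  moreover have "a\<^sup>2 = (1 + r) powr s" "b\<^sup>2 = (1 - r) powr s"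
    using r by (simp_all add: a_def b_def power2_eq_square flip: powr_add)
  ultimately show "second_diff_ramp s r \<le> 2 * r\<^sup>2" using r by (simp add: second_diff_ramp_def)
qed

lemma ramp_bound_far:
  assumes "0 < s" "s < 1" "1 \<le> \<bar>r\<bar>"
  shows "\<bar>second_diff_ramp s r\<bar> \<le> 4 * \<bar>r\<bar> powr s"
proof -
  have *: "(max 0 (1 + r)) powr s \<le> 2 * \<bar>r\<bar> powr s" if "1 \<le> \<bar>r\<bar>" for r :: real
  proof -
    have "(max 0 (1 + r)) powr s \<le> (2 * \<bar>r\<bar>) powr s" using that assms by (intro powr_mono2) auto
    also have "\<dots> = 2 powr s * \<bar>r\<bar> powr s" by (simp add: powr_mult)
    also have "\<dots> \<le> 2 * \<bar>r\<bar> powr s"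
      using assms powr_mono[of s 1 "2::real"] by (intro mult_right_mono) auto
    finally show ?thesis .
  qed
  have "1 \<le> \<bar>r\<bar> powr s" using assms by (simp add: ge_one_powr_ge_zero)
  moreover have "0 \<le> (max 0 (1 + r)) powr s" "0 \<le> (max 0 (1 - r)) powr s" by simp_all
  ultimately show ?thesis using *[of r] *[of "-r"] assms(3)
    unfolding second_diff_ramp_def abs_le_iff by (intro conjI; simp only: abs_minus_cancel diff_conv_add_uminus[symmetric]; linarith)
qed

lemma second_diff_ramp_measurable [measurable]: "second_diff_ramp s \<in> borel_measurable borel"
  unfolding second_diff_ramp_def[abs_def] by measurable

lemma second_diff_ramp_minus: "second_diff_ramp s (- r) = second_diff_ramp s r"
  by (simp add: second_diff_ramp_def)

lemma ramp_kernel_bound: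
  assumes "0 < s" "s < 1" "r > 0"
  shows "\<bar>second_diff_ramp s r * r powr (-1-2 * s)\<bar> \<le> (if r \<le> 1 then 2 * r powr (1-2 * s) else 4 * r powr (-1-s))"
proof -
  note that = assms(3)
  show ?thesis
  proof (cases "r \<le> 1")
    case True
    have "\<bar>second_diff_ramp s r\<bar> * r powr (-1-2 * s) \<le> 2 * r\<^sup>2 * r powr (-1-2 * s)"
      using ramp_bounds[OF assms(1,2), of r] True that by (intro mult_right_mono) auto
    also have "\<dots> = 2 * r powr (1-2 * s)" using powr_square_mult[OF that, of "-1-2 * s"] by simp
    finally show ?thesis using True by (simp add: abs_mult)
  next
    case False
    have "\<bar>second_diff_ramp s r\<bar> * r powr (-1-2 * s) \<le> 4 * r powr s * r powr (-1-2 * s)"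
      using ramp_bound_far[OF assms(1,2), of r] False that by (intro mult_right_mono) auto
    also have "\<dots> = 4 * r powr (-1-s)"
    proof -
      have "r powr s * r powr (-1-2 * s) = r powr (s + (-1-2 * s))" by (rule powr_add[symmetric])
      moreover have "s + (-1-2 * s) = -1-s" by simp
      ultimately show ?thesis by (simp only: mult.assoc)
    qed
    finally show ?thesis using False by (simp add: abs_mult)
  qed
qed

lemma ramp_kernel_integrable:
  assumes "0 < s" "s < 1"
  shows "set_integrable lborel {0<..} (\<lambda>r. second_diff_ramp s r * r powr (-1-2 * s))"
proof -
  have i1: "set_integrable lborel {0..1} (\<lambda>r. 2 * r powr (1-2 * s))"
    using assms by (intro set_integrable_lborel_if_has_integral[OF has_integral_mult_right[OF has_integral_powr_from_0]]) auto
  have i2: "set_integrable lborel {1..} (\<lambda>r. 4 * r powr (-1-s))"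
    using assms by (intro set_integrable_lborel_if_has_integral[OF has_integral_mult_right[OF has_integral_powr_to_inf]]) auto
  have "set_integrable lborel {0<..1} (\<lambda>r. second_diff_ramp s r * r powr (-1-2 * s))"
    unfolding set_integrable_def
  proof (rule Bochner_Integration.integrable_bound[OF i1[unfolded set_integrable_def]], simp, rule AE_I2)
    show "norm (indicator {0<..1} r *\<^sub>R (second_diff_ramp s r * r powr (-1-2 * s)))
      \<le> norm (indicator {0..1} r *\<^sub>R (2 * r powr (1-2 * s)))" for r :: real
      using ramp_kernel_bound[OF assms, of r] by (cases "0 < r \<and> r \<le> 1") auto
  qed
  moreover have "set_integrable lborel {1<..} (\<lambda>r. second_diff_ramp s r * r powr (-1-2 * s))"
    unfolding set_integrable_def
  proof (rule Bochner_Integration.integrable_bound[OF i2[unfolded set_integrable_def]], simp, rule AE_I2)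
    show "norm (indicator {1<..} r *\<^sub>R (second_diff_ramp s r * r powr (-1-2 * s)))
      \<le> norm (indicator {1..} r *\<^sub>R (4 * r powr (-1-s)))" for r :: real
      using ramp_kernel_bound[OF assms, of r] by (cases "1 < r") auto
  qed
  ultimately have "set_integrable lborel ({0<..1} \<union> {1<..}) (\<lambda>r. second_diff_ramp s r * r powr (-1-2 * s))"
    by (rule set_integrable_Un) auto
  moreover have "{0<..1} \<union> {1<..} = {0::real<..}" by auto
  ultimately show ?thesis by simp
qed


lemma one_minus_powr_bounds:
  fixes s w :: real
  assumes "0 < s" "s < 1" "0 \<le> w" "w \<le> 1"
  shows "0 \<le> 1 - (1 - w) powr s" "1 - (1 - w) powr s \<le> w"
  using assms powr_mono'[of s 1 "1 - w"] powr_mono2[of s "1 - w" 1] by auto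

text \<open>The function \<open>(max 0 x) powr s\<close> solves the one-dimensional equation in \<open>x > 0\<close>. Let \<open>h\<close> be the part of
  the integrand that comes from the step to the left, \<open>(1 - (max 0 (1 - r)) powr s) * r powr (-1-2s)\<close>,
  and let \<open>K\<close> be a primitive of it. The part from the step to the right is, in the variable
  \<open>w = r / (1 + r)\<close> (inversion of \<open>1 + r\<close>), equal to \<open>- h w\<close> plus an exact derivative; so
  \<open>G r = K r - K (r / (1 + r)) - Q r\<close> with an elementary \<open>Q\<close> is a primitive of the whole integrand. At 0
  the two values of \<open>K\<close> cancel because \<open>r - r / (1 + r)\<close> is quadratic in \<open>r\<close>; at infinity \<open>K\<close> is
  explicit and both \<open>K r - K 1\<close> and \<open>Q r\<close> tend to \<open>1 / (2 * s)\<close>.\<close>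

lemma integral_second_diff_ramp_1D:
  assumes s: "0 < s" "s < 1"
  shows "(LBINT r:{0<..}. second_diff_ramp s r * r powr (-1-2 * s)) = 0"
proof -
  define h where "h w = (1 - (max 0 (1 - w)) powr s) * w powr (-1-2 * s)" for w :: real
  \<comment> \<open>\<open>Q r\<close> is \<open>(1 - (1 - w) powr s)\<^sup>2 * w powr (-2 * s) / (2 * s)\<close> at \<open>w = r / (1 + r)\<close>.\<close>
  define Q where "Q r = ((1 + r) powr s - 1)\<^sup>2 * r powr (-2 * s) / (2 * s)" for r :: real
  define W where "W r = r / (1 + r)" for r :: real
  have cont_h: "isCont h w" if "0 < w" for w
    unfolding h_def using s that by (intro continuous_intros) auto
  obtain K where K: "(K has_real_derivative h w) (at w)" if "0 < w" for w
    using einterval_antiderivative[of 0 \<infinity> h] cont_h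
    by (auto simp: has_real_derivative_iff_has_vector_derivative zero_ereal_def)
  define G where "G r = K r - K (W r) - Q r" for r
  have W: "0 < W r" "W r < 1" "W r < r" if "r > 0" for r
    using that by (auto simp: W_def field_simps)
  have G_deriv: "(G has_real_derivative (second_diff_ramp s r * r powr (-1-2 * s))) (at r)" if r: "r > 0" for r
  proof -
    define X Z where "X = (1 + r) powr s" and "Z = r powr (-1-2 * s)"
    have W': "(W has_real_derivative 1 / (1 + r)\<^sup>2) (at r)"
      unfolding W_def using r by (auto intro!: derivative_eq_intros simp: power2_eq_square field_simps)
    have Zr: "r powr (-2 * s) = Z * r"
      using r by (simp add: Z_def powr_mult_base mult.commute)
    have "(Q has_real_derivative (2 * (X - 1) * (s * (1 + r) powr (s-1)) * r powr (-2 * s)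
        + (X - 1)\<^sup>2 * ((-2 * s) * r powr (-2 * s-1))) / (2 * s)) (at r)"
    proof -
      have A: "((\<lambda>r. ((1 + r) powr s - 1)\<^sup>2) has_real_derivative 2 * (X - 1) * (s * (1 + r) powr (s-1))) (at r)"
        unfolding X_def using r by (auto intro!: derivative_eq_intros)
      have B: "((\<lambda>r. r powr (-2 * s)) has_real_derivative (-2 * s) * r powr (-2 * s-1)) (at r)"
        using r by (rule has_real_derivative_powr)
      show ?thesis
        using DERIV_cdivide[OF DERIV_mult[OF A B], of "2 * s"] by (simp add: Q_def[abs_def] X_def mult_ac)
    qed
    also have "r powr (-2 * s-1) = Z"
    proof -
      have "-2 * s-1 = -1-2 * s" by simp
      then show ?thesis by (simp only: Z_def)
    qed
    also have "(1 + r) powr (s-1) = X / (1 + r)" using r by (simp add: X_def powr_diff)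
    also have "(2 * (X - 1) * (s * (X / (1 + r))) * r powr (-2 * s) + (X - 1)\<^sup>2 * ((-2 * s) * Z)) / (2 * s)
      = (X - 1) * (1 - X / (1 + r)) * Z"
    proof -
      define P where "P = X / (1 + r)"
      have Pr: "P * r = X - P" using r by (simp add: P_def field_simps)
      have "2 * (X - 1) * (s * P) * (Z * r) + (X - 1)\<^sup>2 * ((-2 * s) * Z) = (2 * s) * ((X - 1) * (P * r - (X - 1)) * Z)"
        by algebra
      then show ?thesis unfolding Zr P_def[symmetric] using s by (simp only: Pr) simp
    qed
    finally have Q': "(Q has_real_derivative (X - 1) * (1 - X / (1 + r)) * Z) (at r)" .
    have "max 0 (1 - W r) = 1 / (1 + r)" using r by (simp add: W_def field_simps)
    moreover have "(1 / (1 + r)) powr s = 1 / X" using r by (simp add: X_def powr_divide)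
    moreover have "W r powr (-1-2 * s) = Z * (1 + r) * X\<^sup>2"
    proof -
      have "(1 + r) powr (1 + 2 * s) = (1 + r) * X\<^sup>2"
        using r powr_add[of "1 + r" s s] by (simp add: X_def powr_add power2_eq_square)
      moreover have "1 / (1 + r) powr (-1-2 * s) = (1 + r) powr (1 + 2 * s)"
        using powr_minus_divide[of "1 + r" "-1-2 * s"] by (simp add: add.commute)
      moreover have "W r powr (-1-2 * s) = Z * (1 / (1 + r) powr (-1-2 * s))"
        using r by (simp add: W_def Z_def powr_divide)
      ultimately show ?thesis by (simp only: mult.assoc)
    qed
    ultimately have hWr: "h (W r) = (1 - 1 / X) * (Z * (1 + r) * X\<^sup>2)" by (simp add: h_def)
    then have hW: "h (W r) * (1 / (1 + r)\<^sup>2) = (X - 1) * (X / (1 + r)) * Z"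
    proof -
      have "(1 - 1 / X) * X\<^sup>2 = (X - 1) * X"
        using r by (simp add: X_def field_simps power2_eq_square)
      moreover have "h (W r) * (1 / (1 + r)\<^sup>2) = (1 - 1 / X) * X\<^sup>2 * Z * ((1 + r) * (1 / (1 + r)\<^sup>2))"
        by (simp only: hWr mult_ac)
      moreover have "(1 + r) * (1 / (1 + r)\<^sup>2) = 1 / (1 + r)" using r by (simp add: power2_eq_square)
      ultimately show ?thesis by (simp only:) simp
    qed
    have "(G has_real_derivative (h r - h (W r) * (1 / (1 + r)\<^sup>2) - (X - 1) * (1 - X / (1 + r)) * Z)) (at r)"
      unfolding G_def by (intro DERIV_diff K r DERIV_chain2[OF K W'] Q' W)
    also have "h r - h (W r) * (1 / (1 + r)\<^sup>2) - (X - 1) * (1 - X / (1 + r)) * Z = second_diff_ramp s r * Z"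
    proof -
      have "(1 - B) * Z - (X - 1) * P * Z - (X - 1) * (1 - P) * Z = (2 - X - B) * Z" for B P
        by algebra
      note this[of "(max 0 (1 - r)) powr s" "X / (1 + r)"]
      moreover have "max 0 (1 + r) = 1 + r" using r by simp
      ultimately show ?thesis
        unfolding hW by (simp add: h_def second_diff_ramp_def flip: X_def Z_def)
    qed
    finally show ?thesis by (simp add: Z_def)
  qed
  have small: "((\<lambda>r. c * r powr (2-2 * s)) \<longlongrightarrow> 0) (at_right 0)" for c
    using s by (auto intro!: tendsto_eq_intros tendsto_zero_powrI simp: eventually_at_right_less eventually_at_filter)
  have lim0: "(G \<longlongrightarrow> 0) (at_right 0)"
  proof (rule Lim_null_comparison)
    show "\<forall>\<^sub>F r in at_right 0. norm (G r) \<le> (4 + 1 / (2 * s)) * r powr (2-2 * s)"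
      unfolding eventually_at_right_field
    proof (intro exI[of _ 1] conjI allI impI)
      fix r :: real assume r: "0 < r" "r < 1"
      obtain z where z: "W r < z" "z < r" "K r - K (W r) = (r - W r) * h z"
        using MVT2[of "W r" r K h] W[OF r(1)] K by (metis less_le_trans)
      have h0: "0 \<le> h z" and h1: "h z \<le> z * z powr (-1-2 * s)"
        unfolding h_def using one_minus_powr_bounds[OF s, of z] z r W[OF r(1)]
        by (auto intro!: mult_right_mono)
      note h1
      also have "z * z powr (-1-2 * s) = z powr (-2 * s)"
        using z W[OF r(1)] by (simp add: powr_mult_base)
      also have "\<dots> \<le> (r/2) powr (-2 * s)"
      proof (rule powr_mono2')
        have "r / 2 \<le> W r" using r by (simp add: W_def field_simps)
        then show "r / 2 \<le> z" using z by simp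
      qed (use s r in auto)
      also have "\<dots> = 2 powr (2 * s) * r powr (-2 * s)"
        using r by (simp add: powr_divide powr_minus_divide)
      also have "\<dots> \<le> 4 * r powr (-2 * s)"
        using powr_mono[of "2 * s" 2 "2::real"] s by (intro mult_right_mono) auto
      finally have hz: "0 \<le> h z" "h z \<le> 4 * r powr (-2 * s)" using h0 by auto
      have "\<bar>K r - K (W r)\<bar> \<le> r\<^sup>2 * (4 * r powr (-2 * s))"
        unfolding z(3) abs_mult
      proof (intro mult_mono)
        show "\<bar>r - W r\<bar> \<le> r\<^sup>2" using r by (simp add: W_def field_simps power2_eq_square)
      qed (use hz in auto)
      moreover have "\<bar>Q r\<bar> \<le> r\<^sup>2 * r powr (-2 * s) / (2 * s)"
      proof -
        have "\<bar>(1 + r) powr s - 1\<bar> \<le> r"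
        proof -
          have "1 \<le> (1 + r) powr s" using r s by (simp add: ge_one_powr_ge_zero)
          moreover have "s * r \<le> r" using r s by simp
          moreover have "(1 + r) powr s \<le> 1 + s * r" using powr_Bernoulli[of r s] r s by simp
          ultimately show ?thesis by linarith
        qed
        then have "((1 + r) powr s - 1)\<^sup>2 \<le> r\<^sup>2" by (simp add: abs_le_square_iff[symmetric])
        then show ?thesis unfolding Q_def using s by (auto intro!: divide_right_mono mult_right_mono)
      qed
      moreover have "r\<^sup>2 * r powr (-2 * s) = r powr (2-2 * s)"
        using powr_square_mult[OF r(1), of "-2 * s"] by simp
      ultimately show "norm (G r) \<le> (4 + 1 / (2 * s)) * r powr (2-2 * s)"
        by (simp add: G_def algebra_simps)
    qed simp
  qed (rule small)
  have inv: "((\<lambda>r::real. 1 / r) \<longlongrightarrow> 0) at_top"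
    by (intro tendsto_divide_0[OF tendsto_const] filterlim_at_top_imp_at_infinity filterlim_ident)
  have limQ: "(Q \<longlongrightarrow> 1 / (2 * s)) at_top"
  proof -
    have "((\<lambda>r::real. ((1 + 1/r) powr s - r powr (-s))\<^sup>2 / (2 * s)) \<longlongrightarrow> ((1 + 0) powr s - 0)\<^sup>2 / (2 * s)) at_top"
      using s by (intro tendsto_divide tendsto_power tendsto_diff tendsto_powr tendsto_add tendsto_const inv
           filterlim_ident tendsto_neg_powr) auto
    moreover have "\<forall>\<^sub>F r in at_top. ((1 + 1/r) powr s - r powr (-s))\<^sup>2 / (2 * s) = Q r"
      using eventually_gt_at_top[of 0]
    proof eventually_elim
      case (elim r)
      have "(1 + 1/r) powr s = (1 + r) powr s * r powr (-s)"
        using elim by (simp add: powr_minus_divide flip: powr_divide) (simp add: field_simps)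
      then have "((1 + 1/r) powr s - r powr (-s))\<^sup>2 = ((1 + r) powr s - 1)\<^sup>2 * (r powr (-s))\<^sup>2"
        by (simp add: power_mult_distrib[symmetric] algebra_simps)
      also have "(r powr (-s))\<^sup>2 = r powr (-2 * s)" by (simp add: power2_eq_square flip: powr_add)
      finally show ?case by (simp add: Q_def)
    qed
    ultimately show ?thesis using s by (auto intro: Lim_transform_eventually)
  qed
  have limW: "(W \<longlongrightarrow> 1) at_top"
  proof -
    have "((\<lambda>r::real. 1 / (1 + 1/r)) \<longlongrightarrow> 1 / (1 + 0)) at_top"
      by (intro tendsto_divide tendsto_add tendsto_const inv) auto
    moreover have "\<forall>\<^sub>F r in at_top. 1 / (1 + 1/r) = W r"
      using eventually_gt_at_top[of 0] by eventually_elim (simp add: W_def field_simps)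
    ultimately show ?thesis by (auto intro: Lim_transform_eventually)
  qed
  have limKW: "((\<lambda>r. K (W r)) \<longlongrightarrow> K 1) at_top"
    using isCont_tendsto_compose[OF DERIV_isCont[OF K[of 1]] limW] by simp
  \<comment> \<open>To the right of 1 the function \<open>h\<close> is the pure power \<open>r powr (-1-2 * s)\<close>.\<close>
  have K_eq: "K r = K 1 + (1 - r powr (-2 * s)) / (2 * s)" if "1 \<le> r" for r
  proof -
    have "(K r + r powr (-2 * s) / (2 * s)) = (K 1 + 1 powr (-2 * s) / (2 * s))"
    proof (rule DERIV_isconst2[of 1 "r+1"])
      show "continuous_on {1..r+1} (\<lambda>r. K r + r powr (-2 * s) / (2 * s))"
      proof (rule continuous_on_add)
        show "continuous_on {1..r+1} K"
          using DERIV_isCont[OF K] by (intro continuous_at_imp_continuous_on) auto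
        show "continuous_on {1..r+1} (\<lambda>r. r powr (-2 * s) / (2 * s))"
          using s by (intro continuous_intros) auto
      qed
      show "((\<lambda>r. K r + r powr (-2 * s) / (2 * s)) has_real_derivative 0) (at x)" if "1 < x" "x < r+1" for x
      proof -
        have "h x = x powr (-1-2 * s)" using that s by (simp add: h_def)
        moreover have "-2 * s - 1 = -1-2 * s" by simp
        moreover have "((\<lambda>r. r powr (-2 * s)) has_real_derivative (-2 * s) * x powr (-2 * s - 1)) (at x)"
          using that by (intro has_real_derivative_powr) auto
        ultimately have P: "((\<lambda>r. r powr (-2 * s)) has_real_derivative (-2 * s) * h x) (at x)" by (simp only:)
        show ?thesis
          using DERIV_add[OF K[of x] DERIV_cdivide[OF P, of "2 * s"]] that s by simp
      qed
    qed (use that in auto)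
    then show ?thesis by (simp add: diff_divide_distrib)
  qed
  have limK: "(K \<longlongrightarrow> K 1 + (1 - 0) / (2 * s)) at_top"
  proof -
    have "((\<lambda>r. K 1 + (1 - r powr (-2 * s)) / (2 * s)) \<longlongrightarrow> K 1 + (1 - 0) / (2 * s)) at_top"
      using s by (intro tendsto_add tendsto_divide tendsto_diff tendsto_const tendsto_neg_powr filterlim_ident) auto
    moreover have "\<forall>\<^sub>F r in at_top. K 1 + (1 - r powr (-2 * s)) / (2 * s) = K r"
      using eventually_ge_at_top[of 1] by eventually_elim (simp only: K_eq[symmetric])
    ultimately show ?thesis by (auto intro: Lim_transform_eventually)
  qed
  have limG: "(G \<longlongrightarrow> 0) at_top"
    using tendsto_diff[OF tendsto_diff[OF limK limKW] limQ] by (simp add: G_def[abs_def])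
  have "(LBINT r=0..\<infinity>. second_diff_ramp s r * r powr (-1-2 * s)) = 0 - 0"
  proof (rule interval_integral_FTC_integrable)
    show "isCont (\<lambda>r. second_diff_ramp s r * r powr (-1-2 * s)) x" if "0 < ereal x" for x
      unfolding second_diff_ramp_def using that s by (intro continuous_intros) auto
    show "(G has_vector_derivative second_diff_ramp s x * x powr (-1-2 * s)) (at x)" if "0 < ereal x" for x
      using G_deriv[of x] that by (simp add: has_real_derivative_iff_has_vector_derivative)
    show "set_integrable lborel (einterval 0 \<infinity>) (\<lambda>r. second_diff_ramp s r * r powr (-1-2 * s))"
      using ramp_kernel_integrable[OF s] by (simp add: zero_ereal_def)
    show "((G \<circ> real_of_ereal) \<longlongrightarrow> 0) (at_right 0)"
      using lim0 by (simp add: zero_ereal_def ereal_tendsto_simps1)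
    show "((G \<circ> real_of_ereal) \<longlongrightarrow> 0) (at_left \<infinity>)"
      using limG by (simp add: ereal_tendsto_simps)
  qed simp
  then show ?thesis by (simp add: interval_lebesgue_integral_def zero_ereal_def)
qed

section \<open>From the line to the plane\<close>

lemma distr_lborel_orthogonal:
  fixes R :: "real^2 \<Rightarrow> real^2"
  assumes R: "orthogonal_transformation R"
  shows "distr lborel borel R = lborel"
proof (rule lborel_eqI[symmetric])
  have cont: "continuous_on UNIV R"
    using orthogonal_transformation_linear[OF R] by (simp add: linear_continuous_on linear_conv_bounded_linear)
  then have [measurable]: "R \<in> borel_measurable borel" by (rule borel_measurable_continuous_onI)
  fix l u :: "real^2" assume lu: "\<And>b. b \<in> Basis \<Longrightarrow> l \<bullet> b \<le> u \<bullet> b"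
  have inv: "orthogonal_transformation (inv R)" by (rule orthogonal_transformation_inv[OF R])
  have pre: "R -` box l u = inv R ` box l u"
    using orthogonal_transformation_bij[OF R] by (simp add: bij_vimage_eq_inv_image)
  have meas: "inv R ` box l u \<in> sets borel"
    using open_vimage[OF open_box cont, of l u] by (simp add: pre[symmetric])
  have lm: "inv R ` box l u \<in> lmeasurable"
    by (rule measurable_orthogonal_image[OF inv]) simp
  have "emeasure (distr lborel borel R) (box l u) = emeasure lborel (inv R ` box l u)"
    by (simp add: emeasure_distr pre)
  also have "\<dots> = emeasure lebesgue (inv R ` box l u)" using meas by simp
  also have "\<dots> = ennreal (measure lebesgue (inv R ` box l u))"
    by (rule emeasure_eq_measure2[OF lm])
  also have "measure lebesgue (inv R ` box l u) = measure lebesgue (box l u)"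
    by (rule measure_orthogonal_image[OF inv]) simp
  also have "\<dots> = (\<Prod>b\<in>Basis. (u - l) \<bullet> b)" using lu by (simp add: measure_lborel_box_eq)
  finally show "emeasure (distr lborel borel R) (box l u) = (\<Prod>b\<in>Basis. (u - l) \<bullet> b)" .
qed simp

lemma Basis_R2: "(Basis :: (real^2) set) = {axis 1 1, axis 2 1}"
  by (auto simp: Basis_vec_def exhaust_2 axis_eq_axis) (metis exhaust_2)+

text \<open>This turns integrals over the plane into iterated integrals over the line; together with rotations
  it allows any orthonormal frame.\<close>

lemma distr_lborel_coordinates:
  "distr (lborel \<Otimes>\<^sub>M lborel) borel (\<lambda>(u, v). vector [u, v] :: real^2) = lborel"
proof (rule lborel_eqI[symmetric])
  let ?T = "\<lambda>(u, v). vector [u, v] :: real^2"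
  have T_eq: "?T = (\<lambda>p. fst p *\<^sub>R axis 1 1 + snd p *\<^sub>R axis 2 1)"
    by (auto simp: fun_eq_iff vec_eq_iff forall_2 axis_def)
  have [measurable]: "?T \<in> lborel \<Otimes>\<^sub>M lborel \<rightarrow>\<^sub>M borel"
    unfolding T_eq by measurable
  fix l u :: "real^2" assume lu: "\<And>b. b \<in> Basis \<Longrightarrow> l \<bullet> b \<le> u \<bullet> b"
  then have le: "l $ 1 \<le> u $ 1" "l $ 2 \<le> u $ 2"
    using lu[of "axis 1 1"] lu[of "axis 2 1"] by (simp_all add: Basis_R2 inner_axis)
  have pre: "?T -` box l u = {l$1<..<u$1} \<times> {l$2<..<u$2}"
    by (auto simp: mem_box_cart forall_2)
  have "emeasure (distr (lborel \<Otimes>\<^sub>M lborel) borel ?T) (box l u) = emeasure (lborel \<Otimes>\<^sub>M lborel) ({l$1<..<u$1} \<times> {l$2<..<u$2})"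
    by (subst emeasure_distr) (auto simp: pre space_pair_measure)
  also have "\<dots> = ennreal (u$1 - l$1) * ennreal (u$2 - l$2)"
    using le by (subst lborel.emeasure_pair_measure_Times) auto
  also have "\<dots> = (\<Prod>b\<in>Basis. (u - l) \<bullet> b)"
    using le by (simp add: Basis_R2 inner_axis axis_eq_axis ennreal_mult)
  finally show "emeasure (distr (lborel \<Otimes>\<^sub>M lborel) borel ?T) (box l u) = (\<Prod>b\<in>Basis. (u - l) \<bullet> b)" .
qed simp

lemma distr_lborel_frame:
  fixes e e' :: "real^2"
  assumes e: "norm e = 1" "norm e' = 1" "e \<bullet> e' = 0"
  shows "distr (lborel \<Otimes>\<^sub>M lborel) borel (\<lambda>(u, v). u *\<^sub>R e + v *\<^sub>R e') = lborel"
proof -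
  define R where "R y = (y$1) *\<^sub>R e + (y$2) *\<^sub>R e'" for y :: "real^2"
  have ee: "e \<bullet> e = 1" "e' \<bullet> e' = 1" using e by (simp_all add: norm_eq_sqrt_inner)
  have "linear R" by (rule linearI) (simp_all add: R_def algebra_simps)
  moreover have "R x \<bullet> R y = x \<bullet> y" for x y
    by (simp add: R_def inner_add_left inner_add_right ee e inner_commute[of e' e]) (simp add: inner_vec_def sum_2)
  ultimately have R: "orthogonal_transformation R" by (simp add: orthogonal_transformation_def)
  have m: "R \<in> borel_measurable borel"
    unfolding R_def by measurable
  let ?T = "\<lambda>(u, v). vector [u, v] :: real^2"
  have T_eq: "?T = (\<lambda>p. fst p *\<^sub>R axis 1 1 + snd p *\<^sub>R axis 2 1)"
    by (auto simp: fun_eq_iff vec_eq_iff forall_2 axis_def)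
  have mT: "?T \<in> lborel \<Otimes>\<^sub>M lborel \<rightarrow>\<^sub>M borel"
    unfolding T_eq by measurable
  have "lborel = distr lborel borel R" by (rule distr_lborel_orthogonal[OF R, symmetric])
  also have "\<dots> = distr (distr (lborel \<Otimes>\<^sub>M lborel) borel ?T) borel R"
    by (simp only: distr_lborel_coordinates)
  also have "\<dots> = distr (lborel \<Otimes>\<^sub>M lborel) borel (R \<circ> ?T)"
    by (rule distr_distr[OF m mT])
  also have "R \<circ> ?T = (\<lambda>(u, v). u *\<^sub>R e + v *\<^sub>R e')" by (auto simp: R_def fun_eq_iff)
  finally show ?thesis by simp
qed

lemma ramp_kernel_1D:
  assumes s: "0 < s" "s < 1" and "c > 0"
  shows "has_bochner_integral lborel (\<lambda>u. second_diff_ramp s (c * u) * \<bar>u\<bar> powr (-1-2 * s)) 0"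
proof -
  define J where "J u = indicator {0<..} u * (second_diff_ramp s u * u powr (-1-2 * s))" for u :: real
  define k where "k u = second_diff_ramp s u * \<bar>u\<bar> powr (-1-2 * s)" for u
  have J: "has_bochner_integral lborel J 0"
    using ramp_kernel_integrable[OF s] integral_second_diff_ramp_1D[OF s]
    by (simp add: has_bochner_integral_iff set_integrable_def set_lebesgue_integral_def J_def[abs_def])
  have "has_bochner_integral lborel (\<lambda>u. J u + J (- u)) (0 + 0)"
    using J lborel_has_bochner_integral_real_affine_iff[of "-1" J 0 0]
    by (intro has_bochner_integral_add) simp_all
  moreover have "J u + J (- u) = k u" for u
    by (cases u "0::real" rule: linorder_cases) (simp_all add: J_def k_def second_diff_ramp_minus)
  ultimately have "has_bochner_integral lborel k 0" by simp
  then have "has_bochner_integral lborel (\<lambda>u. k (c * u)) 0"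
    using lborel_has_bochner_integral_real_affine_iff[of c k 0 0] \<open>c > 0\<close> by simp
  then have "has_bochner_integral lborel (\<lambda>u. c powr (1 + 2 * s) * k (c * u)) (c powr (1 + 2 * s) * 0)"
    by (intro has_bochner_integral_mult_right)
  moreover have "c powr (1 + 2 * s) * k (c * u) = second_diff_ramp s (c * u) * \<bar>u\<bar> powr (-1-2 * s)" for u
  proof -
    have "c powr (1 + 2 * s) * c powr (-1-2 * s) = c powr 0" unfolding powr_add[symmetric] by simp
    then show ?thesis using \<open>c > 0\<close> by (simp add: k_def abs_mult powr_mult)
  qed
  ultimately show ?thesis by simp
qed

lemma integrable_inverse_1_plus_square: "integrable lborel (\<lambda>v::real. inverse (1 + v\<^sup>2))"
proof -
  define J :: "real \<Rightarrow> real" where "J v = indicator {0..} v * inverse (1 + v\<^sup>2)" for v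
  have [measurable]: "J \<in> borel_measurable borel" unfolding J_def by measurable
  have J: "integrable lborel J"
  proof (rule integrableI_nonneg)
    have "(\<integral>\<^sup>+v. ennreal (J v) \<partial>lborel) = (\<integral>\<^sup>+v. ennreal (inverse (1 + v\<^sup>2)) * indicator {0..} v \<partial>lborel)"
      by (intro nn_integral_cong) (simp add: J_def split: split_indicator)
    also have "\<dots> = ennreal (pi / 2 - arctan 0)"
      by (intro nn_integral_FTC_atLeast DERIV_arctan tendsto_arctan_at_top) (auto simp: add_pos_nonneg)
    finally show "(\<integral>\<^sup>+v. ennreal (J v) \<partial>lborel) < \<infinity>" by simp
  qed (auto simp: J_def add_nonneg_nonneg)
  have "integrable lborel (\<lambda>v. J v + J (0 + (-1) * v))"
    using J lborel_integrable_real_affine[OF J, of "-1" 0] by (intro Bochner_Integration.integrable_add) auto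
  then show ?thesis
    by (rule Bochner_Integration.integrable_bound) (auto simp: J_def split: split_indicator)
qed

lemma integrable_1_plus_square_powr:
  assumes "0 < s" shows "integrable lborel (\<lambda>v::real. (1 + v\<^sup>2) powr (-1-s))"
proof (rule Bochner_Integration.integrable_bound)
  show "integrable lborel (\<lambda>v::real. inverse (1 + v\<^sup>2))"
    by (rule integrable_inverse_1_plus_square)
  show "AE v in lborel. norm ((1 + v\<^sup>2) powr (-1-s)) \<le> norm (inverse (1 + v\<^sup>2))"
  proof (rule AE_I2)
    fix v :: real
    have "(1 + v\<^sup>2) powr (-1-s) \<le> (1 + v\<^sup>2) powr (-1)" using assms by (intro powr_mono) auto
    also have "\<dots> = inverse (1 + v\<^sup>2)" by (simp add: powr_minus add_pos_nonneg)
    finally show "norm ((1 + v\<^sup>2) powr (-1-s)) \<le> norm (inverse (1 + v\<^sup>2))"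
      by (simp add: add_pos_nonneg)
  qed
qed measurable

text \<open>Scaling \<open>v = u * v'\<close>: integrating the planar kernel along a line at distance \<open>\<bar>u\<bar>\<close> from the origin
  leaves a multiple of the kernel of the one-dimensional operator.\<close>

lemma inner_kernel_integral:
  assumes "0 < s" "u \<noteq> (0::real)"
  defines "\<kappa> \<equiv> (LBINT v. (1 + v\<^sup>2) powr (-1-s))"
  shows "has_bochner_integral lborel (\<lambda>v. (u\<^sup>2 + v\<^sup>2) powr (-1-s)) (\<bar>u\<bar> powr (-1-2 * s) * \<kappa>)"
proof -
  have eq: "(u\<^sup>2 + (0 + u * v)\<^sup>2) powr (-1-s) = \<bar>u\<bar> powr (-2-2 * s) * (1 + v\<^sup>2) powr (-1-s)" for v
  proof -
    have "u\<^sup>2 + (0 + u * v)\<^sup>2 = \<bar>u\<bar>\<^sup>2 * (1 + v\<^sup>2)" by (simp add: algebra_simps)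
    also have "\<bar>u\<bar>\<^sup>2 = \<bar>u\<bar> powr 2" using assms by simp
    finally have "(u\<^sup>2 + (0 + u * v)\<^sup>2) powr (-1-s) = (\<bar>u\<bar> powr 2) powr (-1-s) * (1 + v\<^sup>2) powr (-1-s)"
      by (simp only: powr_mult)
    also have "(\<bar>u\<bar> powr 2) powr (-1-s) = \<bar>u\<bar> powr (-2-2 * s)"
      by (simp only: powr_powr) (simp add: algebra_simps)
    finally show ?thesis .
  qed
  have "has_bochner_integral lborel (\<lambda>v. (1 + v\<^sup>2) powr (-1-s)) \<kappa>"
    unfolding \<kappa>_def using integrable_1_plus_square_powr[OF assms(1)] by (rule has_bochner_integral_integrable)
  then have "has_bochner_integral lborel (\<lambda>v. \<bar>u\<bar> powr (-2-2 * s) * (1 + v\<^sup>2) powr (-1-s)) (\<bar>u\<bar> powr (-2-2 * s) * \<kappa>)"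
    by (intro has_bochner_integral_mult_right)
  then have "has_bochner_integral lborel (\<lambda>v. (u\<^sup>2 + (0 + u * v)\<^sup>2) powr (-1-s)) (\<bar>u\<bar> powr (-2-2 * s) * \<kappa>)"
    unfolding eq by simp
  moreover have "(\<bar>u\<bar> powr (-1-2 * s) * \<kappa>) /\<^sub>R \<bar>u\<bar> = \<bar>u\<bar> powr (-2-2 * s) * \<kappa>"
    using powr_diff[of "\<bar>u\<bar>" "-1-2 * s" 1] assms(2) by (simp add: divide_inverse mult_ac algebra_simps)
  ultimately show ?thesis
    by (subst lborel_has_bochner_integral_real_affine_iff[OF assms(2), of _ _ 0]) (simp only:)
qed

text \<open>A function of \<open>a \<bullet> y\<close> alone is constant along the lines orthogonal to \<open>a\<close>, so the planar integral
  reduces to the one-dimensional identity.\<close>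

lemma second_diff_ramp_2D:
  fixes a :: "real^2"
  assumes s: "0 < s" "s < 1"
  shows "has_bochner_integral lborel (\<lambda>y. second_diff_ramp s (a \<bullet> y) * norm y powr (-2-2 * s)) 0"
proof (cases "a = 0")
  case True
  then show ?thesis by (simp add: second_diff_ramp_def has_bochner_integral_zero)
next
  case False
  define c where "c = norm a"
  define e where "e = a /\<^sub>R c"
  have c: "c > 0" and e1: "norm e = 1" and a: "a = c *\<^sub>R e" using False by (simp_all add: c_def e_def)
  obtain e' where e': "norm e' = 1" "e \<bullet> e' = 0"
    using exists_orthogonal_unit_R2[OF e1] by metis
  have ee: "e \<bullet> e = 1" "e' \<bullet> e' = 1" using e1 e' by (simp_all add: norm_eq_sqrt_inner)
  let ?f = "\<lambda>y. second_diff_ramp s (a \<bullet> y) * norm y powr (-2-2 * s)"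
  let ?T = "\<lambda>(u, v). u *\<^sub>R e + v *\<^sub>R e'"
  define F where "F p = second_diff_ramp s (c * fst p) * ((fst p)\<^sup>2 + (snd p)\<^sup>2) powr (-1-s)" for p :: "real \<times> real"
  have [measurable]: "F \<in> borel_measurable (lborel \<Otimes>\<^sub>M lborel)" unfolding F_def by measurable
  define \<kappa> where "\<kappa> = (LBINT v. (1 + v\<^sup>2) powr (-1-s))"
  have F_eq: "?f (?T p) = F p" for p
  proof (cases p)
    case (Pair u v)
    have "(u *\<^sub>R e + v *\<^sub>R e') \<bullet> (u *\<^sub>R e + v *\<^sub>R e') = u\<^sup>2 + v\<^sup>2"
      by (simp add: inner_add_left inner_add_right ee e' inner_commute[of e' e] power2_eq_square)
    then have "norm (u *\<^sub>R e + v *\<^sub>R e') = (u\<^sup>2 + v\<^sup>2) powr (1/2)"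
      by (simp add: norm_eq_sqrt_inner powr_half_sqrt)
    then have "norm (u *\<^sub>R e + v *\<^sub>R e') powr (-2-2 * s) = (u\<^sup>2 + v\<^sup>2) powr (-1-s)"
      by (simp add: powr_powr algebra_simps)
    moreover have "a \<bullet> (u *\<^sub>R e + v *\<^sub>R e') = c * u"
      by (simp add: a inner_add_right ee e')
    ultimately show ?thesis by (simp add: Pair F_def)
  qed
  have inner: "has_bochner_integral lborel (\<lambda>v. F (u, v)) (second_diff_ramp s (c * u) * (\<bar>u\<bar> powr (-1-2 * s) * \<kappa>))"
    if "u \<noteq> 0" for u
    unfolding F_def fst_conv snd_conv \<kappa>_def
    using inner_kernel_integral[OF s(1) that] by (intro has_bochner_integral_mult_right)
  have inner_abs: "has_bochner_integral lborel (\<lambda>v. norm (F (u, v))) (\<bar>second_diff_ramp s (c * u)\<bar> * (\<bar>u\<bar> powr (-1-2 * s) * \<kappa>))"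
    if "u \<noteq> 0" for u
  proof -
    have "norm (F (u, v)) = \<bar>second_diff_ramp s (c * u)\<bar> * (u\<^sup>2 + v\<^sup>2) powr (-1-s)" for v
      by (simp add: F_def abs_mult)
    then show ?thesis
      unfolding \<kappa>_def using inner_kernel_integral[OF s(1) that]
      by (simp only:) (intro has_bochner_integral_mult_right)
  qed
  have outer: "has_bochner_integral lborel (\<lambda>u. second_diff_ramp s (c * u) * (\<bar>u\<bar> powr (-1-2 * s) * \<kappa>)) 0"
  proof -
    have "has_bochner_integral lborel (\<lambda>u. second_diff_ramp s (c * u) * \<bar>u\<bar> powr (-1-2 * s) * \<kappa>) (0 * \<kappa>)"
      using ramp_kernel_1D[OF s c] by (intro has_bochner_integral_mult_left)
    then show ?thesis by (simp add: mult.assoc)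
  qed
  have ae: "AE u in lborel. u \<noteq> (0::real)" by (rule AE_lborel_singleton)
  have intF: "integrable (lborel \<Otimes>\<^sub>M lborel) F"
  proof (rule lborel_pair.Fubini_integrable)
    have "integrable lborel (\<lambda>u. \<bar>second_diff_ramp s (c * u) * (\<bar>u\<bar> powr (-1-2 * s) * \<kappa>)\<bar>)"
      using outer by (intro integrable_abs) (simp add: has_bochner_integral_iff)
    moreover have "\<kappa> \<ge> 0" unfolding \<kappa>_def by simp
    ultimately have *: "integrable lborel (\<lambda>u. \<bar>second_diff_ramp s (c * u)\<bar> * (\<bar>u\<bar> powr (-1-2 * s) * \<kappa>))"
      by (simp add: abs_mult)
    show "integrable lborel (\<lambda>u. LBINT v. norm (F (u, v)))"
    proof (rule integrable_cong_AE_imp[OF *])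
      show "AE u in lborel. \<bar>second_diff_ramp s (c * u)\<bar> * (\<bar>u\<bar> powr (-1-2 * s) * \<kappa>) = (LBINT v. norm (F (u, v)))"
        using ae by eventually_elim (simp only: has_bochner_integral_integral_eq[OF inner_abs] not_False_eq_True)
    qed measurable
    show "AE u in lborel. integrable lborel (\<lambda>v. F (u, v))"
      using ae by eventually_elim (use inner in \<open>auto simp: has_bochner_integral_iff\<close>)
  qed measurable
  have "integral\<^sup>L (lborel \<Otimes>\<^sub>M lborel) F = (LBINT u. LBINT v. F (u, v))"
    using lborel_pair.integral_fst'[OF intF] by simp
  also have "\<dots> = (LBINT u. second_diff_ramp s (c * u) * (\<bar>u\<bar> powr (-1-2 * s) * \<kappa>))"
    by (rule integral_cong_AE)
       (use ae in \<open>auto elim!: eventually_mono simp: has_bochner_integral_integral_eq[OF inner]\<close>)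
  also have "\<dots> = 0" using outer by (simp add: has_bochner_integral_iff)
  finally have "has_bochner_integral (lborel \<Otimes>\<^sub>M lborel) (\<lambda>p. ?f (?T p)) 0"
    using intF by (simp add: F_eq has_bochner_integral_iff)
  then have "has_bochner_integral (distr (lborel \<Otimes>\<^sub>M lborel) borel ?T) ?f 0"
    by (subst has_bochner_integral_iff, subst (asm) has_bochner_integral_iff, subst integrable_distr_eq)
       (auto simp: integral_distr)
  then show ?thesis by (simp only: distr_lborel_frame[OF e1 e'])
qed

section \<open>Pointwise bounds for the barrier\<close>

lemma powr_subadditive:
  fixes a b s :: real
  assumes "0 \<le> a" "0 \<le> b" "0 < s" "s \<le> 1"
  shows "(a + b) powr s \<le> a powr s + b powr s"
proof (cases "a + b = 0")
  case False
  then have ab: "a + b > 0" using assms by simp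
  have *: "c / (a + b) \<le> (c / (a + b)) powr s" if "0 \<le> c" "c \<le> a + b" for c
    using powr_mono'[of s 1 "c / (a + b)"] that assms ab by auto
  have "1 = a / (a + b) + b / (a + b)" using ab by (simp add: add_divide_distrib[symmetric])
  also have "\<dots> \<le> (a / (a + b)) powr s + (b / (a + b)) powr s"
    using assms by (intro add_mono *) auto
  also have "\<dots> = (a powr s + b powr s) / (a + b) powr s"
    using assms ab by (simp add: powr_divide add_divide_distrib)
  finally show ?thesis using ab by (simp add: divide_simps)
qed (use assms in auto)

text \<open>Since \<open>0 powr s = 0\<close>, this is \<open>q powr s * ln (1/q)\<close> with \<open>q = 1 - norm z ^ 2\<close> inside the disc and 0
  outside of it.\<close>

definition barrier :: "real \<Rightarrow> real^2 \<Rightarrow> real" where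
  "barrier s z = - ((max 0 (1 - z \<bullet> z)) powr s * ln (max 0 (1 - z \<bullet> z)))"

text \<open>Near \<open>v = 0\<close> the function \<open>(1 + v) powr s * ln (1 + v)\<close> is \<open>v\<close> up to a quadratic error. In a symmetric
  second difference the linear terms nearly cancel, so only the error counts.\<close>

lemma one_plus_powr_ln_bounds:
  fixes s v :: real
  assumes "0 < s" "s < 1" "\<bar>v\<bar> \<le> 1/2"
  shows "(1 + v) powr s * ln (1 + v) \<le> v + v\<^sup>2" "v - 2 * v\<^sup>2 \<le> (1 + v) powr s * ln (1 + v)"
proof -
  have v: "-1/2 \<le> v" "v \<le> 1/2" "0 < 1 + v" using assms by auto
  have "ln (1 + v) \<le> v" using ln_add_one_self_le_self2[of v] v by simp
  then have "(1 + v) powr s * ln (1 + v) \<le> (1 + v) powr s * v" by (intro mult_left_mono) auto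
  also have "\<dots> \<le> (1 + v) * v"
  proof (cases "0 \<le> v")
    case True
    then show ?thesis using powr_mono[of s 1 "1 + v"] assms v by (intro mult_right_mono) auto
  next
    case False
    then show ?thesis using powr_mono'[of s 1 "1 + v"] assms v by (intro mult_right_mono_neg) auto
  qed
  finally show "(1 + v) powr s * ln (1 + v) \<le> v + v\<^sup>2" by (simp add: algebra_simps power2_eq_square)
  have ln_lower: "v - 2 * v\<^sup>2 \<le> ln (1 + v)"
  proof (cases "0 \<le> v")
    case True
    then have "v - v\<^sup>2 \<le> ln (1 + v)" using ln_one_plus_pos_lower_bound[of v] v by simp
    then show ?thesis using zero_le_power2[of v] by linarith
  qed (use ln_one_minus_pos_lower_bound[of "-v"] v in auto)
  show "v - 2 * v\<^sup>2 \<le> (1 + v) powr s * ln (1 + v)"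
  proof (cases "0 \<le> v")
    case True
    then have "1 * ln (1 + v) \<le> (1 + v) powr s * ln (1 + v)"
      using assms by (intro mult_right_mono) (auto simp: ge_one_powr_ge_zero)
    then show ?thesis using ln_lower by simp
  next
    case False
    then have "1 * ln (1 + v) \<le> (1 + v) powr s * ln (1 + v)"
      using assms v powr_mono2[of s "1 + v" 1] by (intro mult_right_mono_neg) auto
    then show ?thesis using ln_lower by simp
  qed
qed

lemma powr_add_le_linear:
  fixes b p s :: real
  assumes "0 < s" "s < 1" "1/2 \<le> b" "0 \<le> p"
  shows "(b + p) powr s \<le> b powr s + 2 * p"
proof -
  have "(b + p) powr s = b powr s * (1 + p / b) powr s"
    using assms by (simp add: powr_mult[symmetric] distrib_left)
  also have "\<dots> \<le> b powr s * (1 + s * (p / b))"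
    using assms by (intro mult_left_mono powr_Bernoulli) (auto intro: order_trans[of _ 0])
  also have "\<dots> = b powr s + s * p * b powr (s - 1)"
    using assms by (simp add: powr_diff algebra_simps)
  also have "s * p * b powr (s - 1) \<le> 1 * p * 2"
  proof (intro mult_mono)
    have "b powr (s - 1) \<le> (1/2) powr (s - 1)" using assms by (intro powr_mono2') auto
    also have "\<dots> = 2 powr (1 - s)" by (simp add: powr_divide powr_minus_divide[symmetric])
    also have "\<dots> \<le> 2 powr 1" using assms by (intro powr_mono) auto
    finally show "b powr (s - 1) \<le> 2" by simp
  qed (use assms in auto)
  finally show ?thesis by simp
qed

text \<open>In units of \<open>t\<close>, the value of \<open>1 - norm x ^ 2\<close> at the base point, the barrier splits into a multiple of
  a power, with the large factor \<open>- ln t\<close>, and a term without large factor.\<close>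

lemma barrier_eq_scaled:
  assumes "0 < t" "-1 < v" "1 - z \<bullet> z = t * (1 + v)"
  shows "barrier s z = t powr s * ((1 + v) powr s * (- ln t) - (1 + v) powr s * ln (1 + v))"
proof -
  have "max 0 (1 - z \<bullet> z) = t * (1 + v)" using assms by simp
  then show ?thesis unfolding barrier_def
    using assms(1,2) by (simp only: powr_mult ln_mult) (simp add: algebra_simps)
qed

context
  fixes s t :: real and x :: "real^2"
  assumes s: "0 < s" "s < 1" and x: "norm x < 1" and t_def: "t = 1 - x \<bullet> x"
begin

text \<open>The two bounds for the logarithm decide how much of it is absorbed: near \<open>x\<close> one can spend a full power
  of \<open>t\<close>, far away only \<open>t powr (s/2)\<close>.\<close>

lemma t_bounds: "0 < t" "t \<le> 1" "0 \<le> - ln t" "- ln t \<le> 1 / t" "- ln t \<le> (2 / s) * t powr (- (s/2))"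
proof -
  show t: "0 < t" using x unfolding t_def norm_eq_sqrt_inner by simp
  show t1: "t \<le> 1" by (simp add: t_def)
  show "0 \<le> - ln t" using t t1 by simp
  have "ln (1/t) \<le> (1/t) powr (s/2) / (s/2)" using t t1 s by (intro ln_powr_bound) auto
  then show "- ln t \<le> (2 / s) * t powr (- (s/2))"
    using t by (simp add: ln_div powr_divide powr_minus_divide mult.commute)
  have "ln (1/t) \<le> (1/t) powr 1 / 1" using t t1 by (intro ln_powr_bound) auto
  then show "- ln t \<le> 1 / t" using t by (simp add: ln_div)
qed

text \<open>Relative to \<open>t\<close>, a step \<open>\<plusminus>y\<close> changes \<open>1 - norm x ^ 2\<close> by \<open>\<minusplus>r - p\<close>: the linear part \<open>r\<close> belongs to
  the tangent plane, \<open>p\<close> is the exact curvature term. The restriction to \<open>norm y \<le> t / 8\<close> keeps the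
  relative change below 1/2.\<close>

lemma near_setup:
  assumes "norm y \<le> t / 8"
  defines "p \<equiv> (norm y)\<^sup>2 / t" and "r \<equiv> 2 * (x \<bullet> y) / t"
  shows "0 \<le> p" "p \<le> (norm y)\<^sup>2 / t\<^sup>2" "\<bar>- r - p\<bar> \<le> 1/2" "\<bar>r - p\<bar> \<le> 1/2" "\<bar>r\<bar> \<le> 1/4"
    "(- r - p)\<^sup>2 + (r - p)\<^sup>2 \<le> 18 * (norm y)\<^sup>2 / t\<^sup>2"
    "1 - (x + y) \<bullet> (x + y) = t * (1 + (- r - p))" "1 - (x - y) \<bullet> (x - y) = t * (1 + (r - p))"
    "r\<^sup>2 \<le> 4 * (norm y)\<^sup>2 / t\<^sup>2"
proof -
  note t = t_bounds(1,2)
  show "0 \<le> p" using t by (simp add: p_def)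
  have p_le: "p \<le> norm y / t"
  proof -
    have "(norm y)\<^sup>2 \<le> norm y * 1" unfolding power2_eq_square using assms(1) t by (intro mult_left_mono) auto
    then show ?thesis using t by (simp add: p_def divide_right_mono)
  qed
  have "\<bar>x \<bullet> y\<bar> \<le> norm y"
    using Cauchy_Schwarz_ineq2[of x y] mult_right_mono[of "norm x" 1 "norm y"] x by simp
  then have r_le: "\<bar>r\<bar> \<le> 2 * (norm y / t)" using t by (simp add: r_def abs_mult divide_right_mono)
  have yt: "norm y / t \<le> 1/8" using assms(1) t by (simp add: divide_simps)
  show "\<bar>r\<bar> \<le> 1/4" using r_le yt by linarith
  have b: "\<bar>- r - p\<bar> \<le> 3 * (norm y / t)" "\<bar>r - p\<bar> \<le> 3 * (norm y / t)"
    using r_le p_le \<open>0 \<le> p\<close> by linarith+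
  then show "\<bar>- r - p\<bar> \<le> 1/2" "\<bar>r - p\<bar> \<le> 1/2" using yt by linarith+
  have "(- r - p)\<^sup>2 \<le> (3 * (norm y / t))\<^sup>2" "(r - p)\<^sup>2 \<le> (3 * (norm y / t))\<^sup>2"
    using power_mono[OF b(1), of 2] power_mono[OF b(2), of 2] by simp_all
  then show "(- r - p)\<^sup>2 + (r - p)\<^sup>2 \<le> 18 * (norm y)\<^sup>2 / t\<^sup>2" by (simp add: power_mult_distrib power_divide)
  show "r\<^sup>2 \<le> 4 * (norm y)\<^sup>2 / t\<^sup>2"
    using power_mono[OF r_le, of 2] by (simp add: power_mult_distrib power_divide)
  have "(norm y)\<^sup>2 * t \<le> (norm y)\<^sup>2 * 1" using t by (intro mult_left_mono) auto
  then show "p \<le> (norm y)\<^sup>2 / t\<^sup>2" using t by (simp add: p_def divide_simps power2_eq_square)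
  show "1 - (x + y) \<bullet> (x + y) = t * (1 + (- r - p))" "1 - (x - y) \<bullet> (x - y) = t * (1 + (r - p))"
    using t by (simp_all add: r_def p_def power2_norm_eq_inner right_diff_distrib distrib_left)
      (simp_all add: t_def inner_add_left inner_add_right inner_diff_left inner_diff_right inner_commute[of y x])
qed

lemma barrier_at: "barrier s x = t powr s * (- ln t)"
  using t_bounds by (simp add: barrier_def flip: t_def)

text \<open>The power with factor \<open>- ln t\<close> is replaced by that of the tangent plane, which costs a multiple of
  \<open>p\<close>, and \<open>- ln t * p \<le> (norm y)\<^sup>2 / t\<^sup>2\<close>. In the remaining term the linear parts add up to \<open>-2p\<close>.
  The lower bound has the same quadratic form and serves integrability.\<close>

lemma barrier_second_diff_near:
  assumes "norm y \<le> t / 8"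
  shows "2 * barrier s x - barrier s (x + y) - barrier s (x - y)
      \<le> t powr s * (- ln t) * second_diff_ramp s (2 * (x \<bullet> y) / t) + 22 * t powr (s - 2) * (norm y)\<^sup>2"
    and "- (38 * t powr (s - 2) * (norm y)\<^sup>2) \<le> 2 * barrier s x - barrier s (x + y) - barrier s (x - y)"
proof -
  define p r where "p = (norm y)\<^sup>2 / t" and "r = 2 * (x \<bullet> y) / t"
  define Y where "Y = (norm y)\<^sup>2 / t\<^sup>2"
  define L where "L = - ln t"
  note ns = near_setup[OF assms, folded p_def r_def]
  note t = t_bounds
  have ts: "0 \<le> t powr s" by simp
  have tY: "t powr s * Y = t powr (s - 2) * (norm y)\<^sup>2"
    using t by (simp add: Y_def powr_diff)
  have Lp: "L * p \<le> Y"
  proof -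
    have "L * p \<le> (1 / t) * p" using t ns(1) by (intro mult_right_mono) (auto simp: L_def)
    also have "\<dots> = Y" by (simp add: p_def Y_def power2_eq_square)
    finally show ?thesis .
  qed
  define v w where "v = - r - p" and "w = r - p"
  have vw: "\<bar>v\<bar> \<le> 1/2" "\<bar>w\<bar> \<le> 1/2" "v\<^sup>2 + w\<^sup>2 \<le> 18 * Y" "v + w = - 2 * p"
    using ns by (simp_all add: v_def w_def Y_def)
  have fv: "barrier s (x + y) = t powr s * ((1 + v) powr s * L - (1 + v) powr s * ln (1 + v))"
    unfolding L_def using vw(1) t ns(7) by (intro barrier_eq_scaled) (auto simp: v_def[symmetric] abs_le_iff)
  have fw: "barrier s (x - y) = t powr s * ((1 + w) powr s * L - (1 + w) powr s * ln (1 + w))"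
    unfolding L_def using vw(2) t ns(8) by (intro barrier_eq_scaled) (auto simp: w_def[symmetric] abs_le_iff)
  have eq: "2 * barrier s x - barrier s (x + y) - barrier s (x - y) =
     t powr s * (L * (2 - (1 + v) powr s - (1 + w) powr s) + (1 + v) powr s * ln (1 + v) + (1 + w) powr s * ln (1 + w))"
    unfolding fv fw barrier_at L_def by (simp add: algebra_simps)
  have L0: "0 \<le> L" using t by (simp add: L_def)
  have "(max 0 (1 - r)) powr s \<le> (1 + v) powr s + 2 * p"
  proof -
    have "1/2 \<le> 1 + v" using vw(1) by linarith
    from powr_add_le_linear[OF s this ns(1)] show ?thesis using ns(5) by (simp add: v_def abs_le_iff)
  qed
  moreover have "(max 0 (1 + r)) powr s \<le> (1 + w) powr s + 2 * p"
  proof -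
    have "1/2 \<le> 1 + w" using vw(2) by linarith
    from powr_add_le_linear[OF s this ns(1)] show ?thesis using ns(5) by (simp add: w_def abs_le_iff)
  qed
  ultimately have "2 - (1 + v) powr s - (1 + w) powr s \<le> second_diff_ramp s r + 4 * p"
    by (simp add: second_diff_ramp_def)
  from mult_left_mono[OF this L0]
  have A: "L * (2 - (1 + v) powr s - (1 + w) powr s) \<le> L * second_diff_ramp s r + 4 * Y"
    using Lp by (simp add: algebra_simps)
  have B: "(1 + v) powr s * ln (1 + v) + (1 + w) powr s * ln (1 + w) \<le> 18 * Y"
    using one_plus_powr_ln_bounds(1)[OF s vw(1)] one_plus_powr_ln_bounds(1)[OF s vw(2)] vw(3,4) ns(1) by linarith
  have "2 * barrier s x - barrier s (x + y) - barrier s (x - y) \<le> t powr s * (L * second_diff_ramp s r + 22 * Y)"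
    unfolding eq using A B by (intro mult_left_mono) auto
  then show "2 * barrier s x - barrier s (x + y) - barrier s (x - y)
      \<le> t powr s * (- ln t) * second_diff_ramp s (2 * (x \<bullet> y) / t) + 22 * t powr (s - 2) * (norm y)\<^sup>2"
    using tY by (simp add: r_def L_def algebra_simps)
  have "(1 + v) powr s \<le> 1 + s * v" "(1 + w) powr s \<le> 1 + s * w"
    using s vw by (auto intro!: powr_Bernoulli simp: abs_le_iff)
  then have "s * (2 * p) \<le> 2 - (1 + v) powr s - (1 + w) powr s"
    using arg_cong[OF vw(4), of "\<lambda>z. s * z"] by (simp add: algebra_simps)
  then have "0 \<le> 2 - (1 + v) powr s - (1 + w) powr s"
    using s ns(1) by (meson order_trans mult_nonneg_nonneg less_imp_le zero_le_numeral)
  then have "0 \<le> L * (2 - (1 + v) powr s - (1 + w) powr s)" using L0 by simp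
  moreover have "- 38 * Y \<le> (1 + v) powr s * ln (1 + v) + (1 + w) powr s * ln (1 + w)"
    using one_plus_powr_ln_bounds(2)[OF s vw(1)] one_plus_powr_ln_bounds(2)[OF s vw(2)] vw(3,4) ns(2)
    unfolding Y_def[symmetric] by linarith
  ultimately have "t powr s * (- 38 * Y) \<le> 2 * barrier s x - barrier s (x + y) - barrier s (x - y)"
    unfolding eq by (intro mult_left_mono) auto
  then show "- (38 * t powr (s - 2) * (norm y)\<^sup>2) \<le> 2 * barrier s x - barrier s (x + y) - barrier s (x - y)"
    using tY by (simp add: algebra_simps)
qed

text \<open>For a step longer than \<open>t / 8\<close> the two positive parts, of the tangent plane and of \<open>1 - norm x ^ 2\<close>,
  differ by at most \<open>(norm y)\<^sup>2\<close>, so by subadditivity their powers differ by at most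
  \<open>norm y powr (2 * s)\<close>. The exponent \<open>3 * s / 2\<close> in the statement lies between that exponent, good for
  short steps, and the growth \<open>s\<close> for long ones; it leaves room on both sides, so that the kernel
  integrates the bound to \<open>t powr (-s/2)\<close> and a logarithm is absorbed by another \<open>t powr (-s/2)\<close>.\<close>

lemma barrier_lower_far:
  assumes "t / 8 < norm y"
  shows "t powr s * (- ln t) * (max 0 (1 + 2 * (x \<bullet> y) / t)) powr s - (206 / s) * t powr (- (s/2)) * norm y powr (3 * s / 2)
     \<le> barrier s (x - y)"
proof -
  define \<zeta> where "\<zeta> = max 0 (1 - (x - y) \<bullet> (x - y))"
  define l where "l = max 0 (t + 2 * (x \<bullet> y))"
  define L where "L = - ln t"
  define N where "N = norm y"
  note t = t_bounds
  have N: "N > 0" using assms t(1) unfolding N_def by linarith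
  have q: "1 - (x - y) \<bullet> (x - y) = t + 2 * (x \<bullet> y) - N\<^sup>2"
    by (simp add: N_def power2_norm_eq_inner t_def inner_diff_left inner_diff_right inner_commute[of y x])
  have "\<bar>x \<bullet> y\<bar> \<le> N"
    using Cauchy_Schwarz_ineq2[of x y] mult_right_mono[of "norm x" 1 "norm y"] x by (simp add: N_def)
  then have l_le: "l \<le> t + 2 * N" using t N by (simp add: l_def)
  have "max 0 (c - d) \<le> max 0 c" "max 0 c \<le> max 0 (c - d) + d" if "0 \<le> d" for c d :: real
    using that by auto
  from this[OF zero_le_power2] have z_le: "\<zeta> \<le> l" "0 \<le> \<zeta>" "l \<le> \<zeta> + N\<^sup>2"
    unfolding \<zeta>_def l_def q by auto
  have z10: "\<zeta> \<le> 10 * N" using l_le z_le assms by (simp add: N_def)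
  have L0: "0 \<le> L" and L1: "L \<le> (2 / s) * t powr (- (s/2))" using t by (simp_all add: L_def)
  \<comment> \<open>The error of the tangent plane.\<close>
  have D: "l powr s \<le> \<zeta> powr s + 3 * N powr (3 * s / 2)"
  proof (cases "N \<le> 1")
    case True
    have "l powr s \<le> (\<zeta> + N\<^sup>2) powr s" using s z_le by (intro powr_mono2) (auto simp: l_def)
    also have "\<dots> \<le> \<zeta> powr s + (N\<^sup>2) powr s" using s z_le by (intro powr_subadditive) auto
    also have "(N\<^sup>2) powr s = N powr (2 * s)" using N powr_powr[of N 2 s] by simp
    also have "\<dots> \<le> N powr (3 * s / 2)" using N True s by (intro powr_mono') auto
    finally show ?thesis using powr_ge_zero[of N "3 * s / 2"] by linarith
  next
    case False
    have "l powr s \<le> (3 * N) powr s" using l_le t False s by (intro powr_mono2) (auto simp: l_def)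
    also have "\<dots> = 3 powr s * N powr s" by (simp add: powr_mult)
    also have "\<dots> \<le> 3 * N powr (3 * s / 2)"
      using powr_mono[of s 1 "3::real"] s False N by (intro mult_mono powr_mono) auto
    finally show ?thesis using powr_ge_zero[of \<zeta> s] by linarith
  qed
  \<comment> \<open>The term without large factor is nonnegative as long as \<open>\<zeta> \<le> t\<close>.\<close>
  have k: "- (200 / s * t powr (- (s/2)) * N powr (3 * s / 2)) \<le> - (\<zeta> powr s * ln \<zeta>) - L * \<zeta> powr s"
  proof (cases "\<zeta> \<le> t")
    case True
    show ?thesis
    proof (cases "\<zeta> = 0")
      case False
      then have "ln \<zeta> \<le> ln t" using True z_le t by simp
      then have "\<zeta> powr s * (ln \<zeta> + L) \<le> 0" by (intro mult_nonneg_nonpos) (auto simp: L_def)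
      moreover have "0 \<le> 200 / s * t powr (- (s/2)) * N powr (3 * s / 2)" using s by simp
      ultimately show ?thesis by (simp add: algebra_simps)
    qed (use s in auto)
  next
    case False
    then have zt: "\<zeta> / t \<ge> 1" "\<zeta> > 0" using t by auto
    have "ln \<zeta> + L = ln (\<zeta> / t)" using zt t by (simp add: ln_div L_def)
    also have "\<dots> \<le> (\<zeta> / t) powr (s/2) / (s/2)" using zt s by (intro ln_powr_bound) auto
    finally have "\<zeta> powr s * (ln \<zeta> + L) \<le> \<zeta> powr s * ((\<zeta> / t) powr (s/2) / (s/2))" by (intro mult_left_mono) auto
    also have "\<dots> = (2 / s) * t powr (- (s/2)) * (\<zeta> powr s * \<zeta> powr (s/2))"
      using zt t by (simp add: powr_divide powr_minus_divide mult_ac)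
    also have "\<zeta> powr s * \<zeta> powr (s/2) = \<zeta> powr (3 * s / 2)" by (simp add: powr_add[symmetric])
    also have "(2 / s) * t powr (- (s/2)) * \<zeta> powr (3 * s / 2) \<le> (2 / s) * t powr (- (s/2)) * (100 * N powr (3 * s / 2))"
    proof (intro mult_left_mono)
      have "\<zeta> powr (3 * s / 2) \<le> (10 * N) powr (3 * s / 2)" using z10 z_le s by (intro powr_mono2) auto
      also have "\<dots> = 10 powr (3 * s / 2) * N powr (3 * s / 2)" by (simp add: powr_mult)
      also have "\<dots> \<le> 10 powr 2 * N powr (3 * s / 2)" using s by (intro mult_right_mono powr_mono) auto
      finally show "\<zeta> powr (3 * s / 2) \<le> 100 * N powr (3 * s / 2)" by simp
    qed (use s in auto)
    finally show ?thesis by (simp add: algebra_simps)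
  qed
  have "L * l powr s \<le> L * (\<zeta> powr s + 3 * N powr (3 * s / 2))" by (intro mult_left_mono D L0)
  also have "\<dots> = L * \<zeta> powr s + L * (3 * N powr (3 * s / 2))" by (simp add: algebra_simps)
  also have "L * (3 * N powr (3 * s / 2)) \<le> (2 / s) * t powr (- (s/2)) * (3 * N powr (3 * s / 2))"
    by (intro mult_right_mono L1) auto
  finally have E: "L * l powr s - 6 / s * t powr (- (s/2)) * N powr (3 * s / 2) \<le> L * \<zeta> powr s" by (simp add: mult_ac)
  have "l = t * max 0 (1 + 2 * (x \<bullet> y) / t)" using t by (simp add: l_def max_mult_distrib_left distrib_left)
  then have "l powr s = t powr s * (max 0 (1 + 2 * (x \<bullet> y) / t)) powr s" by (simp add: powr_mult)
  moreover have "barrier s (x - y) = - (\<zeta> powr s * ln \<zeta>)" by (simp add: barrier_def \<zeta>_def)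
  ultimately show ?thesis using E k s unfolding L_def[symmetric] N_def[symmetric]
    by (simp add: field_simps)
qed

lemma barrier_second_diff_far:
  assumes "t / 8 < norm y"
  shows "2 * barrier s x - barrier s (x + y) - barrier s (x - y)
      \<le> t powr s * (- ln t) * second_diff_ramp s (2 * (x \<bullet> y) / t) + (412 / s) * t powr (- (s/2)) * norm y powr (3 * s / 2)"
proof -
  define Q P where "Q = (206 / s) * t powr (- (s/2)) * norm y powr (3 * s / 2)" and "P = t powr s * (- ln t)"
  have "P * (max 0 (1 + 2 * (x \<bullet> y) / t)) powr s - Q \<le> barrier s (x - y)"
    using barrier_lower_far[OF assms] by (simp only: P_def Q_def)
  moreover have "P * (max 0 (1 - 2 * (x \<bullet> y) / t)) powr s - Q \<le> barrier s (x + y)"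
    using barrier_lower_far[of "- y"] assms by (simp add: P_def Q_def)
  moreover have "(412 / s) * t powr (- (s/2)) * norm y powr (3 * s / 2) = 2 * Q" by (simp add: Q_def)
  ultimately show ?thesis
    unfolding barrier_at second_diff_ramp_def P_def[symmetric] by (simp add: algebra_simps)
qed

end

section \<open>The barrier as a strict subsolution\<close>

lemma kernel_far:
  fixes \<beta> \<rho> :: real
  assumes "\<beta> > 0" "\<rho> > 0"
  shows "integrable lborel (\<lambda>y::real^2. indicator {y. \<rho> \<le> norm y} y * norm y powr (-2-\<beta>))"
    and "(LBINT y::real^2. indicator {y. \<rho> \<le> norm y} y * norm y powr (-2-\<beta>)) \<le> pi * (2 + \<beta>) / \<beta> * \<rho> powr (-\<beta>)"
proof -
  let ?f = "\<lambda>y::real^2. indicator {y. \<rho> \<le> norm y} y * norm y powr (-2-\<beta>)"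
  note le = nn_integral_kernel_far[OF assms]
  show i: "integrable lborel ?f"
  proof (rule integrableI_nonneg)
    show "(\<integral>\<^sup>+y. ennreal (?f y) \<partial>lborel) < \<infinity>"
      using le by (rule le_less_trans) simp
  qed auto
  have "ennreal (integral\<^sup>L lborel ?f) \<le> ennreal (pi * (2 + \<beta>) / \<beta> * \<rho> powr (-\<beta>))"
    using nn_integral_eq_integral[OF i] le by simp
  then show "integral\<^sup>L lborel ?f \<le> pi * (2 + \<beta>) / \<beta> * \<rho> powr (-\<beta>)"
    using assms by (subst (asm) ennreal_le_iff) auto
qed

lemma kernel_near:
  fixes \<sigma> \<rho> :: real
  assumes "0 < \<sigma>" "\<sigma> < 2" "\<rho> > 0"
  shows "integrable lborel (\<lambda>y::real^2. indicator {y. norm y \<le> \<rho>} y * norm y powr (-\<sigma>))"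
    and "(LBINT y::real^2. indicator {y. norm y \<le> \<rho>} y * norm y powr (-\<sigma>)) \<le> 2 * pi / (2 - \<sigma>) * \<rho> powr (2-\<sigma>)"
proof -
  let ?f = "\<lambda>y::real^2. indicator {y. norm y \<le> \<rho>} y * norm y powr (-\<sigma>)"
  note le = nn_integral_kernel_near[OF assms]
  show i: "integrable lborel ?f"
  proof (rule integrableI_nonneg)
    show "(\<integral>\<^sup>+y. ennreal (?f y) \<partial>lborel) < \<infinity>"
      using le by (rule le_less_trans) simp
  qed auto
  have "ennreal (integral\<^sup>L lborel ?f) \<le> ennreal (2 * pi / (2 - \<sigma>) * \<rho> powr (2-\<sigma>))"
    using nn_integral_eq_integral[OF i] le by simp
  then show "integral\<^sup>L lborel ?f \<le> 2 * pi / (2 - \<sigma>) * \<rho> powr (2-\<sigma>)"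
    using assms by (subst (asm) ennreal_le_iff) auto
qed

abbreviation frac_kernel :: "real \<Rightarrow> real^2 \<Rightarrow> real" where
  "frac_kernel s y \<equiv> norm y powr (-2-2 * s)"

abbreviation second_diff :: "(real^2 \<Rightarrow> real) \<Rightarrow> real^2 \<Rightarrow> real^2 \<Rightarrow> real" where
  "second_diff w x y \<equiv> 2 * w x - w (x + y) - w (x - y)"

lemma norm_square_times_kernel: "(norm y)\<^sup>2 * frac_kernel s y = norm y powr (- (2 * s))"
  using powr_square_mult[of "norm y" "-2-2 * s"] by (cases "y = 0") auto

text \<open>Second differences of bounded functions that are \<open>C\<^sup>2\<close> at the base point satisfy the two bounds.\<close>

lemma kernel_integrable:
  fixes h :: "real^2 \<Rightarrow> real"
  assumes s: "0 < s" "s < 1" and [measurable]: "h \<in> borel_measurable borel" and "\<rho> > 0"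
    and near: "\<And>y. norm y \<le> \<rho> \<Longrightarrow> \<bar>h y\<bar> \<le> A * (norm y)\<^sup>2"
    and far: "\<And>y. \<rho> < norm y \<Longrightarrow> \<bar>h y\<bar> \<le> B"
  shows "integrable lborel (\<lambda>y. h y * frac_kernel s y)"
proof (rule Bochner_Integration.integrable_bound)
  show "integrable lborel (\<lambda>y. \<bar>A\<bar> * (indicator {y. norm y \<le> \<rho>} y * norm y powr (- (2 * s))) +
      \<bar>B\<bar> * (indicator {y. \<rho> \<le> norm y} y * frac_kernel s y))"
    using kernel_far[of "2 * s" \<rho>] kernel_near[of "2 * s" \<rho>] s \<open>\<rho> > 0\<close>
    by (intro Bochner_Integration.integrable_add integrable_mult_right) auto
  show "AE y in lborel. norm (h y * frac_kernel s y) \<le> norm (\<bar>A\<bar> * (indicator {y. norm y \<le> \<rho>} y * norm y powr (- (2 * s))) +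
      \<bar>B\<bar> * (indicator {y. \<rho> \<le> norm y} y * frac_kernel s y))"
  proof (rule AE_I2)
    fix y :: "real^2"
    show "norm (h y * frac_kernel s y) \<le> norm (\<bar>A\<bar> * (indicator {y. norm y \<le> \<rho>} y * norm y powr (- (2 * s))) +
      \<bar>B\<bar> * (indicator {y. \<rho> \<le> norm y} y * frac_kernel s y))"
    proof (cases "norm y \<le> \<rho>")
      case True
      have "\<bar>h y\<bar> * frac_kernel s y \<le> \<bar>A\<bar> * (norm y)\<^sup>2 * frac_kernel s y"
        using near[OF True] by (intro mult_right_mono order_trans[OF near[OF True]]) auto
      also have "\<dots> = \<bar>A\<bar> * norm y powr (- (2 * s))" by (simp only: mult.assoc norm_square_times_kernel)
      finally have "\<bar>h y\<bar> * frac_kernel s y \<le> \<bar>A\<bar> * norm y powr (- (2 * s))" .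
      moreover have "0 \<le> \<bar>B\<bar> * (indicator {y. \<rho> \<le> norm y} y * frac_kernel s y)" by simp
      ultimately have "\<bar>h y\<bar> * frac_kernel s y \<le> \<bar>A\<bar> * norm y powr (- (2 * s))
          + \<bar>B\<bar> * (indicator {y. \<rho> \<le> norm y} y * frac_kernel s y)" by linarith
      then show ?thesis using True by (simp add: abs_mult)
    next
      case False
      then have "\<bar>h y\<bar> * frac_kernel s y \<le> \<bar>B\<bar> * frac_kernel s y"
        using far[of y] by (intro mult_right_mono) auto
      then show ?thesis using False by (simp add: abs_mult)
    qed
  qed
qed measurable

lemma barrier_measurable [measurable]: "barrier s \<in> borel_measurable borel"
  unfolding barrier_def[abs_def] by measurable

text \<open>The upper bound is \<open>ln y \<le> y powr s / s\<close> at \<open>y = 1/q\<close>.\<close>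

lemma barrier_bounds:
  assumes s: "0 < s"
  shows "0 \<le> barrier s z" "barrier s z \<le> 1 / s"
proof -
  define \<zeta> where "\<zeta> = max 0 (1 - z \<bullet> z)"
  have z: "0 \<le> \<zeta>" "\<zeta> \<le> 1" by (simp_all add: \<zeta>_def)
  have b: "barrier s z = - (\<zeta> powr s * ln \<zeta>)" by (simp add: barrier_def \<zeta>_def)
  show "0 \<le> barrier s z" unfolding b using z by (cases "\<zeta> = 0") (auto intro: mult_nonneg_nonpos)
  show "barrier s z \<le> 1 / s"
  proof (cases "\<zeta> = 0")
    case False
    then have "ln (1 / \<zeta>) \<le> (1 / \<zeta>) powr s / s" using z s by (intro ln_powr_bound) auto
    then have "\<zeta> powr s * (- ln \<zeta>) \<le> \<zeta> powr s * ((1 / \<zeta>) powr s / s)"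
      using False z by (intro mult_left_mono) (auto simp: ln_div)
    also have "\<dots> = 1 / s" using False z by (simp add: powr_divide)
    finally show ?thesis by (simp add: b)
  qed (use s b in simp)
qed

text \<open>The term with the tangent plane integrates to zero, however large its factor. The error bound
  \<open>M\<close> scales like \<open>t powr (-s)\<close> both for steps shorter and for steps longer than \<open>t / 8\<close>.\<close>

lemma barrier_second_diff_integral:
  assumes s: "0 < s" "s < 1"
  obtains C where "C > 0"
    "\<And>x. norm x < 1 \<Longrightarrow> integrable lborel (\<lambda>y. second_diff (barrier s) x y * frac_kernel s y)"
    "\<And>x. norm x < 1 \<Longrightarrow> (LBINT y. second_diff (barrier s) x y * frac_kernel s y) \<le> C * (1 - norm x) powr (- s)"
proof
  define C where "C = 22 * (pi / (1 - s)) + 412 / s * (15 * pi / s)"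
  show "C > 0" using s unfolding C_def by (intro add_pos_pos mult_pos_pos) auto
  fix x :: "real^2" assume x: "norm x < 1"
  define t where "t = 1 - x \<bullet> x"
  note t = t_bounds[OF s x t_def]
  define \<Delta> where "\<Delta> y = second_diff (barrier s) x y" for y
  define n where "n y = second_diff_ramp s ((2 / t) *\<^sub>R x \<bullet> y)" for y
  have n_eq: "second_diff_ramp s (2 * (x \<bullet> y) / t) = n y" for y by (simp add: n_def)
  have [measurable]: "\<Delta> \<in> borel_measurable borel" unfolding \<Delta>_def by measurable
  define M where "M y = 22 * t powr (s - 2) * (indicator {y. norm y \<le> t / 8} y * norm y powr (- (2 * s)))
     + 412 / s * t powr (- (s/2)) * (indicator {y. t / 8 \<le> norm y} y * norm y powr (-2 - s/2))" for y :: "real^2"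
  have near: "\<Delta> y \<le> t powr s * (- ln t) * n y + 22 * t powr (s - 2) * (norm y)\<^sup>2"
     "- (38 * t powr (s - 2) * (norm y)\<^sup>2) \<le> \<Delta> y" if "norm y \<le> t / 8" for y
    using barrier_second_diff_near[OF s x t_def that] unfolding \<Delta>_def n_eq by auto
  have far: "\<Delta> y \<le> t powr s * (- ln t) * n y + 412 / s * t powr (- (s/2)) * norm y powr (3 * s / 2)"
    if "t / 8 < norm y" for y
    using barrier_second_diff_far[OF s x t_def that] unfolding \<Delta>_def n_eq by auto
  show int: "integrable lborel (\<lambda>y. second_diff (barrier s) x y * frac_kernel s y)"
    unfolding \<Delta>_def[symmetric]
  proof (rule kernel_integrable[OF s])
    show "0 < t / 8" using t by simp
    show "\<bar>\<Delta> y\<bar> \<le> (t powr s * (- ln t) * (8 / t\<^sup>2) + 60 * t powr (s - 2)) * (norm y)\<^sup>2" if y: "norm y \<le> t / 8" for y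
    proof -
      note ns = near_setup[OF s x t_def y]
      have "n y \<le> 2 * (2 * (x \<bullet> y) / t)\<^sup>2"
        unfolding n_eq[symmetric] using ns(5) by (intro ramp_bounds[OF s]) auto
      also have "\<dots> \<le> 2 * (4 * (norm y)\<^sup>2 / t\<^sup>2)" using ns(9) by simp
      finally have "t powr s * (- ln t) * n y \<le> t powr s * (- ln t) * (8 / t\<^sup>2 * (norm y)\<^sup>2)"
        using t by (intro mult_left_mono mult_nonneg_nonneg) auto
      moreover have "0 \<le> t powr s * (- ln t) * (8 / t\<^sup>2 * (norm y)\<^sup>2)" using t by (intro mult_nonneg_nonneg) auto
      moreover have "0 \<le> t powr (s - 2) * (norm y)\<^sup>2" by simp
      moreover have "(t powr s * (- ln t) * (8 / t\<^sup>2) + 60 * t powr (s - 2)) * (norm y)\<^sup>2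
          = t powr s * (- ln t) * (8 / t\<^sup>2 * (norm y)\<^sup>2) + 60 * (t powr (s - 2) * (norm y)\<^sup>2)"
        by (simp only: distrib_right mult.assoc)
      ultimately show ?thesis using near[OF y] by (simp only: mult.assoc abs_le_iff) linarith
    qed
    show "\<bar>\<Delta> y\<bar> \<le> 2 / s" for y
      using barrier_bounds[OF s(1), of x] barrier_bounds[OF s(1), of "x + y"] barrier_bounds[OF s(1), of "x - y"]
      unfolding \<Delta>_def by (simp add: abs_le_iff)
  qed measurable
  have le: "\<Delta> y * frac_kernel s y \<le> t powr s * (- ln t) * (n y * frac_kernel s y) + M y" for y
  proof (cases "norm y \<le> t / 8")
    case True
    have "\<Delta> y * frac_kernel s y \<le> (t powr s * (- ln t) * n y + 22 * t powr (s - 2) * (norm y)\<^sup>2) * frac_kernel s y"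
      by (intro mult_right_mono near True) auto
    also have "\<dots> = t powr s * (- ln t) * (n y * frac_kernel s y) + 22 * t powr (s - 2) * ((norm y)\<^sup>2 * frac_kernel s y)"
      by (simp add: algebra_simps)
    also have "22 * t powr (s - 2) * ((norm y)\<^sup>2 * frac_kernel s y) \<le> M y"
      unfolding norm_square_times_kernel M_def using True s by simp
    finally show ?thesis by simp
  next
    case False
    then have y: "t / 8 < norm y" by simp
    have "\<Delta> y * frac_kernel s y \<le> (t powr s * (- ln t) * n y + 412 / s * t powr (- (s/2)) * norm y powr (3 * s / 2)) * frac_kernel s y"
      by (intro mult_right_mono far y) auto
    also have "\<dots> = t powr s * (- ln t) * (n y * frac_kernel s y) + 412 / s * t powr (- (s/2)) * (norm y powr (3 * s / 2) * frac_kernel s y)"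
      by (simp add: algebra_simps)
    also have "norm y powr (3 * s / 2) * frac_kernel s y = norm y powr (-2 - s/2)"
      unfolding powr_add[symmetric] by (rule arg_cong[where f="\<lambda>a. norm y powr a"]) (simp add: field_simps)
    finally show ?thesis using y unfolding M_def by simp
  qed
  have ramp: "has_bochner_integral lborel (\<lambda>y. n y * frac_kernel s y) 0"
    unfolding n_def by (rule second_diff_ramp_2D[OF s])
  have k1: "integrable lborel (\<lambda>y::real^2. indicator {y. norm y \<le> t / 8} y * norm y powr (- (2 * s)))"
     "(LBINT y::real^2. indicator {y. norm y \<le> t / 8} y * norm y powr (- (2 * s))) \<le> 2 * pi / (2 - 2 * s) * (t / 8) powr (2 - 2 * s)"
    using kernel_near[of "2 * s" "t / 8"] s t by auto
  have k2: "integrable lborel (\<lambda>y::real^2. indicator {y. t / 8 \<le> norm y} y * norm y powr (-2 - s/2))"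
     "(LBINT y::real^2. indicator {y. t / 8 \<le> norm y} y * norm y powr (-2 - s/2)) \<le> pi * (2 + s/2) / (s/2) * (t / 8) powr (- (s/2))"
    using kernel_far[of "s/2" "t / 8"] s t by auto
  have intM: "integrable lborel M"
    unfolding M_def using k1 k2 by (intro Bochner_Integration.integrable_add integrable_mult_right)
  have "integral\<^sup>L lborel M = 22 * t powr (s - 2) * (LBINT y::real^2. indicator {y. norm y \<le> t / 8} y * norm y powr (- (2 * s)))
     + 412 / s * t powr (- (s/2)) * (LBINT y::real^2. indicator {y. t / 8 \<le> norm y} y * norm y powr (-2 - s/2))"
    unfolding M_def using k1(1) k2(1) by (subst Bochner_Integration.integral_add) auto
  also have "\<dots> \<le> 22 * t powr (s - 2) * ((pi / (1 - s)) * t powr (2 - 2 * s)) + 412 / s * t powr (- (s/2)) * ((15 * pi / s) * t powr (- (s/2)))"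
  proof (intro add_mono mult_left_mono)
    have "2 * pi / (2 - 2 * s) * (t / 8) powr (2 - 2 * s) \<le> pi / (1 - s) * t powr (2 - 2 * s)"
    proof (intro mult_mono powr_mono2)
      show "2 * pi / (2 - 2 * s) \<le> pi / (1 - s)" using s by (simp add: field_simps)
    qed (use s t in auto)
    then show "(LBINT y::real^2. indicator {y. norm y \<le> t / 8} y * norm y powr (- (2 * s))) \<le> (pi / (1 - s)) * t powr (2 - 2 * s)"
      using k1(2) by linarith
    have "pi * (2 + s/2) / (s/2) * (t / 8) powr (- (s/2)) \<le> (5 * pi / s) * (3 * t powr (- (s/2)))"
    proof (intro mult_mono)
      have "pi * (2 + s/2) \<le> pi * (5/2)" using s by (intro mult_left_mono) auto
      then show "pi * (2 + s/2) / (s/2) \<le> 5 * pi / s" using s by (simp add: field_simps)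
      have "8 powr (s/2) \<le> 8 powr (1/2)" using s by (intro powr_mono) auto
      also have "\<dots> \<le> (9::real) powr (1/2)" by (intro powr_mono2) auto
      also have "\<dots> = 3" by (simp add: powr_half_sqrt real_sqrt_unique[of 3])
      finally have "8 powr (s/2) \<le> (3::real)" .
      then have "t powr (- (s/2)) * 8 powr (s/2) \<le> t powr (- (s/2)) * 3" by (intro mult_left_mono) auto
      then show "(t / 8) powr (- (s/2)) \<le> 3 * t powr (- (s/2))"
        using t by (simp add: powr_divide powr_minus_divide mult.commute)
    qed (use s in auto)
    then show "(LBINT y::real^2. indicator {y. t / 8 \<le> norm y} y * norm y powr (-2 - s/2)) \<le> (15 * pi / s) * t powr (- (s/2))"
      using k2(2) by simp
  qed (use s in auto)
  also have "\<dots> = 22 * (pi / (1 - s)) * (t powr (s - 2) * t powr (2 - 2 * s)) + 412 / s * (15 * pi / s) * (t powr (- (s/2)) * t powr (- (s/2)))"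
    by (simp add: algebra_simps)
  also have "t powr (s - 2) * t powr (2 - 2 * s) = t powr (- s)" unfolding powr_add[symmetric] by simp
  also have "t powr (- (s/2)) * t powr (- (s/2)) = t powr (- s)" unfolding powr_add[symmetric] by simp
  finally have M_le: "integral\<^sup>L lborel M \<le> C * t powr (- s)" by (simp add: C_def algebra_simps)
  have "(LBINT y. \<Delta> y * frac_kernel s y) \<le> (LBINT y. t powr s * (- ln t) * (n y * frac_kernel s y) + M y)"
    using int ramp intM le unfolding \<Delta>_def[symmetric]
    by (intro integral_mono Bochner_Integration.integrable_add integrable_mult_right)
       (auto simp: has_bochner_integral_iff)
  also have "\<dots> = t powr s * (- ln t) * (LBINT y. n y * frac_kernel s y) + integral\<^sup>L lborel M"
    using ramp intM by (subst Bochner_Integration.integral_add) (auto simp: has_bochner_integral_iff)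
  also have "\<dots> \<le> C * t powr (- s)" using ramp M_le by (simp add: has_bochner_integral_iff)
  also have "\<dots> \<le> C * (1 - norm x) powr (- s)"
  proof (intro mult_left_mono powr_mono2')
    have "x \<bullet> x \<le> norm x * 1" unfolding power2_norm_eq_inner[symmetric] power2_eq_square
      using x by (intro mult_left_mono) auto
    then show "1 - norm x \<le> t" by (simp add: t_def)
  qed (use x s \<open>C > 0\<close> in auto)
  finally show "(LBINT y. second_diff (barrier s) x y * frac_kernel s y) \<le> C * (1 - norm x) powr (- s)"
    by (simp only: \<Delta>_def)
qed

text \<open>Inside the closed disc this is 0, so that data and barrier, with disjoint supports, can simply be
  added. Truncation at distance 1 makes it bounded.\<close>

definition ext_data :: "real \<Rightarrow> real \<Rightarrow> real^2 \<Rightarrow> real" where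
  "ext_data s A z = A * (max 0 (min 1 (norm z - 1))) powr s"

lemma ext_data_measurable [measurable]: "ext_data s A \<in> borel_measurable borel"
  unfolding ext_data_def[abs_def] by measurable

lemma ext_data_bounds:
  assumes "0 \<le> A" "0 < s"
  shows "0 \<le> ext_data s A z" "ext_data s A z \<le> A"
proof -
  have "(max 0 (min 1 (norm z - 1))) powr s \<le> 1 powr s" using assms by (intro powr_mono2) auto
  then show "ext_data s A z \<le> A" unfolding ext_data_def using mult_left_mono[of _ 1 A] assms by simp
qed (use assms in \<open>simp add: ext_data_def\<close>)

lemma ext_data_inside: "norm z \<le> 1 \<Longrightarrow> ext_data s A z = 0"
  by (simp add: ext_data_def)

text \<open>With \<open>\<tau> = 1 - norm x\<close>, the disc of radius \<open>\<tau>\<close> around the point at distance \<open>3 * \<tau>\<close> from \<open>x\<close> in outward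
  direction lies outside the unit disc; on it the data are at least \<open>A * \<tau> powr s\<close>, and its points are
  at distance at most \<open>4 * \<tau>\<close> from \<open>x\<close>.\<close>

lemma ext_data_integral:
  fixes x :: "real^2"
  assumes s: "0 < s" "s < 1" and A: "0 \<le> A" and x: "norm x < 1"
  shows "integrable lborel (\<lambda>y. ext_data s A (x + y) * frac_kernel s y)"
    and "A * (pi * 4 powr (-2-2 * s)) * (1 - norm x) powr (- s) \<le> (LBINT y. ext_data s A (x + y) * frac_kernel s y)"
proof -
  define \<tau> where "\<tau> = 1 - norm x"
  have \<tau>: "0 < \<tau>" "\<tau> \<le> 1" using x by (auto simp: \<tau>_def)
  show int: "integrable lborel (\<lambda>y. ext_data s A (x + y) * frac_kernel s y)"
  proof (rule kernel_integrable[OF s _ \<tau>(1)])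
    show "\<bar>ext_data s A (x + y)\<bar> \<le> 0 * (norm y)\<^sup>2" if "norm y \<le> \<tau>" for y
      using that norm_triangle_ineq[of x y] by (simp add: ext_data_inside \<tau>_def)
    show "\<bar>ext_data s A (x + y)\<bar> \<le> A" for y
      using ext_data_bounds[OF A s(1), of "x + y"] by simp
  qed measurable
  \<comment> \<open>The outward direction, arbitrary if \<open>x = 0\<close>.\<close>
  obtain e :: "real^2" where e: "norm e = 1" "x = norm x *\<^sub>R e"
  proof (cases "x = 0")
    case True
    then show ?thesis using that[of "axis 1 1"] by (simp add: norm_axis_1)
  next
    case False
    then show ?thesis using that[of "x /\<^sub>R norm x"] by simp
  qed
  define c where "c = (3 * \<tau>) *\<^sub>R e"
  have ball: "\<tau> \<le> norm (x + y) - 1" "norm y \<le> 4 * \<tau>" "y \<noteq> 0" if "y \<in> ball c \<tau>" for y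
  proof -
    have yc: "norm (y - c) < \<tau>" using that by (simp add: dist_norm norm_minus_commute)
    have nc: "norm c = 3 * \<tau>" using e(1) \<tau> by (simp add: c_def)
    show "norm y \<le> 4 * \<tau>" using norm_triangle_ineq[of "y - c" c] yc nc by simp
    show "y \<noteq> 0" using yc nc \<tau> by auto
    have "x + c = (norm x + 3 * \<tau>) *\<^sub>R e" using e(2) by (simp add: c_def scaleR_add_left)
    then have "norm (x + c) = norm x + 3 * \<tau>" using e(1) \<tau> by simp
    then show "\<tau> \<le> norm (x + y) - 1"
      using norm_triangle_ineq2[of "x + c" "c - y"] yc by (simp add: \<tau>_def norm_minus_commute)
  qed
  have "A * (pi * 4 powr (-2-2 * s)) * \<tau> powr (- s) = (A * \<tau> powr s * (4 * \<tau>) powr (-2-2 * s)) * (pi * \<tau>\<^sup>2)"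
  proof -
    have "\<tau> powr s * \<tau> powr (-2-2 * s) * \<tau>\<^sup>2 = \<tau> powr s * (\<tau>\<^sup>2 * \<tau> powr (-2-2 * s))" by simp
    also have "\<dots> = \<tau> powr s * \<tau> powr (- (2 * s))" using powr_square_mult[OF \<tau>(1), of "-2-2 * s"] by simp
    also have "\<dots> = \<tau> powr (- s)" unfolding powr_add[symmetric] by simp
    finally show ?thesis by (simp add: powr_mult algebra_simps)
  qed
  also have "\<dots> = (LBINT y. (A * \<tau> powr s * (4 * \<tau>) powr (-2-2 * s)) * indicator (ball c \<tau>) y)"
    using emeasure_ball_R2[of \<tau> c] \<tau> by (simp add: measure_def)
  also have "\<dots> \<le> (LBINT y. ext_data s A (x + y) * frac_kernel s y)"
  proof (rule integral_mono)
    show "integrable lborel (\<lambda>y. (A * \<tau> powr s * (4 * \<tau>) powr (-2-2 * s)) * indicator (ball c \<tau>) y)"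
      using emeasure_lborel_ball_finite[of c \<tau>] by (intro integrable_mult_right) auto
    fix y :: "real^2"
    show "A * \<tau> powr s * (4 * \<tau>) powr (-2-2 * s) * indicator (ball c \<tau>) y \<le> ext_data s A (x + y) * frac_kernel s y"
    proof (cases "y \<in> ball c \<tau>")
      case True
      note b = ball[OF True]
      have "A * \<tau> powr s * (4 * \<tau>) powr (-2-2 * s) \<le> ext_data s A (x + y) * frac_kernel s y"
      proof (intro mult_mono)
        show "A * \<tau> powr s \<le> ext_data s A (x + y)"
          unfolding ext_data_def using b \<tau> s A by (intro mult_left_mono powr_mono2) auto
        show "(4 * \<tau>) powr (-2-2 * s) \<le> frac_kernel s y" using b s by (intro powr_mono2') auto
      qed (use A in \<open>auto simp: ext_data_bounds s\<close>)
      then show ?thesis using True by simp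
    qed (use ext_data_bounds[OF A s(1)] in simp)
  qed (rule int)
  finally show "A * (pi * 4 powr (-2-2 * s)) * (1 - norm x) powr (- s) \<le> (LBINT y. ext_data s A (x + y) * frac_kernel s y)"
    by (simp add: \<tau>_def)
qed

text \<open>Up to a positive factor the integral is the fractional Laplacian of \<open>\<phi>\<close> at \<open>x\<close>. Integrability is
  part of the definition because the Bochner integral of a non-integrable function is 0.\<close>

definition strictly_subharmonic :: "real \<Rightarrow> (real^2 \<Rightarrow> real) \<Rightarrow> bool" where
  "strictly_subharmonic s \<phi> \<longleftrightarrow> (\<forall>x. norm x < 1 \<longrightarrow>
     integrable lborel (\<lambda>y. second_diff \<phi> x y * frac_kernel s y) \<and>
     (LBINT y. second_diff \<phi> x y * frac_kernel s y) < 0)"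

text \<open>The constant \<open>A\<close> is chosen such that the data outweigh the bound for the barrier twice.\<close>

lemma strict_subsolution:
  assumes s: "0 < s" "s < 1"
  obtains A where "A > 0" "strictly_subharmonic s (\<lambda>z. barrier s z + ext_data s A z)"
proof -
  obtain C where C: "C > 0"
    "\<And>x. norm x < 1 \<Longrightarrow> integrable lborel (\<lambda>y. second_diff (barrier s) x y * frac_kernel s y)"
    "\<And>x. norm x < 1 \<Longrightarrow> (LBINT y. second_diff (barrier s) x y * frac_kernel s y) \<le> C * (1 - norm x) powr (- s)"
    using barrier_second_diff_integral[OF s] by blast
  define A where "A = (2 * C) / (pi * 4 powr (-2-2 * s))"
  show thesis
  proof (rule that[of A])
    show A: "A > 0" using C(1) by (simp add: A_def)
    define \<phi> where \<phi>: "\<phi> = (\<lambda>z. barrier s z + ext_data s A z)"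
    have A0: "0 \<le> A" using A by simp
    have "integrable lborel (\<lambda>y. second_diff \<phi> x y * frac_kernel s y) \<and>
      (LBINT y. second_diff \<phi> x y * frac_kernel s y) < 0" if x: "norm x < 1" for x
    proof -
      note e = ext_data_integral[OF s A0 x]
      have e': "integrable lborel (\<lambda>y. ext_data s A (x - y) * frac_kernel s y)"
      proof (rule kernel_integrable[OF s, of _ "1 - norm x" 0 A])
        show "\<bar>ext_data s A (x - y)\<bar> \<le> 0 * (norm y)\<^sup>2" if "norm y \<le> 1 - norm x" for y
          using that norm_triangle_ineq4[of x y] by (simp add: ext_data_inside)
        show "\<bar>ext_data s A (x - y)\<bar> \<le> A" for y
          using ext_data_bounds[OF A0 s(1), of "x - y"] by simp
      qed (use x in auto)
      have eq: "second_diff \<phi> x y * frac_kernel s y =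
        second_diff (barrier s) x y * frac_kernel s y - ext_data s A (x + y) * frac_kernel s y
          - ext_data s A (x - y) * frac_kernel s y" for y
        using x by (simp add: \<phi> ext_data_inside algebra_simps)
      have "(LBINT y. second_diff \<phi> x y * frac_kernel s y) =
        (LBINT y. second_diff (barrier s) x y * frac_kernel s y)
         - (LBINT y. ext_data s A (x + y) * frac_kernel s y) - (LBINT y. ext_data s A (x - y) * frac_kernel s y)"
        unfolding eq using C(2)[OF x] e(1) e' by (simp add: Bochner_Integration.integral_diff)
      also have "\<dots> \<le> C * (1 - norm x) powr (- s) - 2 * C * (1 - norm x) powr (- s) - 0"
      proof (intro diff_mono C(3) x)
        show "2 * C * (1 - norm x) powr (- s) \<le> (LBINT y. ext_data s A (x + y) * frac_kernel s y)"
          using e(2) by (simp add: A_def)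
        show "0 \<le> (LBINT y. ext_data s A (x - y) * frac_kernel s y)"
          by (intro Bochner_Integration.integral_nonneg) (simp add: ext_data_bounds[OF A0 s(1)])
      qed
      also have "\<dots> < 0" using C(1) x by simp
      finally show ?thesis
        unfolding eq using C(2)[OF x] e(1) e' by (auto intro!: Bochner_Integration.integrable_diff)
    qed
    then show "strictly_subharmonic s (\<lambda>z. barrier s z + ext_data s A z)"
      unfolding strictly_subharmonic_def \<phi> by blast
  qed
qed

section \<open>Viscosity solutions lie above the barrier\<close>

lemma continuous_on_powr_mult_ln:
  fixes s :: real
  assumes "0 < s"
  shows "continuous_on {0..} (\<lambda>\<zeta>. \<zeta> powr s * ln \<zeta>)"
  unfolding continuous_on_eq_continuous_within
proof
  fix \<zeta> :: real assume "\<zeta> \<in> {0..}"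
  then consider "\<zeta> = 0" | "\<zeta> > 0" by fastforce
  then show "continuous (at \<zeta> within {0..}) (\<lambda>\<zeta>. \<zeta> powr s * ln \<zeta>)"
  proof cases
    case 1
    have "((\<lambda>\<zeta>. \<zeta> powr s * ln \<zeta>) \<longlongrightarrow> 0) (at 0 within {0..})"
    proof (rule Lim_null_comparison)
      show "\<forall>\<^sub>F \<zeta> in at 0 within {0..}. norm (\<zeta> powr s * ln \<zeta>) \<le> (2 / s) * \<zeta> powr (s/2)"
        unfolding eventually_at
      proof (intro exI[of _ 1] conjI ballI impI)
        fix \<zeta> :: real assume "\<zeta> \<in> {0..}" "\<zeta> \<noteq> 0 \<and> dist \<zeta> 0 < 1"
        then have z: "0 < \<zeta>" "\<zeta> < 1" by auto
        have "ln (1 / \<zeta>) \<le> (1 / \<zeta>) powr (s/2) / (s/2)" using z assms by (intro ln_powr_bound) auto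
        then have "\<zeta> powr s * \<bar>ln \<zeta>\<bar> \<le> \<zeta> powr s * ((1 / \<zeta>) powr (s/2) / (s/2))"
          using z by (intro mult_left_mono) (auto simp: ln_div)
        also have "\<dots> = (2 / s) * (\<zeta> powr s * \<zeta> powr (- (s/2)))"
          using z by (simp add: powr_divide powr_minus_divide mult_ac)
        also have "\<zeta> powr s * \<zeta> powr (- (s/2)) = \<zeta> powr (s/2)" unfolding powr_add[symmetric] by simp
        finally show "norm (\<zeta> powr s * ln \<zeta>) \<le> (2 / s) * \<zeta> powr (s/2)" by (simp add: abs_mult)
      qed simp
      have "((\<lambda>\<zeta>. (2 / s) * \<zeta> powr (s/2)) \<longlongrightarrow> (2 / s) * 0 powr (s/2)) (at 0 within {0..})"
        using assms by (intro tendsto_mult tendsto_const tendsto_powr' tendsto_ident_at)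
          (auto simp: eventually_at intro!: exI[of _ 1])
      then show "((\<lambda>\<zeta>. (2 / s) * \<zeta> powr (s/2)) \<longlongrightarrow> 0) (at 0 within {0..})" by simp
    qed
    then show ?thesis using 1 by (simp add: continuous_within)
  next
    case 2
    then have "isCont (\<lambda>\<zeta>. \<zeta> powr s * ln \<zeta>) \<zeta>" by (intro continuous_intros) auto
    then show ?thesis by (rule continuous_at_imp_continuous_at_within)
  qed
qed

lemma continuous_on_barrier: "0 < s \<Longrightarrow> continuous_on UNIV (barrier s)"
  unfolding barrier_def
  by (intro continuous_on_minus continuous_on_compose2[OF continuous_on_powr_mult_ln] continuous_intros) auto

lemma continuous_on_ext_data: "0 < s \<Longrightarrow> continuous_on UNIV (ext_data s A)"
  unfolding ext_data_def by (intro continuous_on_mult continuous_on_const continuous_on_powr' continuous_intros) auto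

lemma barrier_outside: "1 \<le> norm z \<Longrightarrow> barrier s z = 0"
proof -
  assume "1 \<le> norm z"
  then have "1 \<le> z \<bullet> z" unfolding power2_norm_eq_inner[symmetric] by (simp add: one_le_power)
  then show ?thesis by (simp add: barrier_def)
qed

lemma barrier_inside: "norm z < 1 \<Longrightarrow> barrier s z = 0 + (-1) * ((1 - z \<bullet> z) powr s * ln (1 - z \<bullet> z))"
proof -
  assume "norm z < 1"
  then have "z \<bullet> z < 1" unfolding norm_eq_sqrt_inner by simp
  then show ?thesis by (simp add: barrier_def)
qed

lemma frac_const_pos:
  assumes "0 < s" "s < 1" shows "0 < frac_const s"
proof -
  have "- s \<notin> \<int>"
  proof
    assume "- s \<in> \<int>"
    then obtain n where n: "- s = of_int n" by (auto simp: Ints_def)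
    then have "real_of_int n < 0" "-1 < real_of_int n" using assms by linarith+
    then have "n < 0" "-1 < n" by linarith+
    then show False by simp
  qed
  then have "Gamma (- s) \<noteq> 0" by (auto simp: Gamma_eq_zero_iff dest: nonpos_Ints_Int)
  then show ?thesis using assms by (simp add: frac_const_def Gamma_real_pos)
qed

lemma frac_laplacian_eq_kernel:
  assumes [measurable]: "w \<in> borel_measurable borel"
  shows "frac_laplacian s w x = frac_const s / 2 * (LBINT y. second_diff w x y * frac_kernel s y)"
proof -
  have eq: "(w x - (w (x + y) + w (x - y)) / 2) / norm y powr (2 + 2 * s) = (1/2) * (second_diff w x y * frac_kernel s y)" for y
  proof -
    have "-2-2 * s = - (2 + 2 * s)" by simp
    then have "frac_kernel s y = inverse (norm y powr (2 + 2 * s))" by (simp only: powr_minus)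
    moreover have "(W - (a + b) / 2) * i = (1/2) * ((2 * W - a - b) * i)" for W a b i :: real
      by (simp add: algebra_simps)
    ultimately show ?thesis by (simp only: divide_inverse[of _ "norm y powr (2 + 2 * s)"])
  qed
  have "(LINT y|lebesgue. (w x - (w (x + y) + w (x - y)) / 2) / norm y powr (2 + 2 * s))
    = (LBINT y. (1/2) * (second_diff w x y * frac_kernel s y))"
    unfolding eq by (rule integral_completion) measurable
  then show ?thesis by (simp add: frac_laplacian_def)
qed

lemma solution_continuous:
  fixes u g :: "real^2 \<Rightarrow> real"
  assumes "continuous_on (cball 0 1) u" "continuous_on UNIV g" "\<And>x. 1 \<le> norm x \<Longrightarrow> u x = g x"
  shows "continuous_on UNIV u"
proof -
  have "continuous_on (- ball 0 1) u"
    using assms(3) continuous_on_subset[OF assms(2)] by (subst continuous_on_cong[OF refl, of _ u g]) auto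
  then have "continuous_on (cball 0 1 \<union> - ball 0 1) u"
    using assms(1) by (intro continuous_on_closed_Un) (auto simp: closed_Compl)
  moreover have "cball 0 1 \<union> - ball 0 1 = (UNIV :: (real^2) set)" by auto
  ultimately show ?thesis by simp
qed

lemma viscosity_solution_test_below:
  assumes "viscosity_solution s \<Omega> g u" "x0 \<in> \<Omega>" "0 < r" "ball x0 r \<subseteq> \<Omega>" "Ck_closure 2 (ball x0 r) \<phi>"
    "\<phi> x0 = u x0" "\<forall>x\<in>ball x0 r. \<phi> x \<le> u x"
  shows "0 \<le> frac_laplacian s (\<lambda>x. if x \<in> ball x0 r then \<phi> x else u x) x0"
  using assms(1)[unfolded viscosity_solution_def, THEN conjunct2, THEN conjunct2, THEN conjunct2,
      rule_format, OF assms(2,3)] assms(4-) by blast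

text \<open>Let \<open>x0\<close> be a minimum point of \<open>u - \<phi>\<close> on the closed disc, with negative value \<open>d\<close>. It is an interior
  point since \<open>u = \<phi>\<close> outside. Then \<open>\<phi> + d\<close> touches \<open>u\<close> from below at \<open>x0\<close> and is globally below \<open>u\<close>, so
  the function \<open>w\<close> of the definition of viscosity solutions has smaller second differences at \<open>x0\<close> than
  \<open>\<phi>\<close>; but those of \<open>\<phi>\<close> have negative integral.\<close>

lemma viscosity_solution_above_barrier:
  assumes s: "0 < s" "s < 1" and A: "0 < A"
    and sub: "strictly_subharmonic s (\<lambda>z. barrier s z + ext_data s A z)"
    and u: "viscosity_solution s (ball 0 1) (ext_data s A) u"
    and x1: "norm x1 < 1"
  shows "barrier s x1 \<le> u x1"
proof (rule ccontr)
  assume "\<not> barrier s x1 \<le> u x1"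
  then have neg: "u x1 < barrier s x1" by simp
  define \<phi> where "\<phi> = (\<lambda>z. barrier s z + ext_data s A z)"
  have u_out: "u x = ext_data s A x" if "1 \<le> norm x" for x
    using u that by (auto simp: viscosity_solution_def)
  have u_cont: "continuous_on (cball 0 1) u" using u by (simp add: viscosity_solution_def)
  have contu: "continuous_on UNIV u"
    by (rule solution_continuous[OF u_cont continuous_on_ext_data[OF s(1)] u_out])
  have [measurable]: "u \<in> borel_measurable borel" by (rule borel_measurable_continuous_onI[OF contu])
  have cont\<phi>: "continuous_on UNIV \<phi>"
    unfolding \<phi>_def using s by (intro continuous_on_add continuous_on_barrier continuous_on_ext_data)
  have "continuous_on (cball 0 1) (\<lambda>x. u x - \<phi> x)"
    using contu cont\<phi> by (intro continuous_on_diff) (auto intro: continuous_on_subset)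
  then obtain x0 where x0: "x0 \<in> cball 0 1" "\<And>x. x \<in> cball 0 1 \<Longrightarrow> u x0 - \<phi> x0 \<le> u x - \<phi> x"
    using continuous_attains_inf[of "cball (0::real^2) 1" "\<lambda>x. u x - \<phi> x"] by auto
  define d where "d = u x0 - \<phi> x0"
  have d: "d < 0"
    using x0(2)[of x1] x1 neg by (simp add: d_def \<phi>_def ext_data_inside)
  have above: "\<phi> x + d \<le> u x" for x
  proof (cases "norm x \<le> 1")
    case True
    then show ?thesis using x0(2)[of x] by (simp add: d_def)
  next
    case False
    then show ?thesis using d by (simp add: \<phi>_def u_out barrier_outside)
  qed
  have x0_in: "norm x0 < 1"
  proof (rule ccontr)
    assume "\<not> norm x0 < 1"
    then show False using d by (simp add: d_def \<phi>_def u_out barrier_outside)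
  qed
  \<comment> \<open>Half the distance to the circle, so that the closed ball is still inside the disc.\<close>
  define r where "r = (1 - norm x0) / 2"
  have r: "r > 0" using x0_in by (simp add: r_def)
  have cball_sub: "norm x < 1" if "dist x0 x \<le> r" for x
    using that norm_triangle_ineq[of x0 "x - x0"] x0_in by (simp add: r_def dist_norm norm_minus_commute)
  define \<psi> where "\<psi> z = d + (-1) * ((1 - z \<bullet> z) powr s * ln (1 - z \<bullet> z))" for z :: "real^2"
  have \<psi>_eq: "\<psi> x = \<phi> x + d" if "norm x < 1" for x
    using that by (simp add: \<psi>_def \<phi>_def barrier_inside ext_data_inside)
  define w where "w x = (if x \<in> ball x0 r then \<psi> x else u x)" for x
  have "smooth_on (ball (0::real^2) 1) \<psi>"
    unfolding \<psi>_def by (rule smooth_on_powr_ln_radial)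
  then have "Ck_closure 2 (ball x0 r) \<psi>"
    by (intro Ck_on_imp_Ck_closure[of 2 "ball 0 1"]) (use cball_sub r in \<open>auto simp: smooth_on_def\<close>)
  moreover have "ball x0 r \<subseteq> ball 0 1" using cball_sub by auto
  moreover have "\<psi> x0 = u x0" using \<psi>_eq[OF x0_in] by (simp add: d_def)
  moreover have "\<forall>x\<in>ball x0 r. \<psi> x \<le> u x" using \<psi>_eq cball_sub above by auto
  ultimately have "0 \<le> frac_laplacian s (\<lambda>x. if x \<in> ball x0 r then \<psi> x else u x) x0"
    using r x0_in by (intro viscosity_solution_test_below[OF u]) auto
  then have "0 \<le> frac_laplacian s w x0" by (simp add: w_def[abs_def])
  moreover have w_meas [measurable]: "w \<in> borel_measurable borel"
  proof -
    have [measurable]: "ball x0 r \<in> sets borel" by simp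
    show ?thesis unfolding w_def \<psi>_def by measurable
  qed
  ultimately have nonneg: "0 \<le> (LBINT y. second_diff w x0 y * frac_kernel s y)"
    using frac_const_pos[OF s] by (simp add: frac_laplacian_eq_kernel zero_le_mult_iff)
  have w_above: "\<phi> x + d \<le> w x" for x
    using above cball_sub \<psi>_eq by (auto simp: w_def)
  have w_x0: "w x0 = \<phi> x0 + d" using \<psi>_eq[OF x0_in] r by (simp add: w_def)
  have sub0: "integrable lborel (\<lambda>y. second_diff \<phi> x0 y * frac_kernel s y) \<and>
      (LBINT y. second_diff \<phi> x0 y * frac_kernel s y) < 0"
    using sub[unfolded strictly_subharmonic_def, rule_format, OF x0_in] unfolding \<phi>_def .
  have le: "second_diff w x0 y * frac_kernel s y \<le> second_diff \<phi> x0 y * frac_kernel s y" for y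
    using w_above[of "x0 + y"] w_above[of "x0 - y"] w_x0 by (intro mult_right_mono) auto
  \<comment> \<open>Without integrability the inequality \<open>nonneg\<close> would be void.\<close>
  have "integrable lborel (\<lambda>y. second_diff w x0 y * frac_kernel s y)"
  proof -
    let ?far = "\<lambda>y. indicator {y. r \<le> norm y} y * second_diff w x0 y"
    have "compact (u ` cball 0 1)" by (intro compact_continuous_image u_cont) simp
    then obtain B where B: "\<And>x. norm x \<le> 1 \<Longrightarrow> \<bar>u x\<bar> \<le> B"
      by (metis bounded_real compact_imp_bounded image_eqI mem_cball_0)
    have wB: "\<bar>w x\<bar> \<le> \<bar>B\<bar> + A + 1 / s + \<bar>d\<bar>" for x
    proof (cases "x \<in> ball x0 r")
      case True
      then have "w x = barrier s x + d" using \<psi>_eq[of x] cball_sub[of x] by (simp add: w_def \<phi>_def ext_data_inside)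
      then show ?thesis using barrier_bounds[OF s(1), of x] A by linarith
    next
      case False
      then have w: "w x = u x" by (simp add: w_def)
      have s0: "0 \<le> 1 / s" using s by simp
      show ?thesis
      proof (cases "norm x \<le> 1")
        case True
        from B[OF this] w s0 A show ?thesis by linarith
      next
        case False
        then have "w x = ext_data s A x" using w u_out[of x] by simp
        then show ?thesis using ext_data_bounds[of A s x] A s(1) s0 by linarith
      qed
    qed
    have "integrable lborel (\<lambda>y. ?far y * frac_kernel s y)"
    proof (rule kernel_integrable[OF s])
      show "0 < r / 2" using r by simp
      show "\<bar>?far y\<bar> \<le> 0 * (norm y)\<^sup>2" if "norm y \<le> r / 2" for y using that r by simp
      show "\<bar>?far y\<bar> \<le> 4 * (\<bar>B\<bar> + A + 1 / s + \<bar>d\<bar>)" for y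
      proof -
        have "\<bar>second_diff w x0 y\<bar> \<le> 4 * (\<bar>B\<bar> + A + 1 / s + \<bar>d\<bar>)"
        proof -
          have "\<bar>2 * a - b - c\<bar> \<le> 4 * N" if "\<bar>a\<bar> \<le> N" "\<bar>b\<bar> \<le> N" "\<bar>c\<bar> \<le> N" for a b c N :: real
            using that by linarith
          then show ?thesis using wB by blast
        qed
        then show ?thesis by (auto split: split_indicator intro: order_trans)
      qed
    qed measurable
    moreover have "integrable lborel (\<lambda>y. indicator (ball 0 r) y *\<^sub>R (second_diff \<phi> x0 y * frac_kernel s y))"
      using sub0 by (intro integrable_mult_indicator) auto
    ultimately have "integrable lborel (\<lambda>y. ?far y * frac_kernel s y + indicator (ball 0 r) y *\<^sub>R (second_diff \<phi> x0 y * frac_kernel s y))"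
      by (rule Bochner_Integration.integrable_add)
    moreover have "?far y * frac_kernel s y + indicator (ball 0 r) y *\<^sub>R (second_diff \<phi> x0 y * frac_kernel s y)
       = second_diff w x0 y * frac_kernel s y" for y
    proof (cases "norm y < r")
      case True
      then have "x0 + y \<in> ball x0 r" "x0 - y \<in> ball x0 r" by (simp_all add: dist_norm)
      then have "w (x0 + y) = \<phi> (x0 + y) + d" "w (x0 - y) = \<phi> (x0 - y) + d"
        using \<psi>_eq cball_sub by (auto simp: w_def)
      then show ?thesis using True w_x0 by simp
    qed (simp add: indicator_def)
    ultimately show ?thesis by simp
  qed
  then have "(LBINT y. second_diff w x0 y * frac_kernel s y) \<le> (LBINT y. second_diff \<phi> x0 y * frac_kernel s y)"
    using sub0 le by (intro integral_mono) auto
  then show False using nonneg sub0 by linarith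
qed

section \<open>Weak solutions lie above the barrier\<close>

lemma abs_powr_diff_le:
  fixes a b s :: real
  assumes "0 \<le> a" "0 \<le> b" "0 < s" "s \<le> 1"
  shows "\<bar>a powr s - b powr s\<bar> \<le> \<bar>a - b\<bar> powr s"
proof -
  have *: "a powr s - b powr s \<le> \<bar>a - b\<bar> powr s" if "b \<le> a" "0 \<le> b" for a b
    using powr_subadditive[of b "a - b" s] that assms by simp
  have "a powr s \<le> b powr s" if "a \<le> b" using that assms by (intro powr_mono2) auto
  moreover have "b powr s \<le> a powr s" if "b \<le> a" using that assms by (intro powr_mono2) auto
  ultimately show ?thesis
    using *[of b a] *[of a b] assms by (cases "a \<le> b") (auto simp: abs_minus_commute)
qed

lemma ext_data_Holder:
  assumes "0 < s" "s < 1" "0 \<le> A"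
  shows "\<bar>ext_data s A x - ext_data s A y\<bar> \<le> A * norm (x - y) powr s"
proof -
  define a b where "a = max 0 (min 1 (norm x - 1))" and "b = max 0 (min 1 (norm y - 1))"
  have "\<bar>a - b\<bar> \<le> \<bar>norm x - norm y\<bar>" by (simp add: a_def b_def)
  also have "\<dots> \<le> norm (x - y)" by (rule norm_triangle_ineq3)
  finally have "\<bar>a - b\<bar> powr s \<le> norm (x - y) powr s" using assms by (intro powr_mono2) auto
  moreover have "\<bar>a powr s - b powr s\<bar> \<le> \<bar>a - b\<bar> powr s"
    using assms by (intro abs_powr_diff_le) (auto simp: a_def b_def)
  ultimately have "A * \<bar>a powr s - b powr s\<bar> \<le> A * norm (x - y) powr s"
    using assms by (intro mult_left_mono) auto
  moreover have "ext_data s A x - ext_data s A y = A * (a powr s - b powr s)"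
    by (simp add: ext_data_def a_def b_def algebra_simps)
  ultimately show ?thesis using assms by (simp add: abs_mult)
qed

text \<open>On the circle \<open>u = 0\<close>, so \<open>u\<close> is bounded on both sides of it by a multiple of the s-th power of the
  distance to the circle. A segment from an inner to an outer point is at least as long as each of the two
  distances, and this gives the Hoelder bound across the circle.\<close>

lemma Holder_extension:
  fixes u :: "real^2 \<Rightarrow> real"
  assumes s: "0 < s" "s < 1" and A: "0 \<le> A" and u_out: "\<And>x. 1 \<le> norm x \<Longrightarrow> u x = ext_data s A x"
    and hol: "u \<in> holder_space s (cball 0 1)"
  obtains C where "C > 0" "\<And>x y. \<bar>u x - u y\<bar> \<le> C * norm (x - y) powr s"
    "\<And>x. norm x \<le> 1 \<Longrightarrow> \<bar>u x\<bar> \<le> C * (1 - norm x) powr s"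
proof -
  from hol obtain M where M: "\<bar>u x - u y\<bar> / norm (x - y) powr s \<le> M"
    if "norm x \<le> 1" "norm y \<le> 1" "x \<noteq> y" for x y
    unfolding holder_space_def bdd_above_def by (auto simp: mem_cball_0) blast
  define C where "C = \<bar>M\<bar> + A + 1"
  have in_in: "\<bar>u x - u y\<bar> \<le> \<bar>M\<bar> * norm (x - y) powr s" if "norm x \<le> 1" "norm y \<le> 1" for x y
  proof (cases "x = y")
    case False
    then have "\<bar>u x - u y\<bar> \<le> M * norm (x - y) powr s"
      using M[OF that False] by (simp add: divide_le_eq)
    then show ?thesis by (rule order_trans) (intro mult_right_mono; simp)
  qed simp
  have inside: "\<bar>u x\<bar> \<le> \<bar>M\<bar> * (1 - norm x) powr s" if x: "norm x \<le> 1" for x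
  proof -
    obtain e :: "real^2" where e: "norm e = 1" "x = norm x *\<^sub>R e"
    proof (cases "x = 0")
      case True
      then show ?thesis using that[of "axis 1 1"] by (simp add: norm_axis_1)
    next
      case False
      then show ?thesis using that[of "x /\<^sub>R norm x"] by simp
    qed
    have "x - e = (norm x - 1) *\<^sub>R e" using e(2) by (simp add: algebra_simps)
    then have "norm (x - e) = 1 - norm x" using e(1) x by simp
    moreover have "u e = 0" using e(1) by (simp add: u_out ext_data_inside)
    ultimately show ?thesis using in_in[of x e] x e(1) by simp
  qed
  have in_out: "\<bar>u x - u y\<bar> \<le> (\<bar>M\<bar> + A) * norm (x - y) powr s" if "norm x \<le> 1" "1 \<le> norm y" for x y
  proof -
    have d: "1 - norm x \<le> norm (x - y)" using that norm_triangle_ineq2[of y x] by (simp add: norm_minus_commute)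
    have "\<bar>u x\<bar> \<le> \<bar>M\<bar> * (1 - norm x) powr s" by (rule inside[OF that(1)])
    also have "\<dots> \<le> \<bar>M\<bar> * norm (x - y) powr s" using d that s by (intro mult_left_mono powr_mono2) auto
    finally have "\<bar>u x\<bar> \<le> \<bar>M\<bar> * norm (x - y) powr s" .
    moreover have "\<bar>u y\<bar> \<le> A * norm (x - y) powr s"
      using ext_data_Holder[OF s A, of x y] that by (simp add: u_out ext_data_inside)
    ultimately show ?thesis by (simp add: distrib_right)
  qed
  show thesis
  proof (rule that[of C])
    show "C > 0" using A by (simp add: C_def)
    show "\<bar>u x\<bar> \<le> C * (1 - norm x) powr s" if "norm x \<le> 1" for x
      by (rule order_trans[OF inside[OF that]]) (intro mult_right_mono; use A in \<open>simp add: C_def\<close>)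
    show "\<bar>u x - u y\<bar> \<le> C * norm (x - y) powr s" for x y
    proof -
      consider "norm x \<le> 1" "norm y \<le> 1" | "norm x \<le> 1" "1 \<le> norm y" | "1 \<le> norm x" "norm y \<le> 1"
        | "1 \<le> norm x" "1 \<le> norm y" by linarith
      then have "\<bar>u x - u y\<bar> \<le> (\<bar>M\<bar> + A) * norm (x - y) powr s"
      proof cases
        case 1
        from in_in[OF this] show ?thesis
          by (rule order_trans) (intro mult_right_mono; use A in simp)
      next
        case 3
        from in_out[OF 3(2,1)] show ?thesis by (simp add: abs_minus_commute norm_minus_commute)
      next
        case 4
        have "\<bar>u x - u y\<bar> \<le> A * norm (x - y) powr s" using ext_data_Holder[OF s A, of x y] 4 by (simp add: u_out)
        then show ?thesis by (rule order_trans) (intro mult_right_mono; simp)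
      qed (rule in_out)
      then show ?thesis by (rule order_trans) (intro mult_right_mono; simp add: C_def)
    qed
  qed
qed

lemma Holder_imp_continuous:
  fixes u :: "'a::real_normed_vector \<Rightarrow> real"
  assumes "0 < s" "\<And>x y. \<bar>u x - u y\<bar> \<le> C * norm (x - y) powr s"
  shows "continuous_on UNIV u"
  unfolding continuous_on_def
proof
  fix x :: 'a
  have "((\<lambda>y. C * norm (y - x) powr s) \<longlongrightarrow> C * norm (x - x) powr s) (at x)"
    using assms(1) by (intro tendsto_mult tendsto_const tendsto_powr' tendsto_norm tendsto_diff tendsto_ident_at)
      (auto simp: eventually_at intro!: exI[of _ 1])
  then have "((\<lambda>y. u y - u x) \<longlongrightarrow> 0) (at x)"
    by (intro Lim_null_comparison[of "\<lambda>y. u y - u x" "\<lambda>y. C * norm (y - x) powr s"]) (use assms in auto)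
  then show "(u \<longlongrightarrow> u x) (at x)" by (rule LIM_zero_cancel)
qed

lemma flat_exp_measurable [measurable]: "flat_exp m \<in> borel_measurable borel"
  unfolding flat_exp_def[abs_def] by measurable

lemma bump_measurable [measurable]: "bump c R \<in> borel_measurable borel"
  unfolding bump_def[abs_def] by measurable

lemma bump_shift: "bump (c + a) R (z + a) = bump c R z" "bump c R (z + a) = bump (c - a) R z"
  "bump (c + a) R z = bump c R (z - a)"
  by (simp_all add: bump_def algebra_simps)

lemma integrable_bounded_times_bump:
  fixes u :: "real^2 \<Rightarrow> real"
  assumes [measurable]: "u \<in> borel_measurable borel" and B: "\<And>z. \<bar>u z\<bar> \<le> B" and "\<epsilon> > 0"
  shows "integrable lborel (\<lambda>z. u z * bump c (\<epsilon>\<^sup>2) z)"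
proof (rule Bochner_Integration.integrable_bound)
  show "integrable lborel (\<lambda>z. B * indicator (cball c \<epsilon>) z)"
    using emeasure_lborel_cball_finite[of c \<epsilon>] by (intro integrable_mult_right) auto
  have B0: "0 \<le> B" using B[of 0] by simp
  have "\<bar>u z * bump c (\<epsilon>\<^sup>2) z\<bar> \<le> B * indicator (cball c \<epsilon>) z" for z
  proof (cases "z \<in> cball c \<epsilon>")
    case True
    then show ?thesis using mult_mono[OF B[of z] bump_le_1[of c "\<epsilon>\<^sup>2" z]] bump_nonneg[of c "\<epsilon>\<^sup>2" z] B0
      by (simp add: abs_mult)
  next
    case False
    then show ?thesis using bump_eq_0_iff[OF \<open>\<epsilon> > 0\<close>, of c z] by simp
  qed
  then show "AE z in lborel. norm (u z * bump c (\<epsilon>\<^sup>2) z) \<le> norm (B * indicator (cball c \<epsilon>) z)"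
    using B0 by (auto split: split_indicator)
qed measurable

lemma lborel_integral_translate:
  fixes f :: "'a::euclidean_space \<Rightarrow> real"
  assumes [measurable]: "f \<in> borel_measurable borel"
  shows "(LBINT z. f (z + a)) = (LBINT z. f z)" and "integrable lborel (\<lambda>z. f (z + a)) \<longleftrightarrow> integrable lborel f"
proof -
  have m: "(\<lambda>z. a + z) \<in> lborel \<rightarrow>\<^sub>M (borel :: 'a measure)" by measurable
  have "(LBINT z. f z) = integral\<^sup>L (distr lborel borel ((+) a)) f" by (simp only: lborel_distr_plus)
  also have "\<dots> = (LBINT z. f (a + z))" by (rule integral_distr[OF m]) simp
  finally show "(LBINT z. f (z + a)) = (LBINT z. f z)" by (simp add: add.commute)
  have "integrable lborel f \<longleftrightarrow> integrable (distr lborel borel ((+) a)) f" by (simp only: lborel_distr_plus)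
  also have "\<dots> \<longleftrightarrow> integrable lborel (\<lambda>z. f (a + z))" by (rule integrable_distr_eq[OF m]) simp
  finally show "integrable lborel (\<lambda>z. f (z + a)) \<longleftrightarrow> integrable lborel f" by (simp add: add.commute)
qed

lemma distr_lborel_shear:
  "distr (lborel \<Otimes>\<^sub>M lborel) borel (\<lambda>(z, y). (z, z + y)) = (lborel :: ('a::euclidean_space \<times> 'a) measure)"
proof (rule measure_eqI)
  let ?T = "\<lambda>(z, y). (z, z + y :: 'a)"
  have T [measurable]: "?T \<in> lborel \<Otimes>\<^sub>M lborel \<rightarrow>\<^sub>M borel \<Otimes>\<^sub>M borel" by measurable
  fix X :: "('a \<times> 'a) set" assume "X \<in> sets (distr (lborel \<Otimes>\<^sub>M lborel) borel ?T)"
  then have X: "X \<in> sets borel" by simp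
  then have X' [measurable]: "X \<in> sets (borel \<Otimes>\<^sub>M borel)" by (subst borel_prod)
  have "emeasure (distr (lborel \<Otimes>\<^sub>M lborel) borel ?T) X = (\<integral>\<^sup>+p. indicator X p \<partial>distr (lborel \<Otimes>\<^sub>M lborel) (borel \<Otimes>\<^sub>M borel) ?T)"
    using X by (simp add: borel_prod)
  also have "\<dots> = (\<integral>\<^sup>+p. indicator X (?T p) \<partial>(lborel \<Otimes>\<^sub>M lborel))"
    by (rule nn_integral_distr) measurable
  also have "\<dots> = (\<integral>\<^sup>+z. \<integral>\<^sup>+y. indicator X (z, z + y) \<partial>lborel \<partial>lborel)"
    by (subst lborel.nn_integral_fst[symmetric]) (auto simp: split_beta')
  also have "\<dots> = (\<integral>\<^sup>+z. \<integral>\<^sup>+y. indicator X (z, y) \<partial>lborel \<partial>lborel)"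
    by (intro nn_integral_cong lborel_translate) measurable
  also have "\<dots> = emeasure (lborel \<Otimes>\<^sub>M lborel) X"
    using X' by (subst lborel.nn_integral_fst) auto
  finally show "emeasure (distr (lborel \<Otimes>\<^sub>M lborel) borel ?T) X = emeasure lborel X"
    by (simp add: lborel_prod)
qed simp

text \<open>Test with \<open>\<eta> = bump x (\<epsilon>\<^sup>2)\<close> and substitute \<open>(z, z + y)\<close> for the pair of integration variables. For fixed
  \<open>y\<close> the four products of values of \<open>u\<close> and \<open>\<eta>\<close> integrate in \<open>z\<close> to \<open>V x\<close>, \<open>V (x - y)\<close>, \<open>V (x + y)\<close>
  and \<open>V x\<close>. No principal value appears, since the double integral is absolutely convergent.\<close>

lemma weak_solution_mollified:
  fixes u :: "real^2 \<Rightarrow> real"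
  assumes [measurable]: "u \<in> borel_measurable borel" and B: "\<And>z. \<bar>u z\<bar> \<le> B"
    and u: "weak_solution s \<Omega> g u" and \<epsilon>: "\<epsilon> > 0" and x: "cball x \<epsilon> \<subseteq> \<Omega>"
  defines "V \<equiv> \<lambda>x. LBINT z. u z * bump x (\<epsilon>\<^sup>2) z"
  shows "has_bochner_integral lborel (\<lambda>y. second_diff V x y * frac_kernel s y) 0"
proof -
  define \<eta> where "\<eta> = bump x (\<epsilon>\<^sup>2)"
  have [measurable]: "\<eta> \<in> borel_measurable borel" by (simp add: \<eta>_def)
  define G where "G p = (u (fst p) - u (snd p)) * (\<eta> (fst p) - \<eta> (snd p)) / norm (fst p - snd p) powr (2 + 2 * s)"
    for p :: "(real^2) \<times> (real^2)"
  have G_pair: "G \<in> borel_measurable (lborel \<Otimes>\<^sub>M lborel)" unfolding G_def by measurable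
  then have G_meas: "G \<in> borel_measurable borel" by (simp add: lborel_prod)
  have "test_function \<Omega> \<eta>" unfolding \<eta>_def by (rule test_function_bump[OF \<epsilon> x])
  then have "has_bochner_integral lebesgue G 0"
    using u unfolding weak_solution_def by (auto simp: G_def[abs_def] split_beta')
  then have "has_bochner_integral lborel G 0"
    using G_meas by (simp add: has_bochner_integral_iff integrable_completion integral_completion)
  then have "has_bochner_integral (distr (lborel \<Otimes>\<^sub>M lborel) borel (\<lambda>(z, y). (z, z + y))) G 0"
    by (simp only: distr_lborel_shear)
  then have G0: "integrable (lborel \<Otimes>\<^sub>M lborel) (\<lambda>p. G (case p of (z, y) \<Rightarrow> (z, z + y)))"
    "integral\<^sup>L (lborel \<Otimes>\<^sub>M lborel) (\<lambda>p. G (case p of (z, y) \<Rightarrow> (z, z + y))) = 0"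
  proof -
    have T: "(\<lambda>(z, y). (z, z + y)) \<in> lborel \<Otimes>\<^sub>M lborel \<rightarrow>\<^sub>M (borel :: ((real^2) \<times> (real^2)) measure)"
      unfolding borel_prod[symmetric] by measurable
    assume *: "has_bochner_integral (distr (lborel \<Otimes>\<^sub>M lborel) borel (\<lambda>(z, y). (z, z + y))) G 0"
    show "integrable (lborel \<Otimes>\<^sub>M lborel) (\<lambda>p. G (case p of (z, y) \<Rightarrow> (z, z + y)))"
      using * integrable_distr_eq[OF T G_meas] by (simp add: has_bochner_integral_iff)
    show "integral\<^sup>L (lborel \<Otimes>\<^sub>M lborel) (\<lambda>p. G (case p of (z, y) \<Rightarrow> (z, z + y))) = 0"
      using * integral_distr[OF T G_meas] by (simp add: has_bochner_integral_iff)
  qed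
  have G_shear: "G (z, z + y) = (u z * \<eta> z - u z * \<eta> (z + y) - u (z + y) * \<eta> z + u (z + y) * \<eta> (z + y)) * frac_kernel s y" for z y
  proof -
    have "-2-2 * s = - (2 + 2 * s)" by simp
    then have "frac_kernel s y = inverse (norm y powr (2 + 2 * s))" by (simp only: powr_minus)
    then show ?thesis by (simp add: G_def divide_inverse algebra_simps)
  qed
  have inner: "(LBINT z. G (z, z + y)) = second_diff V x y * frac_kernel s y" for y
  proof -
    have B': "\<bar>u (z + y)\<bar> \<le> B" for z by (rule B)
    have e1: "\<eta> (z + y) = bump (x - y) (\<epsilon>\<^sup>2) z" for z by (simp add: \<eta>_def bump_shift)
    have e2: "\<eta> z = bump (x + y) (\<epsilon>\<^sup>2) (z + y)" for z by (simp add: \<eta>_def bump_shift)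
    have i1: "integrable lborel (\<lambda>z. u z * \<eta> z)" unfolding \<eta>_def by (intro integrable_bounded_times_bump[OF _ B] \<epsilon>) simp
    have i2: "integrable lborel (\<lambda>z. u z * \<eta> (z + y))" unfolding e1 by (intro integrable_bounded_times_bump[OF _ B] \<epsilon>) simp
    have i3: "integrable lborel (\<lambda>z. u (z + y) * \<eta> z)" unfolding \<eta>_def by (intro integrable_bounded_times_bump[OF _ B'] \<epsilon>) simp
    have i4: "integrable lborel (\<lambda>z. u (z + y) * \<eta> (z + y))"
      using i1 lborel_integral_translate(2)[of "\<lambda>z. u z * \<eta> z" y] by simp
    have "(LBINT z. u (z + y) * \<eta> (z + y)) = V x"
      using lborel_integral_translate(1)[of "\<lambda>z. u z * \<eta> z" y] by (simp add: V_def \<eta>_def)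
    moreover have "(LBINT z. u (z + y) * \<eta> z) = V (x + y)"
      using lborel_integral_translate(1)[of "\<lambda>z. u z * bump (x + y) (\<epsilon>\<^sup>2) z" y] by (simp add: V_def e2)
    moreover have "(LBINT z. u z * \<eta> (z + y)) = V (x - y)" by (simp add: V_def e1)
    moreover have "(LBINT z. u z * \<eta> z) = V x" by (simp add: V_def \<eta>_def)
    moreover have "(LBINT z. u z * \<eta> z - u z * \<eta> (z + y) - u (z + y) * \<eta> z + u (z + y) * \<eta> (z + y)) =
       (LBINT z. u z * \<eta> z) - (LBINT z. u z * \<eta> (z + y)) - (LBINT z. u (z + y) * \<eta> z) + (LBINT z. u (z + y) * \<eta> (z + y))"
      using i1 i2 i3 i4 by simp
    ultimately show ?thesis unfolding G_shear by simp
  qed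
  let ?f = "\<lambda>z y. G (z, z + y)"
  have f: "integrable (lborel \<Otimes>\<^sub>M lborel) (\<lambda>(z, y). ?f z y)" "integral\<^sup>L (lborel \<Otimes>\<^sub>M lborel) (\<lambda>(z, y). ?f z y) = 0"
    using G0 by (simp_all add: split_beta')
  have "integrable lborel (\<lambda>y. LBINT z. ?f z y)" by (rule lborel_pair.integrable_snd[OF f(1)])
  moreover have "(LBINT y. LBINT z. ?f z y) = 0" using lborel_pair.integral_snd[OF f(1)] f(2) by simp
  ultimately show ?thesis by (simp add: inner has_bochner_integral_iff)
qed

text \<open>As for viscosity solutions, with the mollification \<open>U\<close> in place of \<open>u\<close>: it is uniformly close to \<open>u\<close> by
  the global Hoelder bound, so a minimum point of \<open>U - \<phi>\<close> lies in the compact set \<open>K\<close> where \<open>u - \<phi>\<close> is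
  clearly negative, and there the mollified equation holds if \<open>\<epsilon>\<close> is smaller than the distance of
  \<open>K\<close> to the circle.\<close>

lemma weak_solution_above_barrier:
  assumes s: "0 < s" "s < 1" and A: "0 < A"
    and sub: "strictly_subharmonic s (\<lambda>z. barrier s z + ext_data s A z)"
    and u: "weak_solution s (ball 0 1) (ext_data s A) u"
    and Holder: "C > 0" "\<And>x y. \<bar>u x - u y\<bar> \<le> C * norm (x - y) powr s"
    and x1: "norm x1 < 1"
  shows "barrier s x1 \<le> u x1"
proof (rule ccontr)
  assume "\<not> barrier s x1 \<le> u x1"
  then have neg: "u x1 < barrier s x1" by simp
  define \<phi> where "\<phi> = (\<lambda>z. barrier s z + ext_data s A z)"
  have u_out: "u x = ext_data s A x" if "1 \<le> norm x" for x
    using u that by (auto simp: weak_solution_def)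
  have contu: "continuous_on UNIV u" by (rule Holder_imp_continuous[OF s(1) Holder(2)])
  have [measurable]: "u \<in> borel_measurable borel" by (rule borel_measurable_continuous_onI[OF contu])
  have cont\<phi>: "continuous_on UNIV \<phi>"
    unfolding \<phi>_def using s by (intro continuous_on_add continuous_on_barrier continuous_on_ext_data)
  have "compact (u ` cball 0 1)" using contu by (intro compact_continuous_image) (auto intro: continuous_on_subset)
  then obtain B0 where B0: "\<And>x. norm x \<le> 1 \<Longrightarrow> \<bar>u x\<bar> \<le> B0"
    by (metis bounded_real compact_imp_bounded image_eqI mem_cball_0)
  have B: "\<bar>u z\<bar> \<le> \<bar>B0\<bar> + A" for z
    using B0[of z] u_out[of z] ext_data_bounds[of A s z] A s by (cases "norm z \<le> 1") auto
  define m where "m = barrier s x1 - u x1"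
  have m: "m > 0" using neg by (simp add: m_def)
  define K where "K = cball 0 1 \<inter> (\<lambda>x. u x - \<phi> x) -` {..- (m/2)}"
  have "closed ((\<lambda>x. u x - \<phi> x) -` {..- (m/2)})"
    using contu cont\<phi> by (intro closed_vimage continuous_on_diff) auto
  then have K: "compact K" unfolding K_def by (intro compact_Int_closed) auto
  have D_out: "u x - \<phi> x = 0" if "1 \<le> norm x" for x
    using that by (simp add: \<phi>_def u_out barrier_outside)
  have D_x1: "u x1 - \<phi> x1 = - m" using x1 by (simp add: \<phi>_def ext_data_inside m_def)
  then have "x1 \<in> K" using x1 m by (simp add: K_def)
  then obtain z0 where z0: "z0 \<in> K" "\<And>x. x \<in> K \<Longrightarrow> norm x \<le> norm z0"
    using continuous_attains_sup[OF K, of norm] by (auto intro: continuous_intros)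
  have "norm z0 < 1"
  proof (rule ccontr)
    assume "\<not> norm z0 < 1"
    then show False using z0(1) m D_out[of z0] by (simp add: K_def)
  qed
  \<comment> \<open>The second entry makes \<open>C * \<epsilon> powr s \<le> m / 8\<close>.\<close>
  define \<epsilon> where "\<epsilon> = min ((1 - norm z0) / 2) ((m / (8 * C)) powr (1 / s))"
  have \<epsilon>: "0 < \<epsilon>" using \<open>norm z0 < 1\<close> m Holder(1) by (simp add: \<epsilon>_def)
  have \<epsilon>C: "C * \<epsilon> powr s \<le> m / 8"
  proof -
    have "\<epsilon> powr s \<le> ((m / (8 * C)) powr (1 / s)) powr s"
      using \<epsilon> s by (intro powr_mono2) (auto simp: \<epsilon>_def)
    also have "\<dots> = m / (8 * C)" using s m Holder(1) by (simp add: powr_powr)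
    finally show ?thesis using Holder(1) by (simp add: field_simps)
  qed
  define c where "c = (LBINT z. bump (0::real^2) (\<epsilon>\<^sup>2) z)"
  define V where "V = (\<lambda>x. LBINT z. u z * bump x (\<epsilon>\<^sup>2) z)"
  have V_shift: "V x = (LBINT z. u (z + x) * bump 0 (\<epsilon>\<^sup>2) z)" for x
    using lborel_integral_translate(1)[of "\<lambda>z. u z * bump x (\<epsilon>\<^sup>2) z" x] by (simp add: V_def bump_shift)
  have int_u: "integrable lborel (\<lambda>z. u (z + x) * bump 0 (\<epsilon>\<^sup>2) z)" for x
    by (intro integrable_bounded_times_bump[OF _ B] \<epsilon>) measurable
  have int_b: "integrable lborel (\<lambda>z::real^2. k * bump 0 (\<epsilon>\<^sup>2) z)" for k
    by (intro integrable_bounded_times_bump[where B="\<bar>k\<bar>"] \<epsilon>) auto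
  \<comment> \<open>The mass of the mollifier, used for normalisation.\<close>
  have c_pos: "c > 0"
  proof -
    have "0 \<le> c" unfolding c_def by (intro Bochner_Integration.integral_nonneg bump_nonneg)
    moreover have "c \<noteq> 0"
    proof
      assume "c = 0"
      then have "AE z in lborel. bump (0::real^2) (\<epsilon>\<^sup>2) z = 0"
        using integral_nonneg_eq_0_iff_AE[OF int_b[of 1, simplified]] by (simp add: c_def bump_nonneg)
      then have "AE z in lborel. z \<notin> ball (0::real^2) \<epsilon>"
        by eventually_elim (use bump_eq_0_iff[OF \<epsilon>, of "0::real^2"] in simp)
      then have "ball (0::real^2) \<epsilon> \<in> null_sets lborel" by (subst AE_iff_null_sets) simp_all
      then show False using \<epsilon> emeasure_ball_R2[of \<epsilon> 0] by (simp add: null_sets_def)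
    qed
    ultimately show ?thesis by simp
  qed
  have V_Holder: "\<bar>V x - V x'\<bar> \<le> c * C * norm (x - x') powr s" for x x'
  proof -
    have "V x - V x' = (LBINT z. (u (z + x) - u (z + x')) * bump 0 (\<epsilon>\<^sup>2) z)"
      unfolding V_shift left_diff_distrib using int_u by simp
    also have "\<bar>\<dots>\<bar> \<le> (LBINT z. (C * norm (x - x') powr s) * bump (0::real^2) (\<epsilon>\<^sup>2) z)"
    proof (rule order_trans[OF integral_abs_bound], rule integral_mono)
      show "integrable lborel (\<lambda>z. \<bar>(u (z + x) - u (z + x')) * bump 0 (\<epsilon>\<^sup>2) z\<bar>)"
        unfolding left_diff_distrib using int_u by (intro integrable_abs Bochner_Integration.integrable_diff)
      show "\<bar>(u (z + x) - u (z + x')) * bump 0 (\<epsilon>\<^sup>2) z\<bar> \<le> C * norm (x - x') powr s * bump 0 (\<epsilon>\<^sup>2) z" for z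
        unfolding abs_mult using Holder(2)[of "z + x" "z + x'"] bump_nonneg[of 0 "\<epsilon>\<^sup>2" z]
        by (simp add: mult_right_mono)
    qed (rule int_b)
    also have "\<dots> = c * C * norm (x - x') powr s" by (simp add: c_def)
    finally show ?thesis .
  qed
  have V_close: "\<bar>V x - c * u x\<bar> \<le> c * (m / 8)" for x
  proof -
    have "V x - c * u x = (LBINT z. (u (z + x) - u x) * bump 0 (\<epsilon>\<^sup>2) z)"
      unfolding V_shift left_diff_distrib using int_u int_b by (simp add: c_def)
    also have "\<bar>\<dots>\<bar> \<le> (LBINT z. (m / 8) * bump (0::real^2) (\<epsilon>\<^sup>2) z)"
    proof (rule order_trans[OF integral_abs_bound], rule integral_mono)
      show "integrable lborel (\<lambda>z. \<bar>(u (z + x) - u x) * bump 0 (\<epsilon>\<^sup>2) z\<bar>)"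
        unfolding left_diff_distrib using int_u int_b by (intro integrable_abs Bochner_Integration.integrable_diff)
      show "\<bar>(u (z + x) - u x) * bump 0 (\<epsilon>\<^sup>2) z\<bar> \<le> m / 8 * bump 0 (\<epsilon>\<^sup>2) z" for z
      proof (cases "norm z < \<epsilon>")
        case True
        have "\<bar>u (z + x) - u x\<bar> \<le> C * norm z powr s" using Holder(2)[of "z + x" x] by simp
        also have "\<dots> \<le> C * \<epsilon> powr s" using True s Holder(1) by (intro mult_left_mono powr_mono2) auto
        also note \<epsilon>C
        finally have "\<bar>u (z + x) - u x\<bar> * bump 0 (\<epsilon>\<^sup>2) z \<le> m / 8 * bump 0 (\<epsilon>\<^sup>2) z"
          by (rule mult_right_mono[OF _ bump_nonneg])
        then show ?thesis by (simp only: abs_mult abs_of_nonneg[OF bump_nonneg])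
      next
        case False
        then show ?thesis using bump_eq_0_iff[OF \<epsilon>, of 0 z] by simp
      qed
    qed (rule int_b)
    also have "\<dots> = c * (m / 8)" by (simp add: c_def)
    finally show ?thesis .
  qed
  define U where "U x = V x / c" for x
  have U_close: "\<bar>U x - u x\<bar> \<le> m / 8" for x
  proof -
    have "c * \<bar>U x - u x\<bar> = \<bar>V x - c * u x\<bar>"
    proof -
      have "V x - c * u x = c * (U x - u x)" using c_pos by (simp add: U_def field_simps)
      then show ?thesis using c_pos by (simp add: abs_mult)
    qed
    then have "c * \<bar>U x - u x\<bar> \<le> c * (m / 8)" using V_close[of x] by simp
    then show ?thesis using c_pos by simp
  qed
  have "continuous_on UNIV V" by (rule Holder_imp_continuous[OF s(1) V_Holder])
  then have "continuous_on (cball 0 1) (\<lambda>x. U x - \<phi> x)"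
    unfolding U_def using cont\<phi> c_pos by (intro continuous_intros) (auto intro: continuous_on_subset)
  then obtain x0 where x0: "x0 \<in> cball 0 1" "\<And>x. x \<in> cball 0 1 \<Longrightarrow> U x0 - \<phi> x0 \<le> U x - \<phi> x"
    using continuous_attains_inf[of "cball (0::real^2) 1" "\<lambda>x. U x - \<phi> x"] by auto
  have "U x0 - \<phi> x0 \<le> U x1 - \<phi> x1" using x0(2)[of x1] x1 by simp
  also have "\<dots> \<le> - m + m / 8"
    using U_close[of x1] D_x1 by linarith
  finally have low: "U x0 - \<phi> x0 \<le> - m + m / 8" .
  then have "u x0 - \<phi> x0 \<le> - (m / 2)" using U_close[of x0] m by linarith
  then have "x0 \<in> K" using x0(1) by (simp add: K_def)
  then have "norm x0 \<le> norm z0" by (rule z0(2))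
  then have x0_in: "norm x0 < 1" using \<open>norm z0 < 1\<close> by simp
  have "cball x0 \<epsilon> \<subseteq> ball 0 1"
  proof
    fix z assume "z \<in> cball x0 \<epsilon>"
    then have "norm (z - x0) \<le> (1 - norm z0) / 2" by (simp add: \<epsilon>_def dist_norm norm_minus_commute)
    then have "norm z < 1" using norm_triangle_ineq[of x0 "z - x0"] \<open>norm x0 \<le> norm z0\<close> \<open>norm z0 < 1\<close> by simp
    then show "z \<in> ball 0 1" by simp
  qed
  from weak_solution_mollified[OF _ B u \<epsilon> this]
  have "has_bochner_integral lborel (\<lambda>y. second_diff V x0 y * frac_kernel s y) 0" by (simp add: V_def)
  then have "has_bochner_integral lborel (\<lambda>y. second_diff V x0 y * frac_kernel s y / c) (0 / c)"
    by (intro has_bochner_integral_divide)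
  then have U0: "has_bochner_integral lborel (\<lambda>y. second_diff U x0 y * frac_kernel s y) 0"
    by (simp add: U_def diff_divide_distrib[symmetric])
  have above: "U x0 - \<phi> x0 \<le> U x - \<phi> x" for x
  proof (cases "norm x \<le> 1")
    case True
    then show ?thesis using x0(2)[of x] by simp
  next
    case False
    then have "1 \<le> norm x" by simp
    from D_out[OF this] low U_close[of x] m show ?thesis by linarith
  qed
  have sub0: "integrable lborel (\<lambda>y. second_diff \<phi> x0 y * frac_kernel s y) \<and>
      (LBINT y. second_diff \<phi> x0 y * frac_kernel s y) < 0"
    using sub[unfolded strictly_subharmonic_def, rule_format, OF x0_in] unfolding \<phi>_def .
  have "(LBINT y. second_diff U x0 y * frac_kernel s y) \<le> (LBINT y. second_diff \<phi> x0 y * frac_kernel s y)"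
  proof (rule integral_mono)
    show "second_diff U x0 y * frac_kernel s y \<le> second_diff \<phi> x0 y * frac_kernel s y" for y
      using above[of "x0 + y"] above[of "x0 - y"] by (intro mult_right_mono) auto
  qed (use U0 sub0 in \<open>auto simp: has_bochner_integral_iff\<close>)
  then show False using U0 sub0 by (simp add: has_bochner_integral_iff)
qed

section \<open>Finite energy\<close>

definition energy_domain :: "((real^2) \<times> (real^2)) set" where
  "energy_domain = UNIV - (- ball 0 1) \<times> (- ball 0 1)"

lemma energy_domain_iff: "p \<in> energy_domain \<longleftrightarrow> norm (fst p) < 1 \<or> norm (snd p) < 1"
  by (cases p) (auto simp: energy_domain_def)

text \<open>The indicator restricts the energy to pairs of points of which at least one lies in the disc.\<close>

definition weight :: "real \<Rightarrow> (real^2) \<times> (real^2) \<Rightarrow> real" where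
  "weight s p = frac_kernel s (fst p - snd p) * indicator energy_domain p"

definition energy :: "real \<Rightarrow> (real^2 \<Rightarrow> real) \<Rightarrow> ennreal" where
  "energy s w = (\<integral>\<^sup>+p. ennreal ((w (fst p) - w (snd p))\<^sup>2 * weight s p) \<partial>(lborel \<Otimes>\<^sub>M lborel))"

lemma weight_nonneg: "0 \<le> weight s p" by (simp add: weight_def)

lemma weight_measurable [measurable]: "weight s \<in> borel_measurable (lborel \<Otimes>\<^sub>M lborel)"
proof -
  have "weight s = (\<lambda>p. frac_kernel s (fst p - snd p) * (if norm (fst p) < 1 then 1 else if norm (snd p) < 1 then 1 else 0))"
    by (auto simp: weight_def energy_domain_iff fun_eq_iff)
  also have "\<dots> \<in> borel_measurable (lborel \<Otimes>\<^sub>M lborel)"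
    by measurable
  finally show ?thesis .
qed

text \<open>Only pairs \<open>(x, y)\<close> with \<open>y\<close> in a fixed disc outside the unit disc are kept. There \<open>w y = 0\<close>, and the
  distance of the points is at most 5.\<close>

lemma Poincare:
  fixes w :: "real^2 \<Rightarrow> real"
  assumes s: "0 < s" and [measurable]: "w \<in> borel_measurable borel" and w: "\<And>x. 1 \<le> norm x \<Longrightarrow> w x = 0"
  shows "ennreal (pi * 5 powr (-2-2 * s)) * (\<integral>\<^sup>+x. ennreal ((w x)\<^sup>2) \<partial>lborel) \<le> energy s w"
proof -
  \<comment> \<open>The centre of a disc of radius 1 outside the unit disc.\<close>
  define c :: "real^2" where "c = 3 *\<^sub>R axis 1 1"
  have c: "norm c = 3" by (simp add: c_def norm_axis_1)
  let ?k = "5 powr (-2-2 * s) :: real"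
  have "ennreal (pi * ?k) * (\<integral>\<^sup>+x. ennreal ((w x)\<^sup>2) \<partial>lborel) = (\<integral>\<^sup>+x. ennreal (pi * ?k) * ennreal ((w x)\<^sup>2) \<partial>lborel)"
    by (rule nn_integral_cmult[symmetric]) measurable
  also have "\<dots> \<le> (\<integral>\<^sup>+x. \<integral>\<^sup>+y. ennreal ((w x - w y)\<^sup>2 * weight s (x, y)) \<partial>lborel \<partial>lborel)"
  proof (rule nn_integral_mono)
    fix x :: "real^2"
    show "ennreal (pi * ?k) * ennreal ((w x)\<^sup>2) \<le> (\<integral>\<^sup>+y. ennreal ((w x - w y)\<^sup>2 * weight s (x, y)) \<partial>lborel)"
    proof (cases "norm x < 1")
      case True
      have "ennreal (pi * ?k) * ennreal ((w x)\<^sup>2) = ennreal ((w x)\<^sup>2 * ?k) * emeasure lborel (ball c 1)"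
        by (simp add: emeasure_ball_R2 mult_ac flip: ennreal_mult)
      also have "\<dots> = (\<integral>\<^sup>+y. ennreal ((w x)\<^sup>2 * ?k) * indicator (ball c 1) y \<partial>lborel)"
        by (rule nn_integral_cmult_indicator[symmetric]) simp
      also have "\<dots> \<le> (\<integral>\<^sup>+y. ennreal ((w x - w y)\<^sup>2 * weight s (x, y)) \<partial>lborel)"
      proof (rule nn_integral_mono)
        fix y :: "real^2"
        show "ennreal ((w x)\<^sup>2 * ?k) * indicator (ball c 1) y \<le> ennreal ((w x - w y)\<^sup>2 * weight s (x, y))"
        proof (cases "y \<in> ball c 1")
          case y: True
          have yc: "norm (y - c) < 1" using y by (simp add: dist_norm norm_minus_commute)
          have "1 \<le> norm y" using norm_triangle_ineq2[of c "c - y"] yc c by (simp add: norm_minus_commute)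
          then have "w y = 0" and ne: "x \<noteq> y" using w True by auto
          have "norm y \<le> 4" using norm_triangle_ineq[of "y - c" c] yc c by simp
          then have "norm (x - y) \<le> 5" using norm_triangle_ineq4[of x y] True by simp
          then have "?k \<le> frac_kernel s (x - y)" using ne s by (intro powr_mono2') auto
          then have "?k \<le> weight s (x, y)" using True by (simp add: weight_def energy_domain_iff)
          then have "(w x)\<^sup>2 * ?k \<le> (w x - w y)\<^sup>2 * weight s (x, y)"
            unfolding \<open>w y = 0\<close> by (simp add: mult_left_mono)
          then show ?thesis using y by (simp add: ennreal_leI)
        qed simp
      qed
      finally show ?thesis .
    qed (simp add: w)
  qed
  also have "\<dots> = energy s w"
    unfolding energy_def by (subst lborel.nn_integral_fst[symmetric]) simp_all
  finally show ?thesis .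
qed

text \<open>The integrand of the energy is symmetric, so one may assume that the first point is in the disc.\<close>

lemma energy_le_by_symmetry:
  assumes [measurable]: "w \<in> borel_measurable borel"
    and "\<And>x y. norm x < 1 \<Longrightarrow> (w x - w y)\<^sup>2 * frac_kernel s (x - y) \<le> F x y"
    and F [measurable]: "(\<lambda>p. F (fst p) (snd p)) \<in> borel_measurable (lborel \<Otimes>\<^sub>M lborel)"
  shows "energy s w \<le> 2 * (\<integral>\<^sup>+x. \<integral>\<^sup>+y. ennreal (F x y) * indicator (ball 0 1) x \<partial>lborel \<partial>lborel)"
proof -
  have [measurable]: "ball (0::real^2) 1 \<in> sets borel" by simp
  let ?G = "\<lambda>x y. ennreal (F x y) * indicator (ball 0 1) x"
  have G [measurable]: "(\<lambda>p. ?G (fst p) (snd p)) \<in> borel_measurable (lborel \<Otimes>\<^sub>M lborel)" by measurable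
  have G': "(\<lambda>p. ?G (snd p) (fst p)) \<in> borel_measurable (lborel \<Otimes>\<^sub>M lborel)"
  proof -
    have "(\<lambda>p::(real^2) \<times> (real^2). (snd p, fst p)) \<in> lborel \<Otimes>\<^sub>M lborel \<rightarrow>\<^sub>M lborel \<Otimes>\<^sub>M lborel"
      by measurable
    from measurable_compose[OF this G] show ?thesis by simp
  qed
  have "ennreal ((w (fst p) - w (snd p))\<^sup>2 * weight s p) \<le> ?G (fst p) (snd p) + ?G (snd p) (fst p)" for p
  proof -
    have le: "ennreal ((w x - w y)\<^sup>2 * frac_kernel s (x - y)) \<le> ?G x y" if "norm x < 1" for x y
      using assms(2)[OF that, of y] that by (simp add: ennreal_leI)
    consider "norm (fst p) < 1" | "norm (snd p) < 1" | "p \<notin> energy_domain"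
      by (auto simp: energy_domain_iff)
    then show ?thesis
    proof cases
      case 1
      then show ?thesis using le[of "fst p" "snd p"]
        by (intro add_increasing2) (auto simp: weight_def energy_domain_iff)
    next
      case 2
      then show ?thesis using le[of "snd p" "fst p"]
        by (intro add_increasing) (auto simp: weight_def energy_domain_iff power2_commute norm_minus_commute)
    qed (simp add: weight_def)
  qed
  then have "energy s w \<le> (\<integral>\<^sup>+p. ?G (fst p) (snd p) + ?G (snd p) (fst p) \<partial>(lborel \<Otimes>\<^sub>M lborel))"
    unfolding energy_def by (rule nn_integral_mono)
  also have "\<dots> = (\<integral>\<^sup>+p. ?G (fst p) (snd p) \<partial>(lborel \<Otimes>\<^sub>M lborel)) + (\<integral>\<^sup>+p. ?G (snd p) (fst p) \<partial>(lborel \<Otimes>\<^sub>M lborel))"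
    by (rule nn_integral_add[OF G G'])
  also have "(\<integral>\<^sup>+p. ?G (fst p) (snd p) \<partial>(lborel \<Otimes>\<^sub>M lborel)) = (\<integral>\<^sup>+x. \<integral>\<^sup>+y. ?G x y \<partial>lborel \<partial>lborel)"
    by (subst lborel.nn_integral_fst[symmetric]) simp_all
  also have "(\<integral>\<^sup>+p. ?G (snd p) (fst p) \<partial>(lborel \<Otimes>\<^sub>M lborel)) = (\<integral>\<^sup>+x. \<integral>\<^sup>+y. ?G x y \<partial>lborel \<partial>lborel)"
    using lborel_pair.nn_integral_snd[OF G'] by simp
  finally show ?thesis by (simp add: mult_2)
qed

lemma nn_integral_shifted_kernel_far:
  assumes s: "0 < s" and \<delta>: "0 < \<delta>"
  shows "(\<integral>\<^sup>+x. ennreal (indicator {h. \<delta> \<le> norm h} (x - y) * frac_kernel s (x - y)) \<partial>lborel)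
    \<le> ennreal (pi * (2 + 2 * s) / (2 * s) * \<delta> powr (- (2 * s)))"
proof -
  let ?f = "\<lambda>h::real^2. ennreal (indicator {h. \<delta> \<le> norm h} h * frac_kernel s h)"
  have "?f \<in> borel_measurable borel" by measurable
  from lborel_translate[OF this, of "- y"]
  have "(\<integral>\<^sup>+x. ?f (x - y) \<partial>lborel) = (\<integral>\<^sup>+h. ?f h \<partial>lborel)" by simp
  also have "\<dots> \<le> ennreal (pi * (2 + 2 * s) / (2 * s) * \<delta> powr (- (2 * s)))"
    using nn_integral_kernel_far[of "2 * s" \<delta>] s \<delta> by simp
  finally show ?thesis .
qed

text \<open>For an outer point \<open>y\<close> at distance \<open>\<delta> \<le> 1\<close> from the disc, the integral of the kernel over the disc is
  \<open>O(\<delta> powr (-2s))\<close>, which the square of the data compensates exactly; for distant \<open>y\<close> it decays like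
  the kernel itself.\<close>

lemma energy_ext_data_finite:
  assumes s: "0 < s" "s < 1" and A: "0 < A"
  shows "energy s (ext_data s A) < \<infinity>"
proof -
  have [measurable]: "ball (0::real^2) 1 \<in> sets borel" "cball (0::real^2) 2 \<in> sets borel" by simp_all
  let ?F = "\<lambda>x y. (ext_data s A y)\<^sup>2 * frac_kernel s (x - y)"
  define M where "M = A\<^sup>2 * (pi * (2 + 2 * s) / (2 * s))"
  have M: "0 \<le> M" using s by (simp add: M_def)
  have inner: "(\<integral>\<^sup>+x. ennreal (?F x y) * indicator (ball 0 1) x \<partial>lborel)
      \<le> ennreal M * indicator (cball 0 2) y + ennreal (A\<^sup>2 * pi * 2 powr (2 + 2 * s)) * ennreal (indicator {y. 2 \<le> norm y} y * frac_kernel s y)" for y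
  proof -
    consider "norm y \<le> 1" | "1 < norm y" "norm y \<le> 2" | "2 < norm y" by linarith
    then show ?thesis
    proof cases
      case 1
      then show ?thesis by (simp add: ext_data_inside)
    next
      case 2
      define \<delta> where "\<delta> = norm y - 1"
      have \<delta>: "0 < \<delta>" "\<delta> \<le> 1" using 2 by (auto simp: \<delta>_def)
      have ext: "(ext_data s A y)\<^sup>2 = A\<^sup>2 * \<delta> powr (2 * s)"
        using \<delta> by (simp add: ext_data_def power_mult_distrib flip: \<delta>_def)
          (simp add: power2_eq_square flip: powr_add)
      have "(\<integral>\<^sup>+x. ennreal (?F x y) * indicator (ball 0 1) x \<partial>lborel)
        \<le> (\<integral>\<^sup>+x. ennreal (A\<^sup>2 * \<delta> powr (2 * s)) * ennreal (indicator {h. \<delta> \<le> norm h} (x - y) * frac_kernel s (x - y)) \<partial>lborel)"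
      proof (rule nn_integral_mono)
        fix x :: "real^2"
        show "ennreal (?F x y) * indicator (ball 0 1) x
           \<le> ennreal (A\<^sup>2 * \<delta> powr (2 * s)) * ennreal (indicator {h. \<delta> \<le> norm h} (x - y) * frac_kernel s (x - y))"
        proof (cases "norm x < 1")
          case True
          then have "\<delta> \<le> norm (x - y)" using norm_triangle_ineq2[of y x] by (simp add: \<delta>_def norm_minus_commute)
          then show ?thesis using True by (simp add: ext flip: ennreal_mult)
        qed simp
      qed
      also have "\<dots> = ennreal (A\<^sup>2 * \<delta> powr (2 * s)) * (\<integral>\<^sup>+x. ennreal (indicator {h. \<delta> \<le> norm h} (x - y) * frac_kernel s (x - y)) \<partial>lborel)"
        by (rule nn_integral_cmult) measurable
      also have "\<dots> \<le> ennreal (A\<^sup>2 * \<delta> powr (2 * s)) * ennreal (pi * (2 + 2 * s) / (2 * s) * \<delta> powr (- (2 * s)))"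
        by (intro mult_left_mono nn_integral_shifted_kernel_far s \<delta>) simp
      also have "\<dots> = ennreal (M * (\<delta> powr (2 * s) * \<delta> powr (- (2 * s))))"
        using s by (simp add: M_def mult_ac flip: ennreal_mult)
      also have "\<delta> powr (2 * s) * \<delta> powr (- (2 * s)) = 1" using \<delta> by (simp flip: powr_add)
      finally show ?thesis using 2 by (simp add: add_increasing2)
    next
      case 3
      have "(\<integral>\<^sup>+x. ennreal (?F x y) * indicator (ball 0 1) x \<partial>lborel)
        \<le> (\<integral>\<^sup>+(x::real^2). ennreal (A\<^sup>2 * (2 powr (2 + 2 * s) * frac_kernel s y)) * indicator (ball 0 1) x \<partial>lborel)"
      proof (rule nn_integral_mono)
        fix x :: "real^2"
        show "ennreal (?F x y) * indicator (ball 0 1) x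
           \<le> ennreal (A\<^sup>2 * (2 powr (2 + 2 * s) * frac_kernel s y)) * indicator (ball 0 1) x"
        proof (cases "norm x < 1")
          case True
          have "norm y / 2 \<le> norm (x - y)"
            using norm_triangle_ineq2[of y x] True 3 by (simp add: norm_minus_commute)
          then have "frac_kernel s (x - y) \<le> (norm y / 2) powr (-2-2 * s)" using s 3 by (intro powr_mono2') auto
          also have "\<dots> = 2 powr (2 + 2 * s) * frac_kernel s y"
          proof -
            have e: "-2-2 * s = - (2 + 2 * s)" by simp
            show ?thesis unfolding e powr_divide powr_minus by (simp add: field_simps)
          qed
          finally have "?F x y \<le> A\<^sup>2 * (2 powr (2 + 2 * s) * frac_kernel s y)"
            using ext_data_bounds[of A s y] A s by (intro mult_mono power_mono) auto
          then show ?thesis by (intro mult_right_mono ennreal_leI) auto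
        qed simp
      qed
      also have "\<dots> = ennreal (A\<^sup>2 * (2 powr (2 + 2 * s) * frac_kernel s y)) * emeasure lborel (ball (0::real^2) 1)"
        by (rule nn_integral_cmult_indicator) simp
      also have "\<dots> = ennreal (A\<^sup>2 * pi * 2 powr (2 + 2 * s)) * ennreal (indicator {y. 2 \<le> norm y} y * frac_kernel s y)"
        using 3 by (simp add: emeasure_ball_R2 mult_ac flip: ennreal_mult)
      finally show ?thesis using 3 by simp
    qed
  qed
  have meas: "(\<lambda>p. ennreal (?F (fst p) (snd p)) * indicator (ball 0 1) (fst p)) \<in> borel_measurable (lborel \<Otimes>\<^sub>M lborel)"
    by measurable
  have le: "energy s (ext_data s A) \<le> 2 * (\<integral>\<^sup>+x. \<integral>\<^sup>+y. ennreal (?F x y) * indicator (ball 0 1) x \<partial>lborel \<partial>lborel)"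
    by (rule energy_le_by_symmetry) (simp_all add: ext_data_inside)
  have "(\<integral>\<^sup>+x. \<integral>\<^sup>+y. ennreal (?F x y) * indicator (ball 0 1) x \<partial>lborel \<partial>lborel)
     = (\<integral>\<^sup>+y. \<integral>\<^sup>+x. ennreal (?F x y) * indicator (ball 0 1) x \<partial>lborel \<partial>lborel)"
    using meas by (intro lborel_pair.Fubini') (simp add: split_beta')
  also have "\<dots> \<le> (\<integral>\<^sup>+y. ennreal M * indicator (cball 0 2) y + ennreal (A\<^sup>2 * pi * 2 powr (2 + 2 * s)) * ennreal (indicator {y. 2 \<le> norm y} y * frac_kernel s y) \<partial>lborel)"
    by (rule nn_integral_mono) (rule inner)
  also have "\<dots> = ennreal M * emeasure lborel (cball (0::real^2) 2)
     + ennreal (A\<^sup>2 * pi * 2 powr (2 + 2 * s)) * (\<integral>\<^sup>+(y::real^2). ennreal (indicator {y. 2 \<le> norm y} y * frac_kernel s y) \<partial>lborel)"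
    by (subst nn_integral_add) (simp_all add: nn_integral_cmult nn_integral_cmult_indicator)
  also have "\<dots> < \<infinity>"
  proof -
    have "(\<integral>\<^sup>+(y::real^2). ennreal (indicator {y. 2 \<le> norm y} y * frac_kernel s y) \<partial>lborel) < \<infinity>"
      using nn_integral_kernel_far[of "2 * s" 2] s by (auto intro: le_less_trans)
    then show ?thesis
      by (simp add: ennreal_mult_less_top emeasure_cball_R2)
  qed
  finally show ?thesis
    by (intro le_less_trans[OF le]) (simp add: ennreal_mult_less_top)
qed

lemma test_function_continuous:
  assumes "test_function \<Omega> \<eta>" shows "continuous_on UNIV \<eta>"
  using assms Ck_on.simps(1)[of UNIV \<eta>] unfolding test_function_def smooth_on_def by blast

text \<open>The partial derivatives are continuous and vanish off the compact support, hence are bounded.\<close>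

lemma test_function_Lipschitz:
  fixes \<eta> :: "'a::euclidean_space \<Rightarrow> real"
  assumes "test_function \<Omega> \<eta>"
  obtains L where "0 \<le> L" "\<And>x y. \<bar>\<eta> x - \<eta> y\<bar> \<le> L * norm (x - y)" "\<And>x. \<bar>\<eta> x\<bar> \<le> L"
proof -
  let ?S = "closure {x. \<eta> x \<noteq> 0}"
  have S: "compact ?S" using assms by (simp add: test_function_def)
  have "Ck_on (Suc 0) UNIV \<eta>" using assms unfolding test_function_def smooth_on_def by blast
  then have diff: "\<And>x. \<eta> differentiable (at x)"
    and cont: "\<And>b. b \<in> Basis \<Longrightarrow> continuous_on UNIV (\<lambda>x. frechet_derivative \<eta> (at x) b)" by auto
  have zero: "\<eta> x = 0" if "x \<notin> ?S" for x using that closure_subset[of "{x. \<eta> x \<noteq> 0}"] by auto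
  have dzero: "frechet_derivative \<eta> (at x) b = 0" if x: "x \<notin> ?S" for x b
  proof -
    have "(\<eta> has_derivative (\<lambda>h. 0)) (at x)"
    proof (rule has_derivative_transform_within_open[OF has_derivative_const])
      show "open (- ?S)" by (simp only: open_Compl closed_closure)
      show "x \<in> - ?S" using x by blast
      show "0 = \<eta> y" if "y \<in> - ?S" for y using zero[of y] that by simp
    qed
    from fun_cong[OF frechet_derivative_at[OF this], of b] show ?thesis by simp
  qed
  have "\<exists>M\<ge>0. \<forall>x. \<bar>f x\<bar> \<le> M" if "continuous_on UNIV f" "\<And>x. x \<notin> ?S \<Longrightarrow> f x = 0" for f :: "'a \<Rightarrow> real"
  proof -
    have "compact (f ` ?S)" using that(1) S by (intro compact_continuous_image) (auto intro: continuous_on_subset)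
    then obtain M where "\<And>x. x \<in> ?S \<Longrightarrow> \<bar>f x\<bar> \<le> M"
      by (metis bounded_real compact_imp_bounded image_eqI)
    then have "\<bar>f x\<bar> \<le> \<bar>M\<bar>" for x using that(2)[of x] by (cases "x \<in> ?S") force+
    then show ?thesis by (intro exI[of _ "\<bar>M\<bar>"]) auto
  qed
  note bd = this
  obtain M0 where M0: "0 \<le> M0" "\<And>x. \<bar>\<eta> x\<bar> \<le> M0"
    using bd[OF test_function_continuous[OF assms] zero] by blast
  have "\<forall>b\<in>Basis. \<exists>M\<ge>0. \<forall>x. \<bar>frechet_derivative \<eta> (at x) b\<bar> \<le> M"
    using bd cont dzero by blast
  then obtain M where M: "\<And>b. b \<in> Basis \<Longrightarrow> 0 \<le> M b" "\<And>b x. b \<in> Basis \<Longrightarrow> \<bar>frechet_derivative \<eta> (at x) b\<bar> \<le> M b"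
    by metis
  define L where "L = (\<Sum>b\<in>Basis. M b)"
  have L0: "0 \<le> L" unfolding L_def by (intro sum_nonneg M)
  have hd: "(\<eta> has_derivative frechet_derivative \<eta> (at x)) (at x within UNIV)" for x
    using diff[of x] by (simp add: frechet_derivative_works)
  have "onorm (frechet_derivative \<eta> (at x)) \<le> L" for x
  proof (rule onorm_le)
    fix h :: 'a
    have lin: "linear (frechet_derivative \<eta> (at x))"
      using hd[of x] has_derivative_linear by blast
    have "frechet_derivative \<eta> (at x) h = (\<Sum>b\<in>Basis. (h \<bullet> b) * frechet_derivative \<eta> (at x) b)"
      by (subst euclidean_representation[of h, symmetric])
         (simp add: linear_sum[OF lin] linear_scale[OF lin] del: euclidean_representation)
    also have "\<bar>\<dots>\<bar> \<le> (\<Sum>b\<in>Basis. \<bar>(h \<bullet> b) * frechet_derivative \<eta> (at x) b\<bar>)" by (rule sum_abs)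
    also have "\<dots> \<le> (\<Sum>b\<in>Basis. norm h * M b)"
      unfolding abs_mult by (intro sum_mono mult_mono M Basis_le_norm) auto
    finally show "norm (frechet_derivative \<eta> (at x) h) \<le> L * norm h"
      by (simp add: L_def sum_distrib_right sum_distrib_left mult.commute)
  qed
  then have Lip: "norm (\<eta> x - \<eta> y) \<le> L * norm (x - y)" for x y
    by (intro differentiable_bound[OF convex_UNIV hd]) auto
  have "\<bar>\<eta> x - \<eta> y\<bar> \<le> (L + M0) * norm (x - y)" for x y
  proof -
    have "\<bar>\<eta> x - \<eta> y\<bar> \<le> L * norm (x - y)" using Lip[of x y] by simp
    also have "\<dots> \<le> (L + M0) * norm (x - y)" using M0(1) by (intro mult_right_mono) auto
    finally show ?thesis .
  qed
  moreover have "\<bar>\<eta> x\<bar> \<le> L + M0" for x using M0(2)[of x] L0 by linarith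
  moreover have "0 \<le> L + M0" using L0 M0(1) by simp
  ultimately show thesis by (intro that[of "L + M0"])
qed

lemma energy_test_function_finite:
  assumes s: "0 < s" "s < 1" and \<eta>: "test_function (ball 0 1) \<eta>"
  shows "energy s \<eta> < \<infinity>"
proof -
  have [measurable]: "ball (0::real^2) 1 \<in> sets borel" by simp
  have [measurable]: "\<eta> \<in> borel_measurable borel"
    by (rule borel_measurable_continuous_onI[OF test_function_continuous[OF \<eta>]])
  obtain L where L: "0 \<le> L" "\<And>x y. \<bar>\<eta> x - \<eta> y\<bar> \<le> L * norm (x - y)" "\<And>x. \<bar>\<eta> x\<bar> \<le> L"
    using test_function_Lipschitz[OF \<eta>] by blast
  define h where "h z = (if norm z \<le> 1 then L\<^sup>2 * (norm z)\<^sup>2 else (2 * L)\<^sup>2)" for z :: "real^2"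
  have [measurable]: "h \<in> borel_measurable borel" unfolding h_def by measurable
  have int: "integrable lborel (\<lambda>z. h z * frac_kernel s z)"
    by (rule kernel_integrable[OF s, of _ 1 "L\<^sup>2" "(2 * L)\<^sup>2"]) (auto simp: h_def)
  have "energy s \<eta> \<le> 2 * (\<integral>\<^sup>+x. \<integral>\<^sup>+y. ennreal (h (x - y) * frac_kernel s (x - y)) * indicator (ball 0 1) x \<partial>lborel \<partial>lborel)"
  proof (rule energy_le_by_symmetry)
    show "(\<eta> x - \<eta> y)\<^sup>2 * frac_kernel s (x - y) \<le> h (x - y) * frac_kernel s (x - y)" for x y
    proof (rule mult_right_mono)
      have "\<bar>\<eta> x - \<eta> y\<bar> \<le> 2 * L" using L(3)[of x] L(3)[of y] by linarith
      then show "(\<eta> x - \<eta> y)\<^sup>2 \<le> h (x - y)"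
        using power_mono[OF L(2)[of x y], of 2] power_mono[of "\<bar>\<eta> x - \<eta> y\<bar>" "2 * L" 2]
        by (simp add: h_def power_mult_distrib)
    qed simp
  qed measurable
  also have "(\<integral>\<^sup>+x. \<integral>\<^sup>+y. ennreal (h (x - y) * frac_kernel s (x - y)) * indicator (ball 0 1) x \<partial>lborel \<partial>lborel)
     = (\<integral>\<^sup>+x. (\<integral>\<^sup>+z. ennreal (h z * frac_kernel s z) \<partial>lborel) * indicator (ball (0::real^2) 1) x \<partial>lborel)"
  proof (rule nn_integral_cong)
    fix x :: "real^2"
    have "(\<integral>\<^sup>+y. ennreal (h (x - y) * frac_kernel s (x - y)) \<partial>lborel) = (\<integral>\<^sup>+y. ennreal (h (- x + y) * frac_kernel s (- x + y)) \<partial>lborel)"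
    proof -
      have "norm (x - y) = norm (- x + y)" for y by (simp add: norm_minus_commute)
      then show ?thesis by (simp only: h_def)
    qed
    also have "\<dots> = (\<integral>\<^sup>+z. ennreal (h z * frac_kernel s z) \<partial>lborel)"
      by (rule lborel_translate[of "\<lambda>z. ennreal (h z * frac_kernel s z)"]) measurable
    finally show "(\<integral>\<^sup>+y. ennreal (h (x - y) * frac_kernel s (x - y)) * indicator (ball 0 1) x \<partial>lborel)
      = (\<integral>\<^sup>+z. ennreal (h z * frac_kernel s z) \<partial>lborel) * indicator (ball 0 1) x"
      by (simp add: nn_integral_multc)
  qed
  also have "\<dots> = (\<integral>\<^sup>+z. ennreal (h z * frac_kernel s z) \<partial>lborel) * emeasure lborel (ball (0::real^2) 1)"
    by (simp add: nn_integral_cmult_indicator)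
  also have "2 * \<dots> < \<infinity>"
  proof -
    have "(\<integral>\<^sup>+z. ennreal (h z * frac_kernel s z) \<partial>lborel) = ennreal (LBINT z. h z * frac_kernel s z)"
      by (rule nn_integral_eq_integral[OF int]) (simp add: h_def)
    then show ?thesis by (simp add: ennreal_mult_less_top emeasure_ball_R2)
  qed
  finally show ?thesis .
qed

text \<open>By the Poincare inequality the increments are small in mean square on the disc. Because of
  \<open>\<bar>w\<bar> \<le> 2 ^ (-n) + 2 ^ n * w\<^sup>2\<close> the rate \<open>8 ^ (-n)\<close> of the energies makes the increments summable in mean,
  so their sum is finite almost everywhere.\<close>

lemma minimizing_sequence_converges:
  fixes u :: "nat \<Rightarrow> real^2 \<Rightarrow> real"
  assumes s: "0 < s" and [measurable]: "\<And>n. u n \<in> borel_measurable borel"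
    and out: "\<And>n x. 1 \<le> norm x \<Longrightarrow> u n x = g x"
    and E: "\<And>n. energy s (\<lambda>x. (u (Suc n) x - u n x) / 2) \<le> ennreal ((1/8) ^ n)"
  shows "AE x in lborel. convergent (\<lambda>n. u n x)"
proof -
  define w where "w n x = (u (Suc n) x - u n x) / 2" for n x
  have w_meas [measurable]: "w n \<in> borel_measurable borel" for n unfolding w_def by measurable
  have w_out: "w n x = 0" if "1 \<le> norm x" for n x using out that by (simp add: w_def)
  define c where "c = pi * 5 powr (-2-2 * s)"
  have c: "c > 0" by (simp add: c_def)
  have L2: "(\<integral>\<^sup>+x. ennreal ((w n x)\<^sup>2) \<partial>lborel) \<le> ennreal ((1/8) ^ n / c)" for n
  proof -
    have "ennreal c * (\<integral>\<^sup>+x. ennreal ((w n x)\<^sup>2) \<partial>lborel) \<le> ennreal ((1/8) ^ n)"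
      using Poincare[OF s w_meas w_out, of n] E[of n] unfolding c_def w_def[abs_def] by (rule order_trans)
    then have "ennreal (1 / c) * (ennreal c * (\<integral>\<^sup>+x. ennreal ((w n x)\<^sup>2) \<partial>lborel)) \<le> ennreal (1 / c) * ennreal ((1/8) ^ n)"
      by (rule mult_left_mono) simp
    also have "ennreal (1 / c) * ennreal ((1/8) ^ n) = ennreal ((1/8) ^ n / c)"
      using c by (simp flip: ennreal_mult)
    also have "ennreal (1 / c) * (ennreal c * (\<integral>\<^sup>+x. ennreal ((w n x)\<^sup>2) \<partial>lborel)) = (\<integral>\<^sup>+x. ennreal ((w n x)\<^sup>2) \<partial>lborel)"
      using c by (simp add: mult.assoc[symmetric] flip: ennreal_mult)
    finally show ?thesis .
  qed
  have L1: "(\<integral>\<^sup>+x. ennreal \<bar>w n x\<bar> \<partial>lborel) \<le> ennreal ((1/2) ^ n * (pi + 1 / c))" for n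
  proof -
    have "(\<integral>\<^sup>+x. ennreal \<bar>w n x\<bar> \<partial>lborel) \<le> (\<integral>\<^sup>+x. ennreal ((1/2) ^ n) * indicator (ball 0 1) x + ennreal (2 ^ n) * ennreal ((w n x)\<^sup>2) \<partial>lborel)"
    proof (rule nn_integral_mono)
      fix x :: "real^2"
      show "ennreal \<bar>w n x\<bar> \<le> ennreal ((1/2) ^ n) * indicator (ball 0 1) x + ennreal (2 ^ n) * ennreal ((w n x)\<^sup>2)"
      proof (cases "norm x < 1")
        case True
        have "\<bar>w n x\<bar> \<le> (1/2) ^ n + 2 ^ n * (w n x)\<^sup>2"
        proof (cases "\<bar>w n x\<bar> \<le> (1/2) ^ n")
          case False
          then have "(1/2) ^ n * \<bar>w n x\<bar> \<le> \<bar>w n x\<bar> * \<bar>w n x\<bar>" by (intro mult_right_mono) auto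
          then have "2 ^ n * ((1/2) ^ n * \<bar>w n x\<bar>) \<le> 2 ^ n * (w n x)\<^sup>2"
            by (intro mult_left_mono) (auto simp: power2_eq_square)
          moreover have "2 ^ n * ((1/2) ^ n * \<bar>w n x\<bar>) = \<bar>w n x\<bar>" by (simp add: power_divide)
          moreover have "0 \<le> (1/2 :: real) ^ n" by simp
          ultimately show ?thesis by linarith
        qed (simp add: add_increasing2)
        then show ?thesis using True by (simp add: ennreal_leI flip: ennreal_mult ennreal_plus)
      qed (simp add: w_out)
    qed
    also have "\<dots> = ennreal ((1/2) ^ n) * emeasure lborel (ball (0::real^2) 1) + ennreal (2 ^ n) * (\<integral>\<^sup>+x. ennreal ((w n x)\<^sup>2) \<partial>lborel)"
    proof -
      have [measurable]: "ball (0::real^2) 1 \<in> sets borel" by simp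
      show ?thesis by (subst nn_integral_add) (simp_all add: nn_integral_cmult nn_integral_cmult_indicator)
    qed
    also have "\<dots> \<le> ennreal ((1/2) ^ n) * ennreal pi + ennreal (2 ^ n) * ennreal ((1/8) ^ n / c)"
      using L2[of n] by (intro add_mono mult_left_mono) (auto simp: emeasure_ball_R2)
    also have "\<dots> = ennreal ((1/2) ^ n * pi + (1/4) ^ n / c)"
    proof -
      have "2 ^ n * ((1/8) ^ n / c) = (1/4) ^ n / c" by (simp flip: power_mult_distrib)
      moreover have "ennreal ((1/2) ^ n) * ennreal pi = ennreal ((1/2) ^ n * pi)"
        by (rule ennreal_mult[symmetric]) auto
      moreover have "ennreal (2 ^ n) * ennreal ((1/8) ^ n / c) = ennreal (2 ^ n * ((1/8) ^ n / c))"
        using c by (intro ennreal_mult[symmetric]) auto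
      moreover have "ennreal ((1/2) ^ n * pi) + ennreal ((1/4) ^ n / c) = ennreal ((1/2) ^ n * pi + (1/4) ^ n / c)"
        using c by (intro ennreal_plus[symmetric]) auto
      ultimately show ?thesis by (simp only:)
    qed
    also have "\<dots> \<le> ennreal ((1/2) ^ n * (pi + 1 / c))"
      using c power_mono[of "1/4" "1/2::real" n] by (intro ennreal_leI) (simp add: distrib_left divide_right_mono)
    finally show ?thesis .
  qed
  have "(\<integral>\<^sup>+x. (\<Sum>n. ennreal \<bar>w n x\<bar>) \<partial>lborel) = (\<Sum>n. \<integral>\<^sup>+x. ennreal \<bar>w n x\<bar> \<partial>lborel)"
    by (rule nn_integral_suminf) measurable
  also have "\<dots> \<le> (\<Sum>n. ennreal ((1/2) ^ n * (pi + 1 / c)))"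
    by (intro suminf_le L1) auto
  also have "\<dots> < \<infinity>"
  proof -
    have "summable (\<lambda>n. (1/2::real) ^ n * (pi + 1 / c))"
      by (intro summable_mult2 summable_geometric) simp
    then show ?thesis using c by (subst suminf_ennreal2) (auto intro: add_nonneg_nonneg)
  qed
  finally have "(\<integral>\<^sup>+x. (\<Sum>n. ennreal \<bar>w n x\<bar>) \<partial>lborel) \<noteq> \<infinity>" by simp
  then have "AE x in lborel. (\<Sum>n. ennreal \<bar>w n x\<bar>) \<noteq> \<infinity>"
    by (intro nn_integral_noteq_infinite) measurable
  then show ?thesis
  proof eventually_elim
    case (elim x)
    have "summable (\<lambda>n. \<bar>w n x\<bar>)" using elim by (intro summable_suminf_not_top) auto
    then have "summable (\<lambda>n. w n x)" by (rule summable_rabs_cancel)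
    then have "summable (\<lambda>n. 2 * w n x)" by (rule summable_mult)
    moreover have "2 * w n x = u (Suc n) x - u n x" for n by (simp add: w_def)
    ultimately have "summable (\<lambda>n. u (Suc n) x - u n x)" by (simp only:)
    then have "convergent (\<lambda>n. \<Sum>k<n. u (Suc k) x - u k x)" by (simp add: summable_iff_convergent)
    then have "convergent (\<lambda>n. u n x - u 0 x)" by (simp add: sum_lessThan_telescope[of "\<lambda>k. u k x"])
    then have "convergent (\<lambda>n. (u n x - u 0 x) + u 0 x)" by (intro convergent_add convergent_const)
    then show ?case by simp
  qed
qed

section \<open>Existence and failure of boundary regularity\<close>

definition admissible :: "(real^2 \<Rightarrow> real) \<Rightarrow> (real^2 \<Rightarrow> real) set" where
  "admissible g = {u. u \<in> borel_measurable borel \<and> (\<forall>x. 1 \<le> norm x \<longrightarrow> u x = g x)}"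

lemma energy_parallelogram:
  assumes [measurable]: "a \<in> borel_measurable borel" "b \<in> borel_measurable borel"
  shows "energy s (\<lambda>x. (a x - b x) / 2) + energy s (\<lambda>x. (a x + b x) / 2) = ennreal (1/2) * (energy s a + energy s b)"
proof -
  have eq: "ennreal (((a x - b x) / 2 - (a y - b y) / 2)\<^sup>2 * weight s p) + ennreal (((a x + b x) / 2 - (a y + b y) / 2)\<^sup>2 * weight s p)
    = ennreal (1/2) * (ennreal ((a x - a y)\<^sup>2 * weight s p) + ennreal ((b x - b y)\<^sup>2 * weight s p))" for x y p
  proof -
    have "((a x - b x) / 2 - (a y - b y) / 2)\<^sup>2 * W + ((a x + b x) / 2 - (a y + b y) / 2)\<^sup>2 * W
      = (1/2) * ((a x - a y)\<^sup>2 * W + (b x - b y)\<^sup>2 * W)" for W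
      by (simp add: power2_eq_square field_simps)
    then show ?thesis
      using weight_nonneg[of s p] by (simp only: ennreal_plus[symmetric] ennreal_mult[symmetric] mult_nonneg_nonneg zero_le_power2 add_nonneg_nonneg divide_nonneg_nonneg zero_le_one zero_le_numeral)
  qed
  have "energy s (\<lambda>x. (a x - b x) / 2) + energy s (\<lambda>x. (a x + b x) / 2) =
    (\<integral>\<^sup>+p. ennreal (((a (fst p) - b (fst p)) / 2 - (a (snd p) - b (snd p)) / 2)\<^sup>2 * weight s p)
       + ennreal (((a (fst p) + b (fst p)) / 2 - (a (snd p) + b (snd p)) / 2)\<^sup>2 * weight s p) \<partial>(lborel \<Otimes>\<^sub>M lborel))"
    unfolding energy_def by (rule nn_integral_add[symmetric]) measurable
  also have "\<dots> = ennreal (1/2) * (\<integral>\<^sup>+p. ennreal ((a (fst p) - a (snd p))\<^sup>2 * weight s p)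
       + ennreal ((b (fst p) - b (snd p))\<^sup>2 * weight s p) \<partial>(lborel \<Otimes>\<^sub>M lborel))"
    unfolding eq by (rule nn_integral_cmult) measurable
  also have "(\<integral>\<^sup>+p. ennreal ((a (fst p) - a (snd p))\<^sup>2 * weight s p)
       + ennreal ((b (fst p) - b (snd p))\<^sup>2 * weight s p) \<partial>(lborel \<Otimes>\<^sub>M lborel)) = energy s a + energy s b"
    unfolding energy_def by (rule nn_integral_add) measurable
  finally show ?thesis .
qed

text \<open>The midpoint of two admissible functions is admissible, so the parallelogram identity bounds the energy
  of half the difference of two almost minimal functions by their excess over the infimum. A minimising
  sequence therefore converges almost everywhere, and the limit is minimal by Fatou's lemma.\<close>

lemma energy_minimizer_exists:
  fixes g :: "real^2 \<Rightarrow> real"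
  assumes s: "0 < s" and g: "g \<in> borel_measurable borel" and fin: "energy s g < \<infinity>"
  obtains u where "u \<in> admissible g" "\<And>v. v \<in> admissible g \<Longrightarrow> energy s u \<le> energy s v" "energy s u < \<infinity>"
proof -
  define I where "I = (INF v\<in>admissible g. energy s v)"
  have g_adm: "g \<in> admissible g" using g by (simp add: admissible_def)
  then have I_fin: "I < \<infinity>" using fin unfolding I_def by (meson INF_lower le_less_trans)
  have I_le: "I \<le> energy s v" if "v \<in> admissible g" for v
    unfolding I_def using that by (rule INF_lower)
  have "\<exists>v\<in>admissible g. energy s v < I + ennreal ((1/8) ^ n)" for n
  proof -
    have "I < I + ennreal ((1/8) ^ n)"
    proof -
      obtain r where "0 \<le> r" "I = ennreal r" using I_fin by (cases I) auto
      then show ?thesis by (simp add: ennreal_less_iff flip: ennreal_plus)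
    qed
    then show ?thesis unfolding I_def INF_less_iff .
  qed
  then obtain v where v: "\<And>n. v n \<in> admissible g" "\<And>n. energy s (v n) < I + ennreal ((1/8) ^ n)" by metis
  have v_meas [measurable]: "v n \<in> borel_measurable borel" for n using v(1) by (simp add: admissible_def)
  have v_out: "v n x = g x" if "1 \<le> norm x" for n x using v(1)[of n] that by (simp add: admissible_def)
  have cauchy: "energy s (\<lambda>x. (v (Suc n) x - v n x) / 2) \<le> ennreal ((1/8) ^ n)" for n
  proof -
    have "(\<lambda>x. (v (Suc n) x + v n x) / 2) \<in> admissible g"
      using v_out by (simp add: admissible_def)
    then have "energy s (\<lambda>x. (v (Suc n) x - v n x) / 2) + I
        \<le> energy s (\<lambda>x. (v (Suc n) x - v n x) / 2) + energy s (\<lambda>x. (v (Suc n) x + v n x) / 2)"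
      by (intro add_left_mono I_le)
    also have "\<dots> = ennreal (1/2) * (energy s (v (Suc n)) + energy s (v n))"
      by (rule energy_parallelogram) measurable
    also have "\<dots> \<le> ennreal (1/2) * ((I + ennreal ((1/8) ^ n)) + (I + ennreal ((1/8) ^ n)))"
    proof (intro mult_left_mono add_mono)
      have "energy s (v (Suc n)) \<le> I + ennreal ((1/8) ^ Suc n)" using v(2) less_imp_le by blast
      also have "\<dots> \<le> I + ennreal ((1/8) ^ n)" by (intro add_left_mono ennreal_leI) simp
      finally show "energy s (v (Suc n)) \<le> I + ennreal ((1/8) ^ n)" .
      show "energy s (v n) \<le> I + ennreal ((1/8) ^ n)" using v(2) less_imp_le by blast
    qed simp
    also have "\<dots> = ennreal ((1/8) ^ n) + I"
    proof -
      have "ennreal (1/2) * (Z + Z) = Z" for Z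
      proof -
        have "ennreal (1/2) * (Z + Z) = (ennreal (1/2) * 2) * Z" by (simp add: mult_2[symmetric] mult.assoc)
        also have "ennreal (1/2) * 2 = ennreal ((1/2) * 2)" by (subst ennreal_mult) auto
        finally show ?thesis by simp
      qed
      then show ?thesis by (simp add: add.commute)
    qed
    finally have "I + energy s (\<lambda>x. (v (Suc n) x - v n x) / 2) \<le> I + ennreal ((1/8) ^ n)"
      by (simp only: add.commute)
    then show ?thesis using I_fin by (auto simp: ennreal_add_left_cancel_le)
  qed
  have conv: "AE x in lborel. convergent (\<lambda>n. v n x)"
    by (rule minimizing_sequence_converges[OF s v_meas v_out cauchy])
  define u where "u x = lim (\<lambda>n. v n x)" for x
  have u_meas [measurable]: "u \<in> borel_measurable borel" unfolding u_def by measurable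
  have u_adm: "u \<in> admissible g" using v_out by (auto simp: admissible_def u_def)
  have ae: "AE p in lborel \<Otimes>\<^sub>M lborel. convergent (\<lambda>n. v n (fst p)) \<and> convergent (\<lambda>n. v n (snd p))"
  proof (rule lborel_pair.AE_pair_measure)
    have "{x \<in> space lborel. Cauchy (\<lambda>n. v n x)} \<in> sets lborel" by measurable
    then have [measurable]: "Measurable.pred borel (\<lambda>x. convergent (\<lambda>n. v n x))"
      by (simp add: pred_def Cauchy_convergent_iff)
    show "{p \<in> space (lborel \<Otimes>\<^sub>M lborel). convergent (\<lambda>n. v n (fst p)) \<and> convergent (\<lambda>n. v n (snd p))} \<in> sets (lborel \<Otimes>\<^sub>M lborel)"
      by measurable
    show "AE x in lborel. AE y in lborel. convergent (\<lambda>n. v n (fst (x, y))) \<and> convergent (\<lambda>n. v n (snd (x, y)))"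
      using conv
    proof eventually_elim
      case (elim x)
      from conv show ?case by eventually_elim (use elim in simp)
    qed
  qed
  have "energy s u = (\<integral>\<^sup>+p. liminf (\<lambda>n. ennreal ((v n (fst p) - v n (snd p))\<^sup>2 * weight s p)) \<partial>(lborel \<Otimes>\<^sub>M lborel))"
    unfolding energy_def
  proof (rule nn_integral_cong_AE)
    show "AE p in lborel \<Otimes>\<^sub>M lborel. ennreal ((u (fst p) - u (snd p))\<^sup>2 * weight s p) = liminf (\<lambda>n. ennreal ((v n (fst p) - v n (snd p))\<^sup>2 * weight s p))"
      using ae
    proof eventually_elim
      case (elim p)
      then have "(\<lambda>n. v n (fst p)) \<longlonglongrightarrow> u (fst p)" "(\<lambda>n. v n (snd p)) \<longlonglongrightarrow> u (snd p)"
        by (simp_all add: u_def convergent_LIMSEQ_iff)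
      then have "(\<lambda>n. ennreal ((v n (fst p) - v n (snd p))\<^sup>2 * weight s p)) \<longlonglongrightarrow> ennreal ((u (fst p) - u (snd p))\<^sup>2 * weight s p)"
        by (intro tendsto_ennrealI tendsto_mult tendsto_power tendsto_diff tendsto_const)
      from lim_imp_Liminf[OF _ this] show ?case by simp
    qed
  qed
  also have "\<dots> \<le> liminf (\<lambda>n. energy s (v n))"
    unfolding energy_def by (rule nn_integral_liminf) measurable
  also have "\<dots> \<le> liminf (\<lambda>n. I + ennreal ((1/8) ^ n))"
    by (intro Liminf_mono always_eventually allI less_imp_le v(2))
  also have "\<dots> = I"
  proof (rule lim_imp_Liminf)
    have "(\<lambda>n. ennreal ((1/8) ^ n)) \<longlonglongrightarrow> ennreal 0"
      by (intro tendsto_ennrealI LIMSEQ_realpow_zero) auto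
    then have "(\<lambda>n. I + ennreal ((1/8) ^ n)) \<longlonglongrightarrow> I + 0"
      by (intro tendsto_add tendsto_const) simp
    then show "(\<lambda>n. I + ennreal ((1/8) ^ n)) \<longlonglongrightarrow> I" by simp
  qed simp
  finally have "energy s u \<le> I" .
  then show thesis
    using that[OF u_adm] I_le I_fin by (meson le_less_trans order_trans)
qed

lemma quadratic_nonneg_imp_linear_zero:
  fixes B e :: real
  assumes "0 \<le> e" "\<And>\<tau>. 0 \<le> 2 * \<tau> * B + \<tau>\<^sup>2 * e"
  shows "B = 0"
proof (rule ccontr)
  assume "B \<noteq> 0"
  \<comment> \<open>Close to the minimum point \<open>- B / e\<close>, but meaningful also for \<open>e = 0\<close>.\<close>
  define \<tau> where "\<tau> = - B / (e + 1)"
  have "2 * \<tau> * B + \<tau>\<^sup>2 * e = - B\<^sup>2 * (e + 2) / (e + 1)\<^sup>2"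
    using assms(1) unfolding \<tau>_def by (simp add: power2_eq_square divide_simps) (simp add: algebra_simps)
  also have "\<dots> < 0" using assms(1) \<open>B \<noteq> 0\<close> by (simp add: divide_neg_pos)
  finally show False using assms(2)[of \<tau>] by simp
qed

lemma energy_integrable:
  assumes [measurable]: "w \<in> borel_measurable borel" and fin: "energy s w < \<infinity>"
  shows "integrable (lborel \<Otimes>\<^sub>M lborel) (\<lambda>p. (w (fst p) - w (snd p))\<^sup>2 * weight s p)"
    and "energy s w = ennreal (integral\<^sup>L (lborel \<Otimes>\<^sub>M lborel) (\<lambda>p. (w (fst p) - w (snd p))\<^sup>2 * weight s p))"
proof -
  show i: "integrable (lborel \<Otimes>\<^sub>M lborel) (\<lambda>p. (w (fst p) - w (snd p))\<^sup>2 * weight s p)"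
    using fin unfolding energy_def by (intro integrableI_nonneg) (auto simp: weight_nonneg)
  show "energy s w = ennreal (integral\<^sup>L (lborel \<Otimes>\<^sub>M lborel) (\<lambda>p. (w (fst p) - w (snd p))\<^sup>2 * weight s p))"
    unfolding energy_def by (rule nn_integral_eq_integral[OF i]) (simp add: weight_nonneg)
qed

text \<open>The energy of \<open>u + \<tau> * \<eta>\<close> is a quadratic polynomial in \<open>\<tau>\<close> with minimum at 0, and the bilinear form is its
  linear coefficient. The weight may be replaced by the kernel because \<open>\<eta>\<close> vanishes outside the disc.\<close>

lemma Euler_Lagrange:
  assumes u: "u \<in> admissible g" "\<And>v. v \<in> admissible g \<Longrightarrow> energy s u \<le> energy s v" and fin: "energy s u < \<infinity>"
    and [measurable]: "\<eta> \<in> borel_measurable borel" and \<eta>: "\<And>x. 1 \<le> norm x \<Longrightarrow> \<eta> x = 0" "energy s \<eta> < \<infinity>"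
  shows "has_bochner_integral (lborel \<Otimes>\<^sub>M lborel)
    (\<lambda>p. (u (fst p) - u (snd p)) * (\<eta> (fst p) - \<eta> (snd p)) * frac_kernel s (fst p - snd p)) 0"
proof -
  have [measurable]: "u \<in> borel_measurable borel" using u(1) by (simp add: admissible_def)
  let ?M = "lborel \<Otimes>\<^sub>M lborel :: ((real^2) \<times> (real^2)) measure"
  define a b where "a p = u (fst p) - u (snd p)" and "b p = \<eta> (fst p) - \<eta> (snd p)" for p
  have [measurable]: "a \<in> borel_measurable ?M" "b \<in> borel_measurable ?M" unfolding a_def b_def by measurable
  have a2: "integrable ?M (\<lambda>p. (a p)\<^sup>2 * weight s p)" and b2: "integrable ?M (\<lambda>p. (b p)\<^sup>2 * weight s p)"
    using energy_integrable(1)[OF _ fin] energy_integrable(1)[OF _ \<eta>(2)] by (simp_all add: a_def b_def)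
  have ab: "integrable ?M (\<lambda>p. a p * b p * weight s p)"
  proof (rule Bochner_Integration.integrable_bound[OF Bochner_Integration.integrable_add[OF a2 b2]])
    have "\<bar>a p * b p * weight s p\<bar> \<le> (a p)\<^sup>2 * weight s p + (b p)\<^sup>2 * weight s p" for p
    proof -
      have "\<bar>a p * b p\<bar> \<le> (a p)\<^sup>2 + (b p)\<^sup>2"
        using sum_squares_bound[of "\<bar>a p\<bar>" "\<bar>b p\<bar>"] mult_nonneg_nonneg[of "\<bar>a p\<bar>" "\<bar>b p\<bar>"]
        unfolding abs_mult power2_abs by linarith
      then have "\<bar>a p * b p\<bar> * weight s p \<le> ((a p)\<^sup>2 + (b p)\<^sup>2) * weight s p"
        by (intro mult_right_mono weight_nonneg)
      then show ?thesis using weight_nonneg[of s p] by (simp add: abs_mult distrib_right)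
    qed
    then show "AE p in ?M. norm (a p * b p * weight s p) \<le> norm ((a p)\<^sup>2 * weight s p + (b p)\<^sup>2 * weight s p)"
      by (intro AE_I2) (simp add: order_trans[OF _ abs_ge_self])
  qed measurable
  define B where "B = integral\<^sup>L ?M (\<lambda>p. a p * b p * weight s p)"
  define e where "e = integral\<^sup>L ?M (\<lambda>p. (b p)\<^sup>2 * weight s p)"
  define e0 where "e0 = integral\<^sup>L ?M (\<lambda>p. (a p)\<^sup>2 * weight s p)"
  have e: "0 \<le> e" and e0: "0 \<le> e0" unfolding e_def e0_def
    by (intro Bochner_Integration.integral_nonneg mult_nonneg_nonneg zero_le_power2 weight_nonneg)+
  have "0 \<le> 2 * \<tau> * B + \<tau>\<^sup>2 * e" for \<tau>
  proof -
    let ?v = "\<lambda>x. u x + \<tau> * \<eta> x"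
    have v: "?v \<in> admissible g" using u(1) \<eta>(1) by (auto simp: admissible_def)
    have [measurable]: "?v \<in> borel_measurable borel" by measurable
    have eq: "(?v (fst p) - ?v (snd p))\<^sup>2 * weight s p =
      (a p)\<^sup>2 * weight s p + 2 * \<tau> * (a p * b p * weight s p) + \<tau>\<^sup>2 * ((b p)\<^sup>2 * weight s p)" for p
      by (simp add: a_def b_def power2_eq_square algebra_simps)
    have int: "integrable ?M (\<lambda>p. (?v (fst p) - ?v (snd p))\<^sup>2 * weight s p)"
      unfolding eq by (intro Bochner_Integration.integrable_add integrable_mult_right a2 b2 ab)
    have "energy s ?v = ennreal (integral\<^sup>L ?M (\<lambda>p. (?v (fst p) - ?v (snd p))\<^sup>2 * weight s p))"
      unfolding energy_def by (rule nn_integral_eq_integral[OF int]) (simp add: weight_nonneg)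
    also have "integral\<^sup>L ?M (\<lambda>p. (?v (fst p) - ?v (snd p))\<^sup>2 * weight s p) = e0 + 2 * \<tau> * B + \<tau>\<^sup>2 * e"
      unfolding eq B_def e_def e0_def using a2 b2 ab by simp
    finally have ev: "energy s ?v = ennreal (e0 + 2 * \<tau> * B + \<tau>\<^sup>2 * e)" .
    have "energy s u = ennreal e0"
      using energy_integrable(2)[OF _ fin] by (simp add: e0_def a_def)
    then have "ennreal e0 \<le> ennreal (e0 + 2 * \<tau> * B + \<tau>\<^sup>2 * e)" using u(2)[OF v] ev by simp
    moreover have "0 \<le> e0 + 2 * \<tau> * B + \<tau>\<^sup>2 * e"
    proof -
      have "0 \<le> integral\<^sup>L ?M (\<lambda>p. (?v (fst p) - ?v (snd p))\<^sup>2 * weight s p)"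
        by (intro Bochner_Integration.integral_nonneg mult_nonneg_nonneg zero_le_power2 weight_nonneg)
      then show ?thesis unfolding eq B_def e_def e0_def using a2 b2 ab by simp
    qed
    ultimately have "e0 \<le> e0 + 2 * \<tau> * B + \<tau>\<^sup>2 * e" by simp
    then show ?thesis by simp
  qed
  then have "B = 0" using quadratic_nonneg_imp_linear_zero[OF e] by blast
  then have "has_bochner_integral ?M (\<lambda>p. a p * b p * weight s p) 0"
    using ab by (simp only: B_def has_bochner_integral_iff)
  moreover have "(\<lambda>p. a p * b p * weight s p) = (\<lambda>p. a p * b p * frac_kernel s (fst p - snd p))"
  proof
    show "a p * b p * weight s p = a p * b p * frac_kernel s (fst p - snd p)" for p
      by (cases "p \<in> energy_domain") (auto simp: weight_def energy_domain_iff b_def \<eta>(1))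
  qed
  ultimately show ?thesis by (simp only: a_def b_def)
qed

lemma weak_solution_exists:
  assumes s: "0 < s" "s < 1" and A: "0 < A"
  shows "\<exists>u. weak_solution s (ball 0 1) (ext_data s A) u"
proof -
  let ?g = "ext_data s A"
  obtain u where u: "u \<in> admissible ?g" "\<And>v. v \<in> admissible ?g \<Longrightarrow> energy s u \<le> energy s v" "energy s u < \<infinity>"
    using energy_minimizer_exists[OF s(1) _ energy_ext_data_finite[OF s A]] by auto
  have [measurable]: "u \<in> borel_measurable borel" using u(1) by (simp add: admissible_def)
  have k: "frac_kernel s y = inverse (norm y powr (2 + 2 * s))" for y
  proof -
    have "-2-2 * s = - (2 + 2 * s)" by simp
    then show ?thesis by (simp only: powr_minus)
  qed
  have "weak_solution s (ball 0 1) ?g u"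
    unfolding weak_solution_def
  proof (intro conjI allI impI ballI)
    show "u \<in> borel_measurable lebesgue" by (rule measurable_completion) simp
    show "u x = ?g x" if "x \<in> - ball 0 1" for x using u(1) that by (simp add: admissible_def)
    have "(\<integral>\<^sup>+ (x, y) \<in> UNIV - (- ball 0 1) \<times> (- ball 0 1). ennreal (\<bar>u x - u y\<bar>\<^sup>2 / norm (x - y) powr (2 + 2 * s)) \<partial>lebesgue)
      = (\<integral>\<^sup>+p. ennreal ((u (fst p) - u (snd p))\<^sup>2 * weight s p) \<partial>lebesgue)"
      by (intro nn_integral_cong) (auto simp: weight_def energy_domain_def k divide_inverse split: split_indicator)
    also have "\<dots> = (\<integral>\<^sup>+p. ennreal ((u (fst p) - u (snd p))\<^sup>2 * weight s p) \<partial>(lborel \<Otimes>\<^sub>M lborel))"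
    proof -
      have "(\<lambda>p. ennreal ((u (fst p) - u (snd p))\<^sup>2 * weight s p)) \<in> borel_measurable (lborel \<Otimes>\<^sub>M lborel)"
        by measurable
      then show ?thesis unfolding lborel_prod by (simp add: nn_integral_completion)
    qed
    also have "\<dots> < \<infinity>" using u(3) by (simp add: energy_def)
    finally show "(\<integral>\<^sup>+ (x, y) \<in> UNIV - (- ball 0 1) \<times> (- ball 0 1). ennreal (\<bar>u x - u y\<bar>\<^sup>2 / norm (x - y) powr (2 + 2 * s)) \<partial>lebesgue) < \<infinity>" .
  next
    fix \<eta> :: "real^2 \<Rightarrow> real" assume \<eta>: "test_function (ball 0 1) \<eta>"
    have \<eta>_meas: "\<eta> \<in> borel_measurable borel"
      by (rule borel_measurable_continuous_onI[OF test_function_continuous[OF \<eta>]])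
    have out: "\<eta> x = 0" if "1 \<le> norm x" for x
    proof (rule ccontr)
      assume "\<eta> x \<noteq> 0"
      then have "x \<in> closure {x. \<eta> x \<noteq> 0}" using closure_subset[of "{x. \<eta> x \<noteq> 0}"] by auto
      then have "x \<in> ball 0 1" using \<eta> unfolding test_function_def by blast
      then show False using that by simp
    qed
    let ?f = "\<lambda>p. (u (fst p) - u (snd p)) * (\<eta> (fst p) - \<eta> (snd p)) * frac_kernel s (fst p - snd p)"
    have "has_bochner_integral (lborel \<Otimes>\<^sub>M lborel) ?f 0"
      by (rule Euler_Lagrange[OF u \<eta>_meas out energy_test_function_finite[OF s \<eta>]])
    then have f: "has_bochner_integral lborel ?f 0" by (simp only: lborel_prod)
    moreover have "?f \<in> borel_measurable lborel" using f by (auto dest: borel_measurable_has_bochner_integral)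
    ultimately have "has_bochner_integral lebesgue ?f 0"
      by (simp add: has_bochner_integral_iff integrable_completion integral_completion)
    moreover have "?f = (\<lambda>(x, y). (u x - u y) * (\<eta> x - \<eta> y) / norm (x - y) powr (2 + 2 * s))"
      by (auto simp: fun_eq_iff k divide_inverse)
    ultimately show "has_bochner_integral lebesgue (\<lambda>(x, y). (u x - u y) * (\<eta> x - \<eta> y) / norm (x - y) powr (2 + 2 * s)) 0"
      by simp
  qed
  then show ?thesis by blast
qed

text \<open>With \<open>q = 1 - norm x ^ 2\<close> the barrier gives \<open>u x \<ge> q powr s * ln (1/q)\<close>, and Hoelder continuity together
  with \<open>u = 0\<close> on the circle gives \<open>u x \<le> C * q powr s\<close>. So \<open>ln (1/q)\<close> would be bounded.\<close>

lemma solution_not_Holder: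
  assumes s: "0 < s" "s < 1" and A: "0 < A"
    and sub: "strictly_subharmonic s (\<lambda>z. barrier s z + ext_data s A z)"
    and u: "solution s (ball 0 1) (ext_data s A) u"
  shows "u \<notin> holder_space s (cball 0 1)"
proof
  assume hol: "u \<in> holder_space s (cball 0 1)"
  have u_out: "u x = ext_data s A x" if "1 \<le> norm x" for x
    using u that by (auto simp: solution_def weak_solution_def viscosity_solution_def)
  obtain C where C: "C > 0" "\<And>x y. \<bar>u x - u y\<bar> \<le> C * norm (x - y) powr s"
    "\<And>x. norm x \<le> 1 \<Longrightarrow> \<bar>u x\<bar> \<le> C * (1 - norm x) powr s"
    using Holder_extension[OF s less_imp_le[OF A] u_out hol] by blast
  have above: "barrier s x \<le> u x" if "norm x < 1" for x
    using u viscosity_solution_above_barrier[OF s A sub _ that] weak_solution_above_barrier[OF s A sub _ C(1,2) that]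
    unfolding solution_def by blast
  \<comment> \<open>Then \<open>q \<le> 2 * \<tau>\<close> gives \<open>ln (1/q) \<ge> C + 2 > C\<close>.\<close>
  define \<tau> where "\<tau> = exp (- C - 2) / 2"
  have \<tau>: "0 < \<tau>" "\<tau> < 1" unfolding \<tau>_def using C(1) by (auto intro: less_trans[of _ "1/2"] simp: divide_less_eq) (smt (verit) exp_le_one_iff)
  define x :: "real^2" where "x = (1 - \<tau>) *\<^sub>R axis 1 1"
  have nx: "norm x = 1 - \<tau>" using \<tau> by (simp add: x_def norm_axis_1)
  define q where "q = 1 - x \<bullet> x"
  have "q = \<tau> * (2 - \<tau>)" unfolding q_def power2_norm_eq_inner[symmetric] nx by (simp add: power2_eq_square algebra_simps)
  then have q: "\<tau> \<le> q" "q \<le> 2 * \<tau>" "0 < q"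
    using \<tau> mult_left_mono[of 1 "2 - \<tau>" \<tau>] mult_left_mono[of "2 - \<tau>" 2 \<tau>] by auto
  have "ln q \<le> ln (2 * \<tau>)" using q by simp
  also have "\<dots> = - C - 2" by (simp add: \<tau>_def)
  finally have "C + 2 \<le> - ln q" by simp
  then have "q powr s * (C + 2) \<le> q powr s * (- ln q)" by (intro mult_left_mono) auto
  also have "\<dots> = barrier s x" using q by (simp add: barrier_def flip: q_def)
  also have "\<dots> \<le> u x" using above[of x] nx \<tau> by simp
  also have "\<dots> \<le> C * \<tau> powr s" using C(3)[of x] nx \<tau> by simp
  also have "\<dots> \<le> C * q powr s" using q \<tau> s C(1) by (intro mult_left_mono powr_mono2) auto
  finally show False using q by (simp add: algebra_simps)
qed

theorem proposition1p2:
  fixes s :: real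
  assumes "0 < s" and "s < 1"
  shows "\<exists>(\<Omega> :: (real^2) set) (C0 :: real) (g :: real^2 \<Rightarrow> real).
           bounded_smooth_domain \<Omega> \<and> C0 > 0 \<and>
           g \<in> borel_measurable (lebesgue_on (- \<Omega>)) \<and>
           (\<forall>x\<in>- \<Omega>. \<forall>z\<in>frontier \<Omega>. \<bar>g x - g z\<bar> \<le> C0 * norm (x - z) powr s) \<and>
           (\<forall>x\<in>- \<Omega>. \<bar>g x\<bar> \<le> C0 * (1 + norm x powr s)) \<and>
           (\<exists>u. solution s \<Omega> g u) \<and>
           (\<forall>u. solution s \<Omega> g u \<longrightarrow> u \<notin> holder_space s (closure \<Omega>))"
proof -
  obtain A where A: "A > 0" and sub: "strictly_subharmonic s (\<lambda>z. barrier s z + ext_data s A z)"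
    using strict_subsolution[OF assms] by blast
  have "ext_data s A \<in> borel_measurable (lebesgue_on (- ball 0 1))"
    by (intro measurable_restrict_space1 measurable_completion) simp
  moreover have "\<bar>ext_data s A x\<bar> \<le> A * (1 + norm x powr s)" for x
  proof -
    have "ext_data s A x \<le> A * 1" "0 \<le> ext_data s A x" using ext_data_bounds[of A s x] A assms by auto
    moreover have "A * 1 \<le> A * (1 + norm x powr s)" using A by (intro mult_left_mono) auto
    ultimately show ?thesis by linarith
  qed
  moreover have "\<exists>u. solution s (ball 0 1) (ext_data s A) u"
    using weak_solution_exists[OF assms A] by (auto simp: solution_def)
  ultimately show ?thesis
    using bounded_smooth_domain_unit_disc A ext_data_Holder[OF assms less_imp_le[OF A]]
      solution_not_Holder[OF assms A sub]
    by (intro exI[of _ "ball 0 1"] exI[of _ A] exI[of _ "ext_data s A"]) auto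
qed

end
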